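(* For all $n\in\mathbb N$ and $k\in\{1,\ldots,n\}$, $$ \binom{2n}{n}\tilde{\mathbf J}_{n,k}\Big(\frac{n+1}{2}\Big)=\binom nk\binom{n+k}{k}-\binom{n-2}{k}\binom{n-2+k}{k}, $$ with the conventions $\binom{-1}{1}=-1$ and $\binom01=\binom02=0$ (and $\binom ab=0$ for integers $0\le a<b$).
   Context: For $d\in\mathbb N$ and $\beta>d/2$ the $d$-dimensional beta' distribution has density $\tilde f_{d,\beta}(x)=\tilde c_{d,\beta}(1+\|x\|^2)^{-\beta}$ with $\tilde c_{d,\beta}=\Gamma(\beta)/(\pi^{d/2}\Gamma(\beta-\frac d2))$. The internal angle $\beta(F,T)$ of a simplex $T\subset\mathbb R^d$ at a face $F$ is $\lim_{r\downarrow0}\mathrm{Vol}_d(B_r(z)\cap T)/\mathrm{Vol}_d(B_r(z))$, $z$ in the relative interior of $F$ (full angle $=1$). For $n\ge2$, $\beta>\frac{n-1}{2}$ and $\tilde X_1,\ldots,\tilde X_n$ i.i.d. in $\mathbb R^{n-1}$ with density $\tilde f_{n-1,\beta}$, $\tilde{\mathbf J}_{n,k}(\beta)=\binom nk\,\mathbb E\,\beta([\tilde X_1,\ldots,\tilde X_k],[\tilde X_1,\ldots,\tilde X_n])$; by convention $\tilde{\mathbf J}_{n,n}(\beta)=1$ for all $n\in\mathbb N$. *)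

theory Defs
  imports "HOL-Probability.Probability"
begin

text \<open>Euclidean space R^d is modelled by extensional functions on {..<d}
  with d-dimensional Lebesgue (Borel) measure given as the product of lborel.\<close>

definition Rsp :: "nat \<Rightarrow> (nat \<Rightarrow> real) measure" where
  "Rsp d = PiM {..<d} (\<lambda>_. lborel)"

definition edist :: "nat \<Rightarrow> (nat \<Rightarrow> real) \<Rightarrow> (nat \<Rightarrow> real) \<Rightarrow> real" where
  "edist d x y = sqrt (\<Sum>i<d. (x i - y i)^2)"

definition eball :: "nat \<Rightarrow> (nat \<Rightarrow> real) \<Rightarrow> real \<Rightarrow> (nat \<Rightarrow> real) set" where
  "eball d z r = {x \<in> space (Rsp d). edist d x z < r}"

definition pcomb :: "nat \<Rightarrow> (nat \<Rightarrow> nat \<Rightarrow> real) \<Rightarrow> nat set \<Rightarrow> (nat \<Rightarrow> real) \<Rightarrow> (nat \<Rightarrow> real)" where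
  "pcomb d X I t = (\<lambda>j. if j < d then (\<Sum>i\<in>I. t i * X i j) else undefined)"

definition psimplex :: "nat \<Rightarrow> (nat \<Rightarrow> nat \<Rightarrow> real) \<Rightarrow> nat set \<Rightarrow> (nat \<Rightarrow> real) set" where
  "psimplex d X I = {pcomb d X I t | t. (\<forall>i\<in>I. 0 \<le> t i) \<and> (\<Sum>i\<in>I. t i) = 1}"

definition relint_simplex :: "nat \<Rightarrow> (nat \<Rightarrow> nat \<Rightarrow> real) \<Rightarrow> nat set \<Rightarrow> (nat \<Rightarrow> real) set" where
  "relint_simplex d X I = {pcomb d X I t | t. (\<forall>i\<in>I. 0 < t i) \<and> (\<Sum>i\<in>I. t i) = 1}"

definition internal_angle :: "nat \<Rightarrow> (nat \<Rightarrow> nat \<Rightarrow> real) \<Rightarrow> nat set \<Rightarrow> nat set \<Rightarrow> real" where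
  "internal_angle d X I J = (THE a. \<forall>z\<in>relint_simplex d X I.
      ((\<lambda>r. measure (Rsp d) (eball d z r \<inter> psimplex d X J) / measure (Rsp d) (eball d z r))
        \<longlongrightarrow> a) (at_right 0))"

definition beta'_const :: "nat \<Rightarrow> real \<Rightarrow> real" where
  "beta'_const d \<beta> = Gamma \<beta> / (pi powr (real d / 2) * Gamma (\<beta> - real d / 2))"

definition beta'_density :: "nat \<Rightarrow> real \<Rightarrow> (nat \<Rightarrow> real) \<Rightarrow> real" where
  "beta'_density d \<beta> x = beta'_const d \<beta> * (1 + (\<Sum>i<d. (x i)^2)) powr (-\<beta>)"

text \<open>E beta([X_1..X_k],[X_1..X_n]) for X_1..X_n i.i.d. beta' in R^(n-1)
  (points indexed 0..<n, face = first k points).\<close>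
definition expected_angle :: "nat \<Rightarrow> nat \<Rightarrow> real \<Rightarrow> real" where
  "expected_angle n k \<beta> = enn2real (\<integral>\<^sup>+ X. ennreal (internal_angle (n - 1) X {..<k} {..<n}
        * (\<Prod>i<n. beta'_density (n - 1) \<beta> (X i))) \<partial>(PiM {..<n} (\<lambda>_. Rsp (n - 1))))"

definition J_tilde :: "nat \<Rightarrow> nat \<Rightarrow> real \<Rightarrow> real" where
  "J_tilde n k \<beta> = (if k = n then 1 else real (n choose k) * expected_angle n k \<beta>)"

end

theory Submission
  imports Defs "Jordan_Normal_Form.Determinant"
begin

text \<open>Write \<open>d = n - 1\<close>. The angle of the simplex at the face is the Gaussian measure of the cone of all
  \<open>\<Sum>\<lambda>\<^sub>i X\<^sub>i\<close> with \<open>\<Sum>\<lambda>\<^sub>i = 0\<close> and \<open>\<lambda>\<^sub>i \<ge> 0\<close> for \<open>i \<ge> k\<close> (points numbered from 0). For \<open>\<beta> = d/2 + 1\<close> the points are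
  centred Gaussian vectors with independent exponentially distributed precisions \<open>s\<^sub>i\<close>. Given \<open>s\<close>, reflections
  show that the direction of \<open>\<lambda>\<close> is uniform with respect to the quadratic form \<open>\<Sum>\<lambda>\<^sub>i\<^sup>2/s\<^sub>i\<close> on the hyperplane
  \<open>\<Sum>\<lambda>\<^sub>i = 0\<close>, so that the expected angle is the Gaussian measure of the orthant \<open>\<lambda>\<^sub>i \<ge> 0\<close> (\<open>i \<ge> k\<close>) for this form.
  Integrating \<open>exp(- s - \<lambda>\<^sup>2/s)/\<surd>s\<close> over \<open>s\<close> turns the \<open>\<lambda>\<^sub>i\<close> into independent Laplace variables conditioned on sum
  zero. The Laplace density is, up to the factor 4, the convolution of the exponential density with its
  reflection; hence the expected angle is \<open>C(n+k-2, k-1) / C(2n-2, n-1)\<close>.\<close>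

section \<open>Lebesgue measure on finite products of the line\<close>

text \<open>The angle is a quotient of two integrals that both depend on the points, so its
  expectation is not a quotient of expectations. The remedy is
  \<open>nn_integral_homogeneous_ratio\<close>: in integrals of a radial profile times a function of
  degree 0 the profile may be exchanged. It is used three times: from small balls to a Gaussian,
  from the averaged density \<open>smoothed\<close> to the Gaussian of \<open>qform\<close>, and
  from exp(-S) to exp(-S)/sqrt S, where S is the sum of the precisions. The third exchange is the
  crux. Given the precisions, the Gaussian orthant probability has the normaliser pi^(d/2)
  sqrt(P/S), P the product of the precisions. The factor 1/sqrt P splits over coordinates, sqrt S
  does not. As the probability has degree 0 in s, a weight 1/sqrt S can be inserted at the price of
  a constant independent of k, and k = d + 1, where the probability is 1, determines it. Hence the
  denominator C(2n-2, n-1): the same Laplace integral without sign constraints. Jacobians of the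
  linear maps involved are not evaluated: they cancel in quotients, or belong to involutions and
  equal 1.\<close>

abbreviation leb :: "'i set \<Rightarrow> ('i \<Rightarrow> real) measure" where
  "leb K \<equiv> PiM K (\<lambda>_. lborel)"

definition vadd :: "'i set \<Rightarrow> ('i \<Rightarrow> real) \<Rightarrow> ('i \<Rightarrow> real) \<Rightarrow> ('i \<Rightarrow> real)" where
  "vadd K x y = (\<lambda>i\<in>K. x i + y i)"

definition vscale :: "'i set \<Rightarrow> real \<Rightarrow> ('i \<Rightarrow> real) \<Rightarrow> ('i \<Rightarrow> real)" where
  "vscale K t x = (\<lambda>i\<in>K. t * x i)"

interpretation lborel_prod: product_sigma_finite "\<lambda>_::'i. lborel :: real measure"
  by (rule product_sigma_finite.intro) (rule sigma_finite_lborel)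

lemma space_leb: "space (leb K) = (\<Pi>\<^sub>E i\<in>K. UNIV)"
  by (simp add: space_PiM)

lemma sigma_finite_leb: "finite K \<Longrightarrow> sigma_finite_measure (leb K)"
  by (rule lborel_prod.sigma_finite)

lemma vadd_in_space: "vadd K x y \<in> space (leb K)"
  by (simp add: vadd_def space_leb)

lemma vscale_in_space: "vscale K t x \<in> space (leb K)"
  by (simp add: vscale_def space_leb)

lemma measurable_vadd [measurable (raw)]:
  assumes "f \<in> M \<rightarrow>\<^sub>M leb K" "g \<in> M \<rightarrow>\<^sub>M leb K"
  shows "(\<lambda>x. vadd K (f x) (g x)) \<in> M \<rightarrow>\<^sub>M leb K"
proof -
  have "(\<lambda>x. f x i) \<in> borel_measurable M" "(\<lambda>x. g x i) \<in> borel_measurable M" if "i \<in> K" for i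
    using measurable_compose[OF assms(1) measurable_component_singleton[OF that]]
      measurable_compose[OF assms(2) measurable_component_singleton[OF that]] by simp_all
  then show ?thesis
    unfolding vadd_def by (intro measurable_restrict) simp
qed

lemma measurable_vscale [measurable (raw)]:
  assumes "f \<in> M \<rightarrow>\<^sub>M leb K" "t \<in> borel_measurable M"
  shows "(\<lambda>x. vscale K (t x) (f x)) \<in> M \<rightarrow>\<^sub>M leb K"
proof -
  note [measurable] = assms(2)
  have [measurable]: "(\<lambda>x. f x i) \<in> borel_measurable M" if "i \<in> K" for i
    using measurable_compose[OF assms(1) measurable_component_singleton[OF that]] by simp
  show ?thesis
    unfolding vscale_def by (intro measurable_restrict) simp
qed

lemma measurable_const_leb [measurable]: "c \<in> space (leb K) \<Longrightarrow> (\<lambda>x. c) \<in> M \<rightarrow>\<^sub>M leb K"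
  by (rule measurable_const)

lemma emeasure_lborel_vimage_affine:
  assumes "c > 0" "A \<in> sets borel"
  shows "emeasure lborel A = ennreal c * emeasure lborel ((\<lambda>x::real. t + c * x) -` A)"
proof -
  have "emeasure lborel A = (\<integral>\<^sup>+x. indicator A x \<partial>lborel)" using assms by simp
  also have "\<dots> = ennreal c * (\<integral>\<^sup>+x. indicator A (t + c * x) \<partial>lborel)"
    using assms by (subst nn_integral_real_affine[of _ c t]) auto
  also have "(\<integral>\<^sup>+x. indicator A (t + c * x) \<partial>lborel) = 
      (\<integral>\<^sup>+x. indicator ((\<lambda>x::real. t + c * x) -` A) x \<partial>lborel)"
    by (simp add: indicator_def vimage_def)
  also have "\<dots> = emeasure lborel ((\<lambda>x::real. t + c * x) -` A)"
    using assms(2) by (intro nn_integral_indicator) (simp add: measurable_sets_borel[where M=borel])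
  finally show ?thesis .
qed

text \<open>Boxes determine a product measure, and on a box the identity splits into one-dimensional
  affine substitutions. A coordinatewise shift \<open>t\<close> with a common factor
  \<open>c\<close> covers translations and dilations at once.\<close>

lemma nn_integral_leb_affine:
  assumes K: "finite K" and c: "c > 0" and F [measurable]: "F \<in> borel_measurable (leb K)"
  shows "(\<integral>\<^sup>+x. F x \<partial>leb K) = ennreal (c ^ card K) * (\<integral>\<^sup>+x. F (\<lambda>i\<in>K. t i + c * x i) \<partial>leb K)"
proof -
  let ?T = "\<lambda>x. \<lambda>i\<in>K. t i + c * x i"
  have T [measurable]: "?T \<in> leb K \<rightarrow>\<^sub>M leb K"
    by (intro measurable_restrict) simp
  define P where "P = density (distr (leb K) (leb K) ?T) (\<lambda>_. ennreal (c ^ card K))"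
  have "P = leb K"
  proof (rule lborel_prod.PiM_eqI[OF K])
    show "sets P = sets (leb K)" by (simp add: P_def)
    fix A :: "'a \<Rightarrow> real set" assume A: "\<And>i. i \<in> K \<Longrightarrow> A i \<in> sets lborel"
    have box: "Pi\<^sub>E K A \<in> sets (leb K)" using A K by (intro sets_PiM_I_finite) auto
    have pre: "?T -` Pi\<^sub>E K A \<inter> space (leb K) = (\<Pi>\<^sub>E i\<in>K. (\<lambda>x. t i + c * x) -` A i)"
      by (auto simp: space_leb PiE_iff)
    have "emeasure P (Pi\<^sub>E K A) = ennreal (c ^ card K) * emeasure (leb K) (\<Pi>\<^sub>E i\<in>K. (\<lambda>x. t i + c * x) -` A i)"
      unfolding P_def using box
      by (simp add: emeasure_density nn_integral_cmult emeasure_distr pre)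
    also have "emeasure (leb K) (\<Pi>\<^sub>E i\<in>K. (\<lambda>x. t i + c * x) -` A i) 
        = (\<Prod>i\<in>K. emeasure lborel ((\<lambda>x. t i + c * x) -` A i))"
      using A K by (intro lborel_prod.emeasure_PiM) (auto intro!: measurable_sets_borel[where M=borel])
    also have "ennreal (c ^ card K) * \<dots> = (\<Prod>i\<in>K. ennreal c * emeasure lborel ((\<lambda>x. t i + c * x) -` A i))"
      using c by (simp add: prod.distrib ennreal_power)
    also have "\<dots> = (\<Prod>i\<in>K. emeasure lborel (A i))"
      using A c by (intro prod.cong refl emeasure_lborel_vimage_affine[symmetric]) auto
    finally show "emeasure P (Pi\<^sub>E K A) = (\<Prod>i\<in>K. emeasure lborel (A i))" .
  qed
  then have "(\<integral>\<^sup>+x. F x \<partial>leb K) = (\<integral>\<^sup>+x. F x \<partial>P)" by simp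
  also have "\<dots> = ennreal (c ^ card K) * (\<integral>\<^sup>+x. F (?T x) \<partial>leb K)"
    unfolding P_def by (simp add: nn_integral_density nn_integral_cmult nn_integral_distr)
  finally show ?thesis .
qed

lemma nn_integral_leb_translate:
  assumes "finite K" "F \<in> borel_measurable (leb K)"
  shows "(\<integral>\<^sup>+x. F (vadd K x c) \<partial>leb K) = (\<integral>\<^sup>+x. F x \<partial>leb K)"
  using nn_integral_leb_affine[of K 1 F c] assms by (simp add: vadd_def add.commute)

lemma nn_integral_leb_scale:
  assumes "finite K" "t > 0" "F \<in> borel_measurable (leb K)"
  shows "(\<integral>\<^sup>+x. F x \<partial>leb K) = ennreal (t ^ card K) * (\<integral>\<^sup>+x. F (vscale K t x) \<partial>leb K)"
  using nn_integral_leb_affine[of K t F "\<lambda>_. 0"] assms by (simp add: vscale_def)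

lemma nn_integral_leb_swap:
  assumes K: "finite K" "finite K'"
    and f: "(\<lambda>(x, y). f x y) \<in> borel_measurable (leb K \<Otimes>\<^sub>M leb K')"
  shows "(\<integral>\<^sup>+x. \<integral>\<^sup>+y. f x y \<partial>leb K' \<partial>leb K) = (\<integral>\<^sup>+y. \<integral>\<^sup>+x. f x y \<partial>leb K \<partial>leb K')"
proof -
  interpret A: sigma_finite_measure "leb K" by (rule sigma_finite_leb[OF K(1)])
  interpret B: sigma_finite_measure "leb K'" by (rule sigma_finite_leb[OF K(2)])
  interpret pair_sigma_finite "leb K" "leb K'" ..
  from Fubini'[OF f] show ?thesis by simp
qed

text \<open>A translation-invariant measure is a multiple of Lebesgue measure, by the usual Fubini argument.\<close>

lemma nn_integral_leb_additive_aux: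
  fixes T :: "('i \<Rightarrow> real) \<Rightarrow> ('j \<Rightarrow> real)"
  assumes K: "finite K" "finite K'"
    and T [measurable]: "T \<in> leb K \<rightarrow>\<^sub>M leb K'" and S [measurable]: "S \<in> leb K' \<rightarrow>\<^sub>M leb K"
    and TS: "\<And>y. y \<in> space (leb K') \<Longrightarrow> T (S y) = y"
    and add: "\<And>x y. x \<in> space (leb K) \<Longrightarrow> y \<in> space (leb K) \<Longrightarrow> T (vadd K x y) = vadd K' (T x) (T y)"
  shows "\<exists>c. \<forall>F\<in>borel_measurable (leb K'). (\<integral>\<^sup>+x. F (T x) \<partial>leb K) = c * (\<integral>\<^sup>+y. F y \<partial>leb K')"
proof -
  define Q where "Q = (\<Pi>\<^sub>E i\<in>K'. {0..1::real})"
  define g :: "('j \<Rightarrow> real) \<Rightarrow> ennreal" where "g = indicator Q"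
  have Q: "Q \<in> sets (leb K')" unfolding Q_def using K by (intro sets_PiM_I_finite) auto
  then have g [measurable]: "g \<in> borel_measurable (leb K')" unfolding g_def by simp
  have g1: "(\<integral>\<^sup>+y. g y \<partial>leb K') = 1"
    using Q K unfolding g_def by (simp add: Q_def lborel_prod.emeasure_PiM)
  have Tsp: "T x \<in> space (leb K')" if "x \<in> space (leb K)" for x
    using measurable_space[OF T that] .
  have Ssp: "S x \<in> space (leb K)" if "x \<in> space (leb K')" for x
    using measurable_space[OF S that] .
  \<comment> \<open>The value that survives: insert the unit mass of \<open>g\<close>, shift x by
    \<open>S y\<close> so that \<open>F\<close> sees T x + y, swap, and shift y by - T x so that
    \<open>F\<close> sees y alone. The remaining x-integral of g(y - T x) loses its y after another
    shift of x by \<open>S y\<close>, which leaves \<open>c\<close>.\<close>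
  define c where "c = (\<integral>\<^sup>+x. g (vscale K' (-1) (T x)) \<partial>leb K)"
  have "(\<integral>\<^sup>+x. F (T x) \<partial>leb K) = c * (\<integral>\<^sup>+y. F y \<partial>leb K')" if F [measurable]: "F \<in> borel_measurable (leb K')" for F
  proof -
    have "(\<integral>\<^sup>+x. F (T x) \<partial>leb K) = (\<integral>\<^sup>+y. g y * (\<integral>\<^sup>+x. F (T x) \<partial>leb K) \<partial>leb K')"
      by (simp add: nn_integral_multc g1)
    also have "\<dots> = (\<integral>\<^sup>+y. \<integral>\<^sup>+x. g y * F (vadd K' (T x) y) \<partial>leb K \<partial>leb K')"
    proof (rule nn_integral_cong)
      fix y assume y: "y \<in> space (leb K')"
      have "(\<integral>\<^sup>+x. F (T x) \<partial>leb K) = (\<integral>\<^sup>+x. F (T (vadd K x (S y))) \<partial>leb K)"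
        by (rule nn_integral_leb_translate[symmetric, OF K(1)]) measurable
      also have "\<dots> = (\<integral>\<^sup>+x. F (vadd K' (T x) y) \<partial>leb K)"
        by (intro nn_integral_cong) (simp add: add Ssp y TS)
      finally show "g y * (\<integral>\<^sup>+x. F (T x) \<partial>leb K) = (\<integral>\<^sup>+x. g y * F (vadd K' (T x) y) \<partial>leb K)"
        using y by (simp add: nn_integral_cmult)
    qed
    also have "\<dots> = (\<integral>\<^sup>+x. \<integral>\<^sup>+y. g y * F (vadd K' (T x) y) \<partial>leb K' \<partial>leb K)"
      by (rule nn_integral_leb_swap[symmetric, OF K]) measurable
    also have "\<dots> = (\<integral>\<^sup>+x. \<integral>\<^sup>+y. g (vadd K' y (vscale K' (-1) (T x))) * F y \<partial>leb K' \<partial>leb K)"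
    proof (rule nn_integral_cong)
      fix x assume x: "x \<in> space (leb K)"
      have *: "vadd K' (T x) (vadd K' y (vscale K' (- 1) (T x))) = y" if "y \<in> space (leb K')" for y
        using that by (auto simp: vadd_def vscale_def space_leb fun_eq_iff PiE_iff extensional_def)
      have "(\<integral>\<^sup>+y. g y * F (vadd K' (T x) y) \<partial>leb K') = 
          (\<integral>\<^sup>+y. g (vadd K' y (vscale K' (-1) (T x))) * F (vadd K' (T x) (vadd K' y (vscale K' (-1) (T x)))) \<partial>leb K')"
        using Tsp[OF x] by (intro nn_integral_leb_translate[symmetric, OF K(2)]) measurable
      then show "(\<integral>\<^sup>+y. g y * F (vadd K' (T x) y) \<partial>leb K') = (\<integral>\<^sup>+y. g (vadd K' y (vscale K' (-1) (T x))) * F y \<partial>leb K')"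
        by (simp add: * cong: nn_integral_cong)
    qed
    also have "\<dots> = (\<integral>\<^sup>+y. \<integral>\<^sup>+x. g (vadd K' y (vscale K' (-1) (T x))) * F y \<partial>leb K \<partial>leb K')"
      by (rule nn_integral_leb_swap[OF K]) measurable
    also have "\<dots> = (\<integral>\<^sup>+y. c * F y \<partial>leb K')"
    proof (rule nn_integral_cong)
      fix y assume y: "y \<in> space (leb K')"
      have "(\<integral>\<^sup>+x. g (vadd K' y (vscale K' (-1) (T x))) \<partial>leb K) =
        (\<integral>\<^sup>+x. g (vadd K' y (vscale K' (-1) (T (vadd K x (S y))))) \<partial>leb K)"
        using y by (intro nn_integral_leb_translate[symmetric, OF K(1)]) measurable
      also have "\<dots> = c" unfolding c_def
        by (intro nn_integral_cong arg_cong[where f=g], simp add: add Ssp y TS)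
           (auto simp: vadd_def vscale_def fun_eq_iff)
      finally show "(\<integral>\<^sup>+x. g (vadd K' y (vscale K' (-1) (T x))) * F y \<partial>leb K) = c * F y"
        using y by (simp add: nn_integral_multc)
    qed
    also have "\<dots> = c * (\<integral>\<^sup>+y. F y \<partial>leb K')" by (simp add: nn_integral_cmult)
    finally show ?thesis .
  qed
  then show ?thesis by blast
qed

text \<open>The inverse \<open>S\<close> is additive as well and has its own constant. Testing the
  unit cube on \<open>S (T x) = x\<close> shows that the two constants multiply to 1, so neither is
  0 or infinite. Measurability and additivity replace linearity, and no determinant has to be
  evaluated.\<close>

lemma nn_integral_leb_additive_iso:
  fixes T :: "('i \<Rightarrow> real) \<Rightarrow> ('j \<Rightarrow> real)"
  assumes K: "finite K" "finite K'"
    and T [measurable]: "T \<in> leb K \<rightarrow>\<^sub>M leb K'" and S [measurable]: "S \<in> leb K' \<rightarrow>\<^sub>M leb K"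
    and TS: "\<And>y. y \<in> space (leb K') \<Longrightarrow> T (S y) = y"
    and ST: "\<And>x. x \<in> space (leb K) \<Longrightarrow> S (T x) = x"
    and add: "\<And>x y. x \<in> space (leb K) \<Longrightarrow> y \<in> space (leb K) \<Longrightarrow> T (vadd K x y) = vadd K' (T x) (T y)"
  obtains c where "0 < c" "c < \<infinity>"
    "\<And>F. F \<in> borel_measurable (leb K') \<Longrightarrow> (\<integral>\<^sup>+x. F (T x) \<partial>leb K) = c * (\<integral>\<^sup>+y. F y \<partial>leb K')"
proof -
  have Tsp: "T x \<in> space (leb K')" if "x \<in> space (leb K)" for x
    using measurable_space[OF T that] .
  have Ssp: "S x \<in> space (leb K)" if "x \<in> space (leb K')" for x
    using measurable_space[OF S that] .
  have addS: "S (vadd K' x y) = vadd K (S x) (S y)" if "x \<in> space (leb K')" "y \<in> space (leb K')" for x y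
    using add[of "S x" "S y"] that Ssp ST[OF vadd_in_space] TS by metis
  obtain c where c: "\<And>F. F \<in> borel_measurable (leb K') \<Longrightarrow> (\<integral>\<^sup>+x. F (T x) \<partial>leb K) = c * (\<integral>\<^sup>+y. F y \<partial>leb K')"
    using nn_integral_leb_additive_aux[OF K T S TS add] by blast
  obtain c' where c': "\<And>F. F \<in> borel_measurable (leb K) \<Longrightarrow> (\<integral>\<^sup>+x. F (S x) \<partial>leb K') = c' * (\<integral>\<^sup>+y. F y \<partial>leb K)"
    using nn_integral_leb_additive_aux[OF K(2,1) S T ST addS] by blast
  define Q where "Q = (\<Pi>\<^sub>E i\<in>K. {0..1::real})"
  define g :: "('i \<Rightarrow> real) \<Rightarrow> ennreal" where "g = indicator Q"
  have Q: "Q \<in> sets (leb K)" unfolding Q_def using K by (intro sets_PiM_I_finite) auto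
  then have g [measurable]: "g \<in> borel_measurable (leb K)" unfolding g_def by simp
  have g1: "(\<integral>\<^sup>+y. g y \<partial>leb K) = 1"
    using Q K unfolding g_def by (simp add: Q_def lborel_prod.emeasure_PiM)
  have "1 = (\<integral>\<^sup>+x. g (S (T x)) \<partial>leb K)"
    by (simp add: ST g1 cong: nn_integral_cong)
  also have "\<dots> = c * (\<integral>\<^sup>+x. g (S x) \<partial>leb K')" by (rule c) measurable
  also have "\<dots> = c * c'" by (simp add: c' g1)
  finally have cc: "c * c' = 1" by simp
  then have "c \<noteq> 0" "c' \<noteq> 0" by auto
  then have "c \<noteq> \<infinity>" using cc by (auto simp: ennreal_top_mult)
  show thesis
    by (rule that[of c]) (use \<open>c \<noteq> 0\<close> \<open>c \<noteq> \<infinity>\<close> c in \<open>auto simp: less_top zero_less_iff_neq_zero\<close>)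
qed

text \<open>For an involution the unknown constant satisfies \<open>c * c = 1\<close>, hence is 1.
  This is how the reflections below get Jacobian 1.\<close>

lemma nn_integral_leb_additive_involution:
  assumes K: "finite K"
    and T [measurable]: "T \<in> leb K \<rightarrow>\<^sub>M leb K"
    and TT: "\<And>x. x \<in> space (leb K) \<Longrightarrow> T (T x) = x"
    and add: "\<And>x y. x \<in> space (leb K) \<Longrightarrow> y \<in> space (leb K) \<Longrightarrow> T (vadd K x y) = vadd K (T x) (T y)"
    and F [measurable]: "F \<in> borel_measurable (leb K)"
  shows "(\<integral>\<^sup>+x. F (T x) \<partial>leb K) = (\<integral>\<^sup>+x. F x \<partial>leb K)"
proof -
  obtain c where c: "0 < c" "c < \<infinity>" "\<And>F. F \<in> borel_measurable (leb K) \<Longrightarrow> (\<integral>\<^sup>+x. F (T x) \<partial>leb K) = c * (\<integral>\<^sup>+y. F y \<partial>leb K)"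
    using nn_integral_leb_additive_iso[OF K K T T TT TT add] by blast
  define Q where "Q = (\<Pi>\<^sub>E i\<in>K. {0..1::real})"
  define g :: "('a \<Rightarrow> real) \<Rightarrow> ennreal" where "g = indicator Q"
  have Q: "Q \<in> sets (leb K)" unfolding Q_def using K by (intro sets_PiM_I_finite) auto
  then have g [measurable]: "g \<in> borel_measurable (leb K)" unfolding g_def by simp
  have g1: "(\<integral>\<^sup>+y. g y \<partial>leb K) = 1"
    using Q K unfolding g_def by (simp add: Q_def lborel_prod.emeasure_PiM)
  have "1 = (\<integral>\<^sup>+x. g (T (T x)) \<partial>leb K)"
    by (simp add: TT g1 cong: nn_integral_cong)
  also have "\<dots> = c * (\<integral>\<^sup>+x. g (T x) \<partial>leb K)" by (rule c(3)) measurable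
  also have "\<dots> = c * c" by (simp add: c(3) g1)
  finally have cc: "c * c = 1" by simp
  obtain r where r: "c = ennreal r" "r \<ge> 0" using c(2) by (cases c) auto
  have "ennreal (r * r) = ennreal 1" using cc r by (simp add: ennreal_mult)
  then have "r * r = 1" using r(2) by (subst (asm) ennreal_inj) auto
  then have "r = 1" using r(2) by (metis abs_of_nonneg mult_cancel_right1 power2_eq_1_iff power2_eq_square abs_minus abs_one)
  then show ?thesis using c(3)[OF F] r by simp
qed

text \<open>With u = exp a, the measure exp(card K * a) da is the radial part of Lebesgue measure in
  polar coordinates. The left product is a double integral over x and a, and dilating x by exp(-a)
  turns \<phi>(N x) \<psi>(exp a N x) into \<phi>(exp(-a) N x) \<psi>(N x). Using dilations avoids
  constructing a surface measure.\<close>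

lemma nn_integral_mellin_swap:
  fixes N :: "('i \<Rightarrow> real) \<Rightarrow> real" and G :: "('i \<Rightarrow> real) \<Rightarrow> ennreal" and \<phi> \<psi> :: "real \<Rightarrow> ennreal"
  assumes K: "finite K"
    and N [measurable]: "N \<in> borel_measurable (leb K)" and G [measurable]: "G \<in> borel_measurable (leb K)"
    and \<phi> [measurable]: "\<phi> \<in> borel_measurable borel" and \<psi> [measurable]: "\<psi> \<in> borel_measurable borel"
    and N_scale: "\<And>t x. t > 0 \<Longrightarrow> x \<in> space (leb K) \<Longrightarrow> N (vscale K t x) = t * N x"
    and G_scale: "\<And>t x. t > 0 \<Longrightarrow> x \<in> space (leb K) \<Longrightarrow> G (vscale K t x) = G x"
    and pos: "AE x in leb K. G x = 0 \<or> N x > 0"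
  shows "(\<integral>\<^sup>+x. \<phi> (N x) * G x \<partial>leb K) * (\<integral>\<^sup>+a. \<psi> (exp a) * ennreal (exp (card K * a)) \<partial>lborel)
       = (\<integral>\<^sup>+x. \<psi> (N x) * G x \<partial>leb K) * (\<integral>\<^sup>+a. \<phi> (exp a) * ennreal (exp (card K * a)) \<partial>lborel)"
proof -
  interpret A: sigma_finite_measure "leb K" by (rule sigma_finite_leb[OF K])
  interpret B: sigma_finite_measure "lborel :: real measure" by (rule sigma_finite_lborel)
  interpret pair_sigma_finite "leb K" "lborel :: real measure" ..
  define \<kappa> where "\<kappa> = card K"
  define m where "m f = (\<integral>\<^sup>+a. f (exp a) * ennreal (exp (\<kappa> * a)) \<partial>lborel)" for f :: "real \<Rightarrow> ennreal"
  \<comment> \<open>Translation of a by ln r, to be used with r = \<open>N x\<close>. Where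
    \<open>N x\<close> is not positive, \<open>pos\<close> makes \<open>G x\<close> vanish, up to a
    null set.\<close>
  have shift: "m f = (\<integral>\<^sup>+a. f (exp a * r) * ennreal (exp (\<kappa> * a) * r ^ \<kappa>) \<partial>lborel)"
    if r: "r > 0" and [measurable]: "f \<in> borel_measurable borel" for f r
  proof -
    have "m f = (\<integral>\<^sup>+a. f (exp (ln r + 1 * a)) * ennreal (exp (\<kappa> * (ln r + 1 * a))) \<partial>lborel)"
      unfolding m_def using nn_integral_real_affine[of "\<lambda>a. f (exp a) * ennreal (exp (\<kappa> * a))" 1 "ln r"] by simp
    also have "\<dots> = (\<integral>\<^sup>+a. f (exp a * r) * ennreal (exp (\<kappa> * a) * r ^ \<kappa>) \<partial>lborel)"
      using r by (intro nn_integral_cong)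
        (simp add: exp_add distrib_left exp_of_nat_mult mult.commute)
    finally show ?thesis .
  qed
  have flip: "m f = (\<integral>\<^sup>+a. f (exp (-a) * r) * ennreal (exp (- (\<kappa> * a)) * r ^ \<kappa>) \<partial>lborel)"
    if r: "r > 0" and [measurable]: "f \<in> borel_measurable borel" for f r
    unfolding shift[OF that]
    using nn_integral_real_affine[of "\<lambda>a. f (exp a * r) * ennreal (exp (\<kappa> * a) * r ^ \<kappa>)" "-1" 0] by simp
  have "(\<integral>\<^sup>+x. \<phi> (N x) * G x \<partial>leb K) * m \<psi> = (\<integral>\<^sup>+x. \<phi> (N x) * G x * m \<psi> \<partial>leb K)"
    by (simp add: nn_integral_multc)
  also have "\<dots> = (\<integral>\<^sup>+x. \<integral>\<^sup>+a. \<phi> (N x) * G x * (\<psi> (exp a * N x) * ennreal (exp (\<kappa> * a) * N x ^ \<kappa>)) \<partial>lborel \<partial>leb K)"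
  proof (rule nn_integral_cong_AE, rule AE_mp[OF pos], intro AE_I2 impI)
    fix x assume "G x = 0 \<or> N x > 0"
    then show "\<phi> (N x) * G x * m \<psi> = (\<integral>\<^sup>+a. \<phi> (N x) * G x * (\<psi> (exp a * N x) * ennreal (exp (\<kappa> * a) * N x ^ \<kappa>)) \<partial>lborel)"
      using shift[OF _ \<psi>, of "N x"] by (auto simp: nn_integral_cmult)
  qed
  also have "\<dots> = (\<integral>\<^sup>+a. \<integral>\<^sup>+x. \<phi> (N x) * G x * (\<psi> (exp a * N x) * ennreal (exp (\<kappa> * a) * N x ^ \<kappa>)) \<partial>leb K \<partial>lborel)"
    by (rule Fubini'[symmetric]) measurable
  also have "\<dots> = (\<integral>\<^sup>+a. \<integral>\<^sup>+x. \<psi> (N x) * G x * (\<phi> (exp (-a) * N x) * ennreal (exp (- (\<kappa> * a)) * N x ^ \<kappa>)) \<partial>leb K \<partial>lborel)"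
  proof (rule nn_integral_cong)
    fix a :: real
    \<comment> \<open>Powers of exp a: the Jacobian contributes -\<kappa>, the old weight +\<kappa>,
      the homogeneity of \<open>N\<close> another -\<kappa>. The total -\<kappa> is the weight that
      \<open>flip\<close> expects.\<close>
    have *: "ennreal (exp (- a) ^ card K) * ennreal (exp (\<kappa> * a) * (exp (- a) * N x) ^ \<kappa>) = ennreal (exp (- (\<kappa> * a)) * N x ^ \<kappa>)" for x
    proof -
      have "exp (- a) ^ \<kappa> * (exp (\<kappa> * a) * (exp (- a) ^ \<kappa> * N x ^ \<kappa>)) = (exp (\<kappa> * (- a)) * exp (\<kappa> * a)) * exp (\<kappa> * (- a)) * N x ^ \<kappa>"
        unfolding exp_of_nat_mult by (simp only: mult_ac)
      also have "\<dots> = exp (- (\<kappa> * a)) * N x ^ \<kappa>"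
        by (simp add: exp_add[symmetric])
      finally have e: "exp (- a) ^ \<kappa> * (exp (\<kappa> * a) * (exp (- a) ^ \<kappa> * N x ^ \<kappa>)) = exp (- (\<kappa> * a)) * N x ^ \<kappa>" .
      have "ennreal (exp (- a) ^ card K) * ennreal (exp (\<kappa> * a) * (exp (- a) * N x) ^ \<kappa>) 
          = ennreal (exp (- a) ^ \<kappa> * (exp (\<kappa> * a) * (exp (- a) * N x) ^ \<kappa>))"
        unfolding \<kappa>_def by (rule ennreal_mult'[symmetric]) simp
      then show ?thesis by (simp only: power_mult_distrib e)
    qed
    have "(\<integral>\<^sup>+x. \<phi> (N x) * G x * (\<psi> (exp a * N x) * ennreal (exp (\<kappa> * a) * N x ^ \<kappa>)) \<partial>leb K)
      = ennreal (exp (-a) ^ card K) * (\<integral>\<^sup>+x. \<phi> (N (vscale K (exp (-a)) x)) * G (vscale K (exp (-a)) x) * 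
        (\<psi> (exp a * N (vscale K (exp (-a)) x)) * ennreal (exp (\<kappa> * a) * N (vscale K (exp (-a)) x) ^ \<kappa>)) \<partial>leb K)"
      by (rule nn_integral_leb_scale[OF K]) auto
    also have "\<dots> = ennreal (exp (-a) ^ card K) * (\<integral>\<^sup>+x. \<phi> (exp (-a) * N x) * G x * 
        (\<psi> (exp a * (exp (-a) * N x)) * ennreal (exp (\<kappa> * a) * (exp (-a) * N x) ^ \<kappa>)) \<partial>leb K)"
      by (intro arg_cong2[where f="(*)"] refl nn_integral_cong) (simp_all add: N_scale G_scale)
    also have "\<dots> = (\<integral>\<^sup>+x. ennreal (exp (-a) ^ card K) * (\<phi> (exp (-a) * N x) * G x * 
        (\<psi> (exp a * (exp (-a) * N x)) * ennreal (exp (\<kappa> * a) * (exp (-a) * N x) ^ \<kappa>))) \<partial>leb K)"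
      by (rule nn_integral_cmult[symmetric]) measurable
    also have "\<dots> = (\<integral>\<^sup>+x. \<psi> (N x) * G x * (\<phi> (exp (-a) * N x) * ennreal (exp (- (\<kappa> * a)) * N x ^ \<kappa>)) \<partial>leb K)"
    proof (rule nn_integral_cong)
      fix x
      have e: "exp a * (exp (-a) * N x) = N x" by (simp add: exp_minus)
      show "ennreal (exp (-a) ^ card K) * (\<phi> (exp (-a) * N x) * G x * 
        (\<psi> (exp a * (exp (-a) * N x)) * ennreal (exp (\<kappa> * a) * (exp (-a) * N x) ^ \<kappa>)))
        = \<psi> (N x) * G x * (\<phi> (exp (-a) * N x) * ennreal (exp (- (\<kappa> * a)) * N x ^ \<kappa>))"
        unfolding e *[of x, symmetric] by (simp only: mult_ac)
    qed
    finally show "(\<integral>\<^sup>+x. \<phi> (N x) * G x * (\<psi> (exp a * N x) * ennreal (exp (\<kappa> * a) * N x ^ \<kappa>)) \<partial>leb K)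
      = (\<integral>\<^sup>+x. \<psi> (N x) * G x * (\<phi> (exp (-a) * N x) * ennreal (exp (- (\<kappa> * a)) * N x ^ \<kappa>)) \<partial>leb K)" .
  qed
  also have "\<dots> = (\<integral>\<^sup>+x. \<integral>\<^sup>+a. \<psi> (N x) * G x * (\<phi> (exp (-a) * N x) * ennreal (exp (- (\<kappa> * a)) * N x ^ \<kappa>)) \<partial>lborel \<partial>leb K)"
    by (rule Fubini') measurable
  also have "\<dots> = (\<integral>\<^sup>+x. \<psi> (N x) * G x * m \<phi> \<partial>leb K)"
  proof (rule nn_integral_cong_AE, rule AE_mp[OF pos], intro AE_I2 impI)
    fix x assume "G x = 0 \<or> N x > 0"
    then show "(\<integral>\<^sup>+a. \<psi> (N x) * G x * (\<phi> (exp (-a) * N x) * ennreal (exp (- (\<kappa> * a)) * N x ^ \<kappa>)) \<partial>lborel) = \<psi> (N x) * G x * m \<phi>"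
      using flip[OF _ \<phi>, of "N x"] by (auto simp: nn_integral_cmult)
  qed
  also have "\<dots> = (\<integral>\<^sup>+x. \<psi> (N x) * G x \<partial>leb K) * m \<phi>"
    by (simp add: nn_integral_multc)
  finally show ?thesis by (simp add: m_def \<kappa>_def)
qed

text \<open>In polar coordinates the radial and the angular part decouple, so that the ratio of the integrals
  of \<open>\<phi>(N) G\<close> and \<open>\<phi>(N) H\<close> does not depend on \<open>\<phi>\<close>.\<close>

lemma nn_integral_homogeneous_ratio:
  fixes N :: "('i \<Rightarrow> real) \<Rightarrow> real" and G H :: "('i \<Rightarrow> real) \<Rightarrow> ennreal" and \<phi> \<xi> :: "real \<Rightarrow> ennreal"
  assumes K: "finite K"
    and N: "N \<in> borel_measurable (leb K)" 
    and G: "G \<in> borel_measurable (leb K)" and H: "H \<in> borel_measurable (leb K)"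
    and \<phi>: "\<phi> \<in> borel_measurable borel" and \<xi>: "\<xi> \<in> borel_measurable borel"
    and N_scale: "\<And>t x. t > 0 \<Longrightarrow> x \<in> space (leb K) \<Longrightarrow> N (vscale K t x) = t * N x"
    and G_scale: "\<And>t x. t > 0 \<Longrightarrow> x \<in> space (leb K) \<Longrightarrow> G (vscale K t x) = G x"
    and H_scale: "\<And>t x. t > 0 \<Longrightarrow> x \<in> space (leb K) \<Longrightarrow> H (vscale K t x) = H x"
    and posG: "AE x in leb K. G x = 0 \<or> N x > 0"
    and posH: "AE x in leb K. H x = 0 \<or> N x > 0"
  shows "(\<integral>\<^sup>+x. \<phi> (N x) * G x \<partial>leb K) * (\<integral>\<^sup>+x. \<xi> (N x) * H x \<partial>leb K)
       = (\<integral>\<^sup>+x. \<xi> (N x) * G x \<partial>leb K) * (\<integral>\<^sup>+x. \<phi> (N x) * H x \<partial>leb K)"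
proof -
  define m where "m f = (\<integral>\<^sup>+a. f (exp a) * ennreal (exp (card K * a)) \<partial>lborel)" for f :: "real \<Rightarrow> ennreal"
  \<comment> \<open>Supported on 1 <= u <= e, that is 0 <= a <= 1, and weighted by u^(-card K), so
    that its radial integral is 1. The integral of \<open>\<psi> (N x) * G x\<close> is then the
    purely angular factor of \<open>G\<close>.\<close>
  define \<psi> :: "real \<Rightarrow> ennreal" where "\<psi> u = ennreal (inverse (u ^ card K)) * indicator {1..exp 1} u" for u
  have \<psi> [measurable]: "\<psi> \<in> borel_measurable borel" unfolding \<psi>_def by measurable
  have "m \<psi> = (\<integral>\<^sup>+a. indicator {0..1::real} a \<partial>lborel)"
    unfolding m_def \<psi>_def
    by (intro nn_integral_cong)
       (auto simp: indicator_def exp_of_nat_mult ennreal_mult[symmetric])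
  then have m1: "m \<psi> = 1" by simp
  have gen: "(\<integral>\<^sup>+x. f (N x) * G x \<partial>leb K) = (\<integral>\<^sup>+x. \<psi> (N x) * G x \<partial>leb K) * m f"
      "(\<integral>\<^sup>+x. f (N x) * H x \<partial>leb K) = (\<integral>\<^sup>+x. \<psi> (N x) * H x \<partial>leb K) * m f"
    if f: "f \<in> borel_measurable borel" for f
    using nn_integral_mellin_swap[OF K N G f \<psi> N_scale G_scale posG] 
      nn_integral_mellin_swap[OF K N H f \<psi> N_scale H_scale posH] m1 unfolding m_def by auto
  show ?thesis
    unfolding gen[OF \<phi>] gen[OF \<xi>] by (simp add: mult_ac)
qed

section \<open>Generic points\<close>

text \<open>The points come as a function into functions, while determinants, reflections and Fubini
  are applied below to a single product space over pairs (point, coordinate).\<close>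

definition flatten :: "'a set \<Rightarrow> 'b set \<Rightarrow> ('a \<Rightarrow> 'b \<Rightarrow> real) \<Rightarrow> 'a \<times> 'b \<Rightarrow> real" where
  "flatten I J X = (\<lambda>p\<in>I \<times> J. X (fst p) (snd p))"

lemma measurable_flatten [measurable]:
  "flatten I J \<in> PiM I (\<lambda>_. leb J) \<rightarrow>\<^sub>M leb (I \<times> J)"
  unfolding flatten_def
proof (rule measurable_restrict)
  fix p assume p: "p \<in> I \<times> J"
  have "(\<lambda>X. X (fst p)) \<in> PiM I (\<lambda>_. leb J) \<rightarrow>\<^sub>M leb J" using p by auto
  from measurable_compose[OF this measurable_component_singleton[of "snd p" J]] p
  show "(\<lambda>X. X (fst p) (snd p)) \<in> PiM I (\<lambda>_. leb J) \<rightarrow>\<^sub>M lborel" by auto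
qed

lemma distr_flatten:
  assumes I: "finite I" and J: "finite J"
  shows "distr (PiM I (\<lambda>_. leb J)) (leb (I \<times> J)) (flatten I J) = leb (I \<times> J)"
proof (rule lborel_prod.PiM_eqI)
  interpret N: product_sigma_finite "\<lambda>_. leb J"
    by (rule product_sigma_finite.intro) (rule sigma_finite_leb[OF J])
  show "finite (I \<times> J)" using I J by simp
  fix A :: "'a \<times> 'b \<Rightarrow> real set" assume A: "\<And>p. p \<in> I \<times> J \<Longrightarrow> A p \<in> sets lborel"
  have box: "Pi\<^sub>E (I \<times> J) A \<in> sets (leb (I \<times> J))" using A I J by (intro sets_PiM_I_finite) auto
  have pre: "flatten I J -` Pi\<^sub>E (I \<times> J) A \<inter> space (PiM I (\<lambda>_. leb J)) = (\<Pi>\<^sub>E i\<in>I. \<Pi>\<^sub>E j\<in>J. A (i, j))"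
    by (auto simp: flatten_def space_PiM PiE_iff)
  have boxJ: "(\<Pi>\<^sub>E j\<in>J. A (i, j)) \<in> sets (leb J)" if "i \<in> I" for i
    using that A J by (intro sets_PiM_I_finite) auto
  have "emeasure (distr (PiM I (\<lambda>_. leb J)) (leb (I \<times> J)) (flatten I J)) (Pi\<^sub>E (I \<times> J) A)
     = emeasure (PiM I (\<lambda>_. leb J)) (\<Pi>\<^sub>E i\<in>I. \<Pi>\<^sub>E j\<in>J. A (i, j))"
    using box by (simp add: emeasure_distr pre)
  also have "\<dots> = (\<Prod>i\<in>I. emeasure (leb J) (\<Pi>\<^sub>E j\<in>J. A (i, j)))"
    using I boxJ by (intro N.emeasure_PiM) auto
  also have "\<dots> = (\<Prod>i\<in>I. \<Prod>j\<in>J. emeasure lborel (A (i, j)))"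
    using A J by (intro prod.cong refl lborel_prod.emeasure_PiM) auto
  also have "\<dots> = (\<Prod>p\<in>I \<times> J. emeasure lborel (A p))"
    by (simp add: prod.cartesian_product split_beta)
  finally show "emeasure (distr (PiM I (\<lambda>_. leb J)) (leb (I \<times> J)) (flatten I J)) (Pi\<^sub>E (I \<times> J) A)
    = (\<Prod>p\<in>I \<times> J. emeasure lborel (A p))" .
qed simp

lemma nn_integral_flatten:
  assumes "finite I" "finite J" "F \<in> borel_measurable (leb (I \<times> J))"
  shows "(\<integral>\<^sup>+X. F (flatten I J X) \<partial>PiM I (\<lambda>_. leb J)) = (\<integral>\<^sup>+x. F x \<partial>leb (I \<times> J))"
  using nn_integral_distr[OF measurable_flatten, of F I J] distr_flatten[OF assms(1,2)] assms(3) by simp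

lemma AE_flatten:
  assumes "finite I" "finite J" "AE x in leb (I \<times> J). P x"
  shows "AE X in PiM I (\<lambda>_. leb J). P (flatten I J X)"
proof -
  have "AE x in distr (PiM I (\<lambda>_. leb J)) (leb (I \<times> J)) (flatten I J). P x"
    unfolding distr_flatten[OF assms(1,2)] by (rule assms(3))
  then show ?thesis by (rule AE_distrD[OF measurable_flatten])
qed

text \<open>Leading m by m block of the matrix of edge vectors issuing from the last point d. The
  geometry uses m = d; the smaller blocks carry the induction that shows non-degeneracy.\<close>

definition edge_mat :: "nat \<Rightarrow> nat \<Rightarrow> (nat \<times> nat \<Rightarrow> real) \<Rightarrow> real mat" where
  "edge_mat d m x = mat m m (\<lambda>(l, j). x (l, j) - x (d, j))"

lemma edge_mat_carrier [simp]: "edge_mat d m x \<in> carrier_mat m m"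
  by (simp add: edge_mat_def)

lemma measurable_det_edge_mat:
  assumes "m \<le> d"
  shows "(\<lambda>x. det (edge_mat d m x)) \<in> borel_measurable (leb ({..<Suc d} \<times> {..<d}))"
proof -
  have "det (edge_mat d m x) = (\<Sum>p | p permutes {0..<m}. signof p * (\<Prod>i = 0..<m. x (i, p i) - x (d, p i)))" for x
    unfolding det_def'[OF edge_mat_carrier]
    by (intro sum.cong refl arg_cong2[where f="(*)"] prod.cong)
       (auto simp: edge_mat_def dest: permutes_in_image)
  moreover have "(\<lambda>x. x (i, p i) - x (d, p i)) \<in> borel_measurable (leb ({..<Suc d} \<times> {..<d}))" 
    if "p permutes {0..<m}" "i \<in> {0..<m}" for p i
  proof -
    have "p i < d" using permutes_in_image[OF that(1), of i] that(2) assms by (metis atLeastLessThan_iff less_le_trans)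
    then have "(i, p i) \<in> {..<Suc d} \<times> {..<d}" "(d, p i) \<in> {..<Suc d} \<times> {..<d}"
      using assms that by auto
    note this[THEN measurable_component_singleton[where M="\<lambda>_. lborel"]]
    then show ?thesis by (intro borel_measurable_diff) simp_all
  qed
  ultimately show ?thesis
    by (simp only:) (intro borel_measurable_sum borel_measurable_times borel_measurable_const borel_measurable_prod, auto)
qed

text \<open>The coordinate x(m, m) occurs only in the corner entry, since the base point has index d
  and m < d. Laplace expansion along the last row is then affine in it, with the preceding minor as
  slope.\<close>

lemma det_edge_mat_corner:
  assumes "m < d"
  obtains r where "\<And>y. det (edge_mat d (Suc m) (x((m, m) := y))) = y * det (edge_mat d m x) + r"
proof -
  let ?A = "\<lambda>y. edge_mat d (Suc m) (x((m, m) := y))"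
  have cof: "cofactor (?A y) m j = cofactor (?A 0) m j" for y j
  proof -
    have "mat_delete (?A y) m j = mat_delete (?A 0) m j"
      using assms by (intro eq_matI) (auto simp: mat_delete_def edge_mat_def)
    then show ?thesis by (simp add: cofactor_def)
  qed
  have cofm: "cofactor (?A 0) m m = det (edge_mat d m x)"
  proof -
    have "mat_delete (?A 0) m m = edge_mat d m x"
      using assms by (intro eq_matI) (auto simp: mat_delete_def edge_mat_def)
    then show ?thesis by (simp add: cofactor_def)
  qed
  have "det (?A y) = y * det (edge_mat d m x) + 
      ((\<Sum>j<m. (x (m, j) - x (d, j)) * cofactor (?A 0) m j) - x (d, m) * det (edge_mat d m x))" for y
  proof -
    have "det (?A y) = (\<Sum>j<Suc m. ?A y $$ (m, j) * cofactor (?A y) m j)"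
      by (rule laplace_expansion_row) auto
    also have "\<dots> = (\<Sum>j<m. ?A y $$ (m, j) * cofactor (?A 0) m j) + ?A y $$ (m, m) * det (edge_mat d m x)"
      by (simp add: cof[of y] cofm)
    also have "(\<Sum>j<m. ?A y $$ (m, j) * cofactor (?A 0) m j) = (\<Sum>j<m. (x (m, j) - x (d, j)) * cofactor (?A 0) m j)"
      using assms by (intro sum.cong refl) (auto simp: edge_mat_def)
    also have "?A y $$ (m, m) = y - x (d, m)" using assms by (auto simp: edge_mat_def)
    finally have e: "det (?A y) = (\<Sum>j<m. (x (m, j) - x (d, j)) * cofactor (?A 0) m j) + (y - x (d, m)) * det (edge_mat d m x)" .
    show ?thesis unfolding e by (simp add: left_diff_distrib)
  qed
  then show thesis by (rule that)
qed

text \<open>Where minor m is non-zero, minor m + 1 is a non-constant affine function of the single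
  coordinate x(m, m) and vanishes for one value of it only. Fubini over that coordinate makes the
  exceptional set null.\<close>

lemma AE_det_edge_mat_nonzero:
  assumes "m \<le> d"
  shows "AE x in leb ({..<Suc d} \<times> {..<d}). det (edge_mat d m x) \<noteq> 0"
  using assms
proof (induction m)
  case 0
  show ?case by simp
next
  case (Suc m)
  let ?K = "{..<Suc d} \<times> {..<d}"
  define K' where "K' = ?K - {(m, m)}"
  have K: "?K = insert (m, m) K'" and K': "finite K'" "(m, m) \<notin> K'" using Suc.prems by (auto simp: K'_def)
  note M [measurable] = measurable_det_edge_mat[of m d] measurable_det_edge_mat[OF Suc.prems]
  have m: "m \<le> d" using Suc.prems by simp
  define B where "B x \<longleftrightarrow> det (edge_mat d (Suc m) x) = 0 \<and> det (edge_mat d m x) \<noteq> 0" for x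
  have B [measurable]: "Measurable.pred (leb ?K) B" unfolding B_def using m by measurable
  have inv: "det (edge_mat d m (x((m, m) := y))) = det (edge_mat d m x)" for x y
  proof -
    have "edge_mat d m (x((m, m) := y)) = edge_mat d m x"
      using Suc.prems by (intro eq_matI) (auto simp: edge_mat_def)
    then show ?thesis by simp
  qed
  have "(\<integral>\<^sup>+x. indicator {x\<in>space (leb ?K). B x} x \<partial>leb ?K) = 
     (\<integral>\<^sup>+x. \<integral>\<^sup>+y. indicator {x\<in>space (leb ?K). B x} (x((m, m) := y)) \<partial>lborel \<partial>leb K')"
    unfolding K by (rule lborel_prod.product_nn_integral_insert[OF K']) (use B in \<open>simp add: K\<close>)
  also have "\<dots> = (\<integral>\<^sup>+x. 0 \<partial>leb K')"
  proof (rule nn_integral_cong)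
    fix x
    obtain r where r: "\<And>y. det (edge_mat d (Suc m) (x((m, m) := y))) = y * det (edge_mat d m x) + r"
      using det_edge_mat_corner[of m d x] Suc.prems by auto
    have "(\<integral>\<^sup>+y. indicator {x\<in>space (leb ?K). B x} (x((m, m) := y)) \<partial>lborel) 
        \<le> (\<integral>\<^sup>+y. indicator {- r / det (edge_mat d m x)} y \<partial>lborel)"
      by (intro nn_integral_mono) (auto simp: indicator_def B_def inv r field_simps)
    also have "\<dots> = 0" by simp
    finally show "(\<integral>\<^sup>+y. indicator {x\<in>space (leb ?K). B x} (x((m, m) := y)) \<partial>lborel) = 0" by simp
  qed
  also have "\<dots> = 0" by simp
  finally have "AE x in leb ?K. indicator {x\<in>space (leb ?K). B x} x = (0::ennreal)"
    by (subst (asm) nn_integral_0_iff_AE) auto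
  then have "AE x in leb ?K. \<not> B x" 
    by (rule AE_mp) (auto simp: indicator_def split: if_splits)
  with Suc.IH[OF m] show ?case by eventually_elim (auto simp: B_def)
qed

lemma edge_inverse:
  assumes "det (edge_mat d d x) \<noteq> 0"
  obtains B where
    "\<And>l m. l < d \<Longrightarrow> m < d \<Longrightarrow> (\<Sum>j<d. (x (l, j) - x (d, j)) * B j m) = (if l = m then 1 else 0)"
    "\<And>j m. j < d \<Longrightarrow> m < d \<Longrightarrow> (\<Sum>l<d. B j l * (x (l, m) - x (d, m))) = (if j = m then 1 else 0)"
proof -
  let ?A = "edge_mat d d x"
  obtain C where C: "C \<in> carrier_mat d d" "C * ?A = 1\<^sub>m d" "?A * C = 1\<^sub>m d"
    using det_non_zero_imp_unit[OF edge_mat_carrier assms, of "()"]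
    unfolding Units_def ring_mat_def by auto
  have "(\<Sum>j<d. (x (l, j) - x (d, j)) * C $$ (j, m)) = (if l = m then 1 else 0)" if "l < d" "m < d" for l m
  proof -
    have "(?A * C) $$ (l, m) = (\<Sum>j<d. (x (l, j) - x (d, j)) * C $$ (j, m))"
      using that C(1) by (auto simp: scalar_prod_def edge_mat_def lessThan_atLeast0 intro!: sum.cong)
    then show ?thesis using C(3) that by simp
  qed
  moreover have "(\<Sum>l<d. C $$ (j, l) * (x (l, m) - x (d, m))) = (if j = m then 1 else 0)" if "j < d" "m < d" for j m
  proof -
    have "(C * ?A) $$ (j, m) = (\<Sum>l<d. C $$ (j, l) * (x (l, m) - x (d, m)))"
      using that C(1) by (auto simp: scalar_prod_def edge_mat_def lessThan_atLeast0 intro!: sum.cong)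
    then show ?thesis using C(2) that by simp
  qed
  ultimately show thesis by (rule that)
qed

section \<open>Angles of simplices as Gaussian measures of cones\<close>

text \<open>Coordinates \<open>\<nu>\<close> on the hyperplane of all \<open>\<lambda>\<close> with \<open>\<lambda>\<^sub>0 + \<dots> + \<lambda>\<^sub>d = 0\<close>.\<close>

definition zext :: "nat \<Rightarrow> (nat \<Rightarrow> real) \<Rightarrow> nat \<Rightarrow> real" where
  "zext d \<nu> i = (if i < d then \<nu> i else - (\<Sum>l<d. \<nu> l))"

text \<open>Tangent cone at the face, in hyperplane coordinates: at a relative interior point the
  weights i < k are positive, so small changes of either sign are allowed. For k = d + 1 no
  constraint is left, so the same function also yields the normaliser.\<close>

definition cone_ind :: "nat \<Rightarrow> nat \<Rightarrow> (nat \<Rightarrow> real) \<Rightarrow> ennreal" where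
  "cone_ind k d \<nu> = (if \<forall>i\<in>{k..d}. 0 \<le> zext d \<nu> i then 1 else 0)"

definition edge_comb :: "nat \<Rightarrow> (nat \<times> nat \<Rightarrow> real) \<Rightarrow> (nat \<Rightarrow> real) \<Rightarrow> nat \<Rightarrow> real" where
  "edge_comb d x \<nu> j = (\<Sum>i<Suc d. zext d \<nu> i * x (i, j))"

definition edge_gauss :: "nat \<Rightarrow> (nat \<times> nat \<Rightarrow> real) \<Rightarrow> (nat \<Rightarrow> real) \<Rightarrow> ennreal" where
  "edge_gauss d x \<nu> = ennreal (exp (- (\<Sum>j<d. (edge_comb d x \<nu> j)\<^sup>2)))"

text \<open>For non-degenerate points this is the Gaussian measure of the cone up to pi^(d/2) and
  the Jacobian of \<open>edge_comb\<close>; both drop out on division by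
  \<open>cone_mass (Suc d) d x\<close>.\<close>

definition cone_mass :: "nat \<Rightarrow> nat \<Rightarrow> (nat \<times> nat \<Rightarrow> real) \<Rightarrow> ennreal" where
  "cone_mass k d x = (\<integral>\<^sup>+\<nu>. cone_ind k d \<nu> * edge_gauss d x \<nu> \<partial>leb {..<d})"

lemma cone_ind_Suc [simp]: "cone_ind (Suc d) d \<nu> = 1"
  by (simp add: cone_ind_def)

lemma zext_cong: "(\<And>l. l < d \<Longrightarrow> \<mu> l = \<nu> l) \<Longrightarrow> zext d \<mu> i = zext d \<nu> i"
  by (simp add: zext_def)

lemma sum_zext: "(\<Sum>i<Suc d. zext d \<nu> i) = 0"
  by (simp add: zext_def)

lemma zext_sum_zero: "(\<Sum>i<Suc d. z i) = 0 \<Longrightarrow> i \<le> d \<Longrightarrow> zext d z i = z i"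
  by (auto simp: zext_def)

lemma zext_vscale: "zext d (vscale {..<d} t \<nu>) i = t * zext d \<nu> i"
  by (simp add: zext_def vscale_def sum_distrib_left)

lemma zext_vadd: "zext d (vadd {..<d} \<mu> \<nu>) i = zext d \<mu> i + zext d \<nu> i"
  by (simp add: zext_def vadd_def sum.distrib)

lemma edge_comb_eq: "edge_comb d x \<nu> j = (\<Sum>l<d. \<nu> l * (x (l, j) - x (d, j)))"
  by (simp add: edge_comb_def zext_def right_diff_distrib sum_subtractf sum_distrib_right)

lemma cone_ind_vscale: "t > 0 \<Longrightarrow> cone_ind k d (vscale {..<d} t \<nu>) = cone_ind k d \<nu>"
  by (simp add: cone_ind_def zext_vscale zero_le_mult_iff)

lemma measurable_leb_component:
  "f \<in> M \<rightarrow>\<^sub>M leb K \<Longrightarrow> i \<in> K \<Longrightarrow> (\<lambda>w. f w i) \<in> borel_measurable M"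
  using measurable_compose[OF _ measurable_component_singleton[of i K "\<lambda>_. lborel"]] by simp

lemma measurable_zext [measurable (raw)]:
  assumes "f \<in> M \<rightarrow>\<^sub>M leb {..<d}"
  shows "(\<lambda>w. zext d (f w) i) \<in> borel_measurable M"
proof (cases "i < d")
  case True
  then show ?thesis using measurable_leb_component[OF assms, of i] by (simp add: zext_def)
next
  case False
  then show ?thesis unfolding zext_def
    by (auto intro!: borel_measurable_sum borel_measurable_uminus measurable_leb_component[OF assms])
qed

lemma measurable_edge_comb:
  assumes f: "f \<in> M \<rightarrow>\<^sub>M leb ({..<Suc d} \<times> {..<d})" and g: "g \<in> M \<rightarrow>\<^sub>M leb {..<d}" and j: "j < d"
  shows "(\<lambda>w. edge_comb d (f w) (g w) j) \<in> borel_measurable M"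
  unfolding edge_comb_def using j
  by (intro borel_measurable_sum borel_measurable_times measurable_zext[OF g] measurable_leb_component[OF f]) auto

lemma measurable_edge_gauss [measurable (raw)]:
  assumes f: "f \<in> M \<rightarrow>\<^sub>M leb ({..<Suc d} \<times> {..<d})" and g: "g \<in> M \<rightarrow>\<^sub>M leb {..<d}"
  shows "(\<lambda>w. edge_gauss d (f w) (g w)) \<in> borel_measurable M"
proof -
  have [measurable]: "(\<lambda>w. \<Sum>j<d. (edge_comb d (f w) (g w) j)\<^sup>2) \<in> borel_measurable M"
    by (intro borel_measurable_sum borel_measurable_power measurable_edge_comb[OF f g]) auto
  show ?thesis unfolding edge_gauss_def by measurable
qed

lemma measurable_cone_ind [measurable (raw)]:
  assumes [measurable]: "f \<in> M \<rightarrow>\<^sub>M leb {..<d}"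
  shows "(\<lambda>w. cone_ind k d (f w)) \<in> borel_measurable M"
  unfolding cone_ind_def by measurable

lemma measurable_cone_mass [measurable]:
  "cone_mass k d \<in> borel_measurable (leb ({..<Suc d} \<times> {..<d}))"
proof -
  interpret sigma_finite_measure "leb {..<d}" by (rule sigma_finite_leb) simp
  show ?thesis unfolding cone_mass_def by measurable
qed

lemma AE_leb_component_nonzero:
  assumes K: "finite K" and i: "i \<in> K"
  shows "AE x in leb K. x i \<noteq> 0"
proof -
  define A where "A = (\<lambda>j. if j = i then {0::real} else UNIV)"
  have "emeasure (leb K) (Pi\<^sub>E K A) = (\<Prod>j\<in>K. emeasure lborel (A j))"
    using K by (intro lborel_prod.emeasure_PiM) (auto simp: A_def)
  also have "\<dots> = 0"
    using K i by (intro prod_zero) (auto simp: A_def)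
  finally have "Pi\<^sub>E K A \<in> null_sets (leb K)"
    using K by (intro null_setsI sets_PiM_I_finite) (auto simp: A_def)
  then show ?thesis
    by (rule AE_I') (auto simp: A_def space_leb PiE_iff extensional_def)
qed

section \<open>Gaussian integrals and the passage from hyperplane coordinates to Euclidean
  space\<close>

lemma nn_integral_gauss: "(\<integral>\<^sup>+x. ennreal (exp (- x\<^sup>2)) \<partial>lborel) = ennreal (sqrt pi)"
proof -
  have "(\<integral>\<^sup>+x. ennreal (normal_density 0 (1 / sqrt 2) x) \<partial>lborel) = 1"
    using prob_space.emeasure_space_1[OF prob_space_normal_density[of "1 / sqrt 2" 0]]
    by (simp add: emeasure_density)
  moreover have "(\<integral>\<^sup>+x. ennreal (normal_density 0 (1 / sqrt 2) x) \<partial>lborel) = 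
      (\<integral>\<^sup>+x. ennreal (1 / sqrt pi) * ennreal (exp (- x\<^sup>2)) \<partial>lborel)"
    by (intro nn_integral_cong)
       (simp add: normal_density_def ennreal_mult'[symmetric] power_divide)
  ultimately have "ennreal (1 / sqrt pi) * (\<integral>\<^sup>+x. ennreal (exp (- x\<^sup>2)) \<partial>lborel) = 1"
    by (simp add: nn_integral_cmult)
  then have "ennreal (sqrt pi) * (ennreal (1 / sqrt pi) * (\<integral>\<^sup>+x. ennreal (exp (- x\<^sup>2)) \<partial>lborel)) = ennreal (sqrt pi)"
    by simp
  then show ?thesis
    by (simp add: mult.assoc[symmetric] ennreal_mult'[symmetric])
qed

lemma nn_integral_leb_gauss:
  assumes "finite K"
  shows "(\<integral>\<^sup>+x. ennreal (exp (- (\<Sum>i\<in>K. (x i)\<^sup>2))) \<partial>leb K) = ennreal (sqrt pi ^ card K)"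
proof -
  have "(\<integral>\<^sup>+x. ennreal (exp (- (\<Sum>i\<in>K. (x i)\<^sup>2))) \<partial>leb K) = (\<integral>\<^sup>+x. (\<Prod>i\<in>K. ennreal (exp (- (x i)\<^sup>2))) \<partial>leb K)"
    using assms by (intro nn_integral_cong) (simp add: prod_ennreal exp_sum sum_negf[symmetric])
  also have "\<dots> = (\<Prod>i\<in>K. \<integral>\<^sup>+x. ennreal (exp (- x\<^sup>2)) \<partial>lborel)"
    using assms by (intro lborel_prod.product_nn_integral_prod) auto
  finally show ?thesis by (simp add: nn_integral_gauss ennreal_power)
qed

text \<open>\<open>c\<close> is the reciprocal of the absolute determinant of the edge matrix, but
  is wanted only as a positive finite number. \<open>S\<close> is exported with its formula because
  the angle computation uses its homogeneity and a bound on its coordinates.\<close>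

lemma edge_iso:
  fixes x :: "nat \<times> nat \<Rightarrow> real"
  assumes "det (edge_mat d d x) \<noteq> 0"
  obtains S B c where
    "S = (\<lambda>U. \<lambda>l\<in>{..<d}. \<Sum>j<d. U j * B j l)"
    "S \<in> leb {..<d} \<rightarrow>\<^sub>M leb {..<d}"
    "\<And>\<nu>. \<nu> \<in> space (leb {..<d}) \<Longrightarrow> S (\<lambda>j\<in>{..<d}. edge_comb d x \<nu> j) = \<nu>"
    "\<And>U. U \<in> space (leb {..<d}) \<Longrightarrow> (\<lambda>j\<in>{..<d}. edge_comb d x (S U) j) = U"
    "0 < c" "c < (\<infinity>::ennreal)"
    "\<And>F. F \<in> borel_measurable (leb {..<d}) \<Longrightarrow> 
      (\<integral>\<^sup>+\<nu>. F (\<lambda>j\<in>{..<d}. edge_comb d x \<nu> j) \<partial>leb {..<d}) = c * (\<integral>\<^sup>+U. F U \<partial>leb {..<d})"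
proof -
  obtain B where B: "\<And>l m. l < d \<Longrightarrow> m < d \<Longrightarrow> (\<Sum>j<d. (x (l, j) - x (d, j)) * B j m) = (if l = m then 1 else 0)"
    "\<And>j m. j < d \<Longrightarrow> m < d \<Longrightarrow> (\<Sum>l<d. B j l * (x (l, m) - x (d, m))) = (if j = m then 1 else 0)"
    by (rule edge_inverse[OF assms]) (rule that)
  define S where "S = (\<lambda>U. \<lambda>l\<in>{..<d}. \<Sum>j<d. U j * B j l)"
  define T where "T = (\<lambda>\<nu>. \<lambda>j\<in>{..<d}. edge_comb d x \<nu> j)"
  have S [measurable]: "S \<in> leb {..<d} \<rightarrow>\<^sub>M leb {..<d}"
    unfolding S_def
    by (intro measurable_restrict)
       (auto intro!: borel_measurable_sum borel_measurable_times measurable_leb_component[OF measurable_ident])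
  have T [measurable]: "T \<in> leb {..<d} \<rightarrow>\<^sub>M leb {..<d}"
    unfolding T_def edge_comb_eq
    by (intro measurable_restrict)
       (auto intro!: borel_measurable_sum borel_measurable_times measurable_leb_component[OF measurable_ident])
  have ST: "S (T \<nu>) = \<nu>" if "\<nu> \<in> space (leb {..<d})" for \<nu>
  proof
    fix l show "S (T \<nu>) l = \<nu> l"
    proof (cases "l < d")
      case True
      have "S (T \<nu>) l = (\<Sum>j<d. \<Sum>m<d. \<nu> m * (x (m, j) - x (d, j)) * B j l)"
        using True by (simp add: S_def T_def edge_comb_eq sum_distrib_right)
      also have "\<dots> = (\<Sum>m<d. \<nu> m * (\<Sum>j<d. (x (m, j) - x (d, j)) * B j l))"
        by (subst sum.swap) (simp add: sum_distrib_left mult.assoc)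
      also have "\<dots> = (\<Sum>m<d. \<nu> m * (if m = l then 1 else 0))"
        using True by (intro sum.cong refl) (simp add: B)
      also have "\<dots> = \<nu> l" using True by (simp add: if_distrib cong: if_cong)
      finally show ?thesis .
    qed (use that in \<open>auto simp: S_def space_leb PiE_iff extensional_def\<close>)
  qed
  have TS: "T (S U) = U" if "U \<in> space (leb {..<d})" for U
  proof
    fix l show "T (S U) l = U l"
    proof (cases "l < d")
      case True
      have "T (S U) l = (\<Sum>m<d. \<Sum>j<d. U j * B j m * (x (m, l) - x (d, l)))"
        using True by (simp add: S_def T_def edge_comb_eq sum_distrib_right)
      also have "\<dots> = (\<Sum>j<d. U j * (\<Sum>m<d. B j m * (x (m, l) - x (d, l))))"
        by (subst sum.swap) (simp add: sum_distrib_left mult.assoc)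
      also have "\<dots> = (\<Sum>j<d. U j * (if j = l then 1 else 0))"
        using True by (intro sum.cong refl) (simp add: B)
      also have "\<dots> = U l" using True by (simp add: if_distrib cong: if_cong)
      finally show ?thesis .
    qed (use that in \<open>auto simp: T_def space_leb PiE_iff extensional_def\<close>)
  qed
  have add: "T (vadd {..<d} \<mu> \<nu>) = vadd {..<d} (T \<mu>) (T \<nu>)" for \<mu> \<nu>
    by (auto simp: T_def edge_comb_def zext_vadd distrib_right sum.distrib fun_eq_iff vadd_def[of _ "restrict _ _"])
  obtain c where c: "0 < c" "c < \<infinity>" "\<And>F. F \<in> borel_measurable (leb {..<d}) \<Longrightarrow> 
      (\<integral>\<^sup>+\<nu>. F (T \<nu>) \<partial>leb {..<d}) = c * (\<integral>\<^sup>+U. F U \<partial>leb {..<d})"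
    by (rule nn_integral_leb_additive_iso[OF finite_lessThan finite_lessThan T S TS ST add]) (assumption | rule that)+
  show thesis
    by (rule that[of S B c]) (use S_def S ST TS c in \<open>auto simp: T_def\<close>)
qed

lemma cone_mass_pos_finite:
  assumes "det (edge_mat d d x) \<noteq> 0"
  shows "0 < cone_mass (Suc d) d x" "cone_mass (Suc d) d x < \<infinity>"
proof -
  obtain c where *: "0 < c" "c < (\<infinity>::ennreal)"
    "\<And>F. F \<in> borel_measurable (leb {..<d}) \<Longrightarrow> 
      (\<integral>\<^sup>+\<nu>. F (\<lambda>j\<in>{..<d}. edge_comb d x \<nu> j) \<partial>leb {..<d}) = c * (\<integral>\<^sup>+U. F U \<partial>leb {..<d})"
    by (rule edge_iso[OF assms]) (rule that)
  have [measurable]: "(\<lambda>U. \<Sum>j<d. (U j)\<^sup>2) \<in> borel_measurable (leb {..<d})"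
    by (auto intro!: borel_measurable_sum borel_measurable_power measurable_leb_component[OF measurable_ident])
  have "cone_mass (Suc d) d x = (\<integral>\<^sup>+\<nu>. ennreal (exp (- (\<Sum>j<d. ((\<lambda>j\<in>{..<d}. edge_comb d x \<nu> j) j)\<^sup>2))) \<partial>leb {..<d})"
    by (simp add: cone_mass_def edge_gauss_def)
  also have "\<dots> = c * (\<integral>\<^sup>+U. ennreal (exp (- (\<Sum>j<d. (U j)\<^sup>2))) \<partial>leb {..<d})"
    by (rule *(3)) measurable
  also have "\<dots> = c * ennreal (sqrt pi ^ d)" by (simp add: nn_integral_leb_gauss)
  finally have e: "cone_mass (Suc d) d x = c * ennreal (sqrt pi ^ d)" .
  show "0 < cone_mass (Suc d) d x" "cone_mass (Suc d) d x < \<infinity>"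
    unfolding e using *(1,2) by (auto simp: ennreal_zero_less_mult_iff ennreal_mult_less_top)
qed

text \<open>For affinely independent points, S(y - z) extended to sum zero is the change of the
  barycentric coordinates from z to y, and these are unique; membership means that all coordinates
  of y are non-negative.\<close>

lemma psimplex_iff_near_relint:
  fixes X :: "nat \<Rightarrow> nat \<Rightarrow> real" and d :: nat
  defines "x \<equiv> flatten {..<Suc d} {..<d} X"
  assumes S: "\<And>\<nu>. \<nu> \<in> space (leb {..<d}) \<Longrightarrow> S (\<lambda>j\<in>{..<d}. edge_comb d x \<nu> j) = \<nu>"
    and TS: "\<And>U. U \<in> space (leb {..<d}) \<Longrightarrow> (\<lambda>j\<in>{..<d}. edge_comb d x (S U) j) = U"
    and k: "k \<le> Suc d" and t: "(\<Sum>i<k. t i) = 1" and z: "z = pcomb d X {..<k} t"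
    and y: "y \<in> space (leb {..<d})"
  shows "y \<in> psimplex d X {..<Suc d} \<longleftrightarrow> 
    (\<forall>i\<le>d. 0 \<le> (if i < k then t i else 0) + zext d (S (vadd {..<d} y (vscale {..<d} (-1) z))) i)"
proof -
  let ?U = "vadd {..<d} y (vscale {..<d} (-1) z)"
  \<comment> \<open>Barycentric coordinates of z with respect to all points, zero off the
    face.\<close>
  define \<tau> where "\<tau> i = (if i < k then t i else 0)" for i
  have sum\<tau>: "(\<Sum>i<Suc d. \<tau> i * f i) = (\<Sum>i<k. t i * f i)" for f :: "nat \<Rightarrow> real"
    using k by (intro sum.mono_neutral_cong_right) (auto simp: \<tau>_def)
  have \<tau>1: "(\<Sum>i<Suc d. \<tau> i) = 1" using sum\<tau>[of "\<lambda>_. 1"] t by simp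
  have zj: "z j = (\<Sum>i<Suc d. \<tau> i * X i j)" if "j < d" for j
    using that by (simp only: z pcomb_def sum\<tau> if_True)
  have ec: "edge_comb d x \<nu> j = (\<Sum>i<Suc d. zext d \<nu> i * X i j)" if "j < d" for \<nu> j
    unfolding edge_comb_def using that by (intro sum.cong refl) (simp add: x_def flatten_def)
  show ?thesis unfolding \<tau>_def[symmetric]
  proof
    assume "y \<in> psimplex d X {..<Suc d}"
    then obtain u where u: "\<And>i. i < Suc d \<Longrightarrow> 0 \<le> u i" "(\<Sum>i<Suc d. u i) = 1" and yu: "y = pcomb d X {..<Suc d} u"
      by (auto simp: psimplex_def)
    define \<nu> where "\<nu> = (\<lambda>l\<in>{..<d}. u l - \<tau> l)"
    have ze: "zext d \<nu> i = u i - \<tau> i" if "i \<le> d" for i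
    proof -
      have "zext d \<nu> i = zext d (\<lambda>l. u l - \<tau> l) i" by (rule zext_cong) (simp add: \<nu>_def)
      also have "\<dots> = u i - \<tau> i"
        using that by (intro zext_sum_zero) (simp_all only: sum_subtractf u \<tau>1)
      finally show ?thesis .
    qed
    have "?U = (\<lambda>j\<in>{..<d}. edge_comb d x \<nu> j)"
    proof
      fix j show "?U j = (\<lambda>j\<in>{..<d}. edge_comb d x \<nu> j) j"
      proof (cases "j < d")
        case True
        have "edge_comb d x \<nu> j = (\<Sum>i<Suc d. (u i - \<tau> i) * X i j)"
          unfolding ec[OF True] by (intro sum.cong refl arg_cong2[where f="(*)"] ze) simp
        also have "\<dots> = y j - z j"
          unfolding zj[OF True] using True by (simp only: yu pcomb_def if_True left_diff_distrib sum_subtractf)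
        finally show ?thesis using True by (simp add: vadd_def vscale_def)
      qed (simp add: vadd_def)
    qed
    then have "S ?U = \<nu>" using S[of \<nu>] by (simp add: \<nu>_def space_leb)
    then show "\<forall>i\<le>d. 0 \<le> \<tau> i + zext d (S ?U) i" using ze u(1) by auto
  next
    assume nn: "\<forall>i\<le>d. 0 \<le> \<tau> i + zext d (S ?U) i"
    define u where "u i = \<tau> i + zext d (S ?U) i" for i
    have "(\<Sum>i<Suc d. u i) = 1" by (simp only: u_def sum.distrib sum_zext \<tau>1)
    moreover have "y = pcomb d X {..<Suc d} u"
    proof
      fix j show "y j = pcomb d X {..<Suc d} u j"
      proof (cases "j < d")
        case True
        have "pcomb d X {..<Suc d} u j = z j + edge_comb d x (S ?U) j"
          unfolding ec[OF True] zj[OF True] using True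
          by (simp only: pcomb_def u_def if_True distrib_right sum.distrib)
        also have "edge_comb d x (S ?U) j = ?U j"
          using fun_cong[OF TS[OF vadd_in_space[of "{..<d}" y "vscale {..<d} (-1) z"]], of j] True by simp
        also have "z j + ?U j = y j" using True by (simp add: vadd_def vscale_def)
        finally show ?thesis ..
      qed (use y in \<open>auto simp: pcomb_def space_leb PiE_iff extensional_def\<close>)
    qed
    moreover have "0 \<le> u i" if "i < Suc d" for i using nn that by (simp add: u_def)
    ultimately show "y \<in> psimplex d X {..<Suc d}" by (auto simp: psimplex_def)
  qed
qed

lemma Rsp_eq_leb: "Rsp d = leb {..<d}"
  by (simp add: Rsp_def)

lemma edist_eq_norm:
  "edist d y z = sqrt (\<Sum>j<d. (vadd {..<d} y (vscale {..<d} (-1) z) j)\<^sup>2)"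
  by (simp add: edist_def vadd_def vscale_def)

lemma eball_measure_pos_finite:
  fixes d :: nat and r :: real
  assumes "r > 0"
  shows "0 < (\<integral>\<^sup>+U. indicator {..<r} (sqrt (\<Sum>j<d. (U j)\<^sup>2)) \<partial>leb {..<d})"
    and "(\<integral>\<^sup>+U. indicator {..<r} (sqrt (\<Sum>j<d. (U j)\<^sup>2)) \<partial>leb {..<d}) < (\<infinity>::ennreal)"
proof -
  have box: "(\<integral>\<^sup>+U. indicator (\<Pi>\<^sub>E j\<in>{..<d}. {-a..a}) U \<partial>leb {..<d}) = ennreal ((2 * a) ^ d)" if "a > 0" for a :: real
  proof -
    have "(\<integral>\<^sup>+U. indicator (\<Pi>\<^sub>E j\<in>{..<d}. {-a..a}) U \<partial>leb {..<d}) = emeasure (leb {..<d}) (\<Pi>\<^sub>E j\<in>{..<d}. {-a..a})"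
      by (intro nn_integral_indicator sets_PiM_I_finite) auto
    also have "\<dots> = (\<Prod>j<d. emeasure lborel {-a..a})" by (intro lborel_prod.emeasure_PiM) auto
    also have "\<dots> = ennreal ((2 * a) ^ d)" using that by (simp add: ennreal_power)
    finally show ?thesis .
  qed
  \<comment> \<open>A cube of half-width r/(d + 1) has l1-radius d r/(d + 1) < r and so lies in the
    ball; the +1 also covers d = 0.\<close>
  define a where "a = r / (real d + 1)"
  have a: "a > 0" using assms by (simp add: a_def)
  have "0 < ennreal ((2 * a) ^ d)" using a by simp
  also have "\<dots> = (\<integral>\<^sup>+U. indicator (\<Pi>\<^sub>E j\<in>{..<d}. {-a..a}) U \<partial>leb {..<d})" using box[OF a] by simp
  also have "\<dots> \<le> (\<integral>\<^sup>+U. indicator {..<r} (sqrt (\<Sum>j<d. (U j)\<^sup>2)) \<partial>leb {..<d})"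
  proof (intro nn_integral_mono, simp split: split_indicator, intro allI impI)
    fix U :: "nat \<Rightarrow> real" assume U: "U \<in> (\<Pi>\<^sub>E j\<in>{..<d}. {-a..a})"
    have "sqrt (\<Sum>j<d. (U j)\<^sup>2) \<le> (\<Sum>j<d. \<bar>U j\<bar>)" 
      using L2_set_le_sum_abs[of U "{..<d}"] by (simp add: L2_set_def)
    also have "\<dots> \<le> (\<Sum>j<d. a)" using U by (intro sum_mono) (force simp: PiE_iff abs_le_iff)
    also have "\<dots> = r * (real d / (real d + 1))" by (simp add: a_def)
    also have "\<dots> < r * 1" using assms by (intro mult_strict_left_mono) auto
    finally show "sqrt (\<Sum>j<d. (U j)\<^sup>2) < r" by simp
  qed
  finally show "0 < (\<integral>\<^sup>+U. indicator {..<r} (sqrt (\<Sum>j<d. (U j)\<^sup>2)) \<partial>leb {..<d})" .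
  have "(\<integral>\<^sup>+U. indicator {..<r} (sqrt (\<Sum>j<d. (U j)\<^sup>2)) \<partial>leb {..<d}) \<le> (\<integral>\<^sup>+U. indicator (\<Pi>\<^sub>E j\<in>{..<d}. {-r..r}) U \<partial>leb {..<d})"
  proof (rule nn_integral_mono)
    fix U assume U: "U \<in> space (leb {..<d})"
    have "\<bar>U j\<bar> \<le> sqrt (\<Sum>j<d. (U j)\<^sup>2)" if "j < d" for j
      using member_le_L2_set[of "{..<d}" j "\<lambda>j. \<bar>U j\<bar>"] that by (simp add: L2_set_def)
    then have "U \<in> (\<Pi>\<^sub>E j\<in>{..<d}. {-r..r})" if "sqrt (\<Sum>j<d. (U j)\<^sup>2) < r"
      using that U by (force simp: space_leb PiE_iff abs_le_iff)
    then show "indicator {..<r} (sqrt (\<Sum>j<d. (U j)\<^sup>2)) \<le> (indicator (\<Pi>\<^sub>E j\<in>{..<d}. {-r..r}) U :: ennreal)"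
      by (auto simp: indicator_def)
  qed
  also have "\<dots> < \<infinity>" using box[OF assms] by simp
  finally show "(\<integral>\<^sup>+U. indicator {..<r} (sqrt (\<Sum>j<d. (U j)\<^sup>2)) \<partial>leb {..<d}) < (\<infinity>::ennreal)" .
qed

lemma ennreal_ratio_eq:
  fixes a b c e :: ennreal
  assumes "a * e = c * b" "0 < b" "b < \<infinity>" "0 < e" "e < \<infinity>"
  shows "a / b = c / e"
proof -
  have "a / b = (a * e) / (b * e)" using assms by (intro divide_mult_eq[symmetric]) auto
  also have "\<dots> = (c * b) / (e * b)" using assms by (simp add: mult.commute)
  also have "\<dots> = c / e" using assms by (intro divide_mult_eq) auto
  finally show ?thesis .
qed


text \<open>In a small ball around a relative interior point the simplex is a translated cone, so
  the volume quotient is constant for small r. Exchanging the radial profile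
  \<open>indicator {..<r}\<close> for a Gaussian identifies that constant with the quotient of the
  cone masses.\<close>

lemma internal_angle_eq_cone_mass:
  fixes X :: "nat \<Rightarrow> nat \<Rightarrow> real" and d :: nat
  defines "x \<equiv> flatten {..<Suc d} {..<d} X"
  assumes det: "det (edge_mat d d x) \<noteq> 0" and k: "1 \<le> k" "k \<le> d"
  shows "0 \<le> internal_angle d X {..<k} {..<Suc d}"
    and "ennreal (internal_angle d X {..<k} {..<Suc d}) = cone_mass k d x / cone_mass (Suc d) d x"
proof -
  let ?K = "{..<d}"
  obtain S B c where S_def: "S = (\<lambda>U. \<lambda>l\<in>{..<d}. \<Sum>j<d. U j * B j l)"
    and S [measurable]: "S \<in> leb ?K \<rightarrow>\<^sub>M leb ?K"
    and ST: "\<And>\<nu>. \<nu> \<in> space (leb ?K) \<Longrightarrow> S (\<lambda>j\<in>{..<d}. edge_comb d x \<nu> j) = \<nu>"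
    and TS: "\<And>U. U \<in> space (leb ?K) \<Longrightarrow> (\<lambda>j\<in>{..<d}. edge_comb d x (S U) j) = U"
    and c: "0 < c" "c < (\<infinity>::ennreal)"
    and T: "\<And>F. F \<in> borel_measurable (leb ?K) \<Longrightarrow> 
      (\<integral>\<^sup>+\<nu>. F (\<lambda>j\<in>{..<d}. edge_comb d x \<nu> j) \<partial>leb ?K) = c * (\<integral>\<^sup>+U. F U \<partial>leb ?K)"
    by (rule edge_iso[OF det]) (rule that)
  define nrm where "nrm U = sqrt (\<Sum>j<d. (U j)\<^sup>2)" for U :: "nat \<Rightarrow> real"
  define g :: "real \<Rightarrow> ennreal" where "g u = ennreal (exp (- u\<^sup>2))" for u
  define C where "C U = cone_ind k d (S U)" for U
  have nrm [measurable]: "nrm \<in> borel_measurable (leb ?K)"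
    unfolding nrm_def by (intro borel_measurable_sqrt[THEN measurable_compose[rotated]] borel_measurable_sum borel_measurable_power
      measurable_leb_component[OF measurable_ident]) auto
  have g [measurable]: "g \<in> borel_measurable borel" unfolding g_def by measurable
  have C [measurable]: "C \<in> borel_measurable (leb ?K)" unfolding C_def by measurable
  have g_nrm: "g (nrm U) = ennreal (exp (- (\<Sum>j<d. (U j)\<^sup>2)))" for U
    by (simp add: g_def nrm_def sum_nonneg)
  define \<gamma> where "\<gamma> = (\<integral>\<^sup>+U. g (nrm U) * 1 \<partial>leb ?K)"
  define \<gamma>k where "\<gamma>k = (\<integral>\<^sup>+U. g (nrm U) * C U \<partial>leb ?K)"
  have cm: "cone_mass m d x = c * (\<integral>\<^sup>+U. g (nrm U) * cone_ind m d (S U) \<partial>leb ?K)" for m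
  proof -
    have "cone_mass m d x = (\<integral>\<^sup>+\<nu>. g (nrm (\<lambda>j\<in>{..<d}. edge_comb d x \<nu> j)) * cone_ind m d (S (\<lambda>j\<in>{..<d}. edge_comb d x \<nu> j)) \<partial>leb ?K)"
      unfolding cone_mass_def g_nrm by (intro nn_integral_cong) (simp add: ST edge_gauss_def mult.commute)
    also have "\<dots> = c * (\<integral>\<^sup>+U. g (nrm U) * cone_ind m d (S U) \<partial>leb ?K)"
      by (rule T) measurable
    finally show ?thesis .
  qed
  have cm_k: "cone_mass k d x = c * \<gamma>k" unfolding cm \<gamma>k_def C_def ..
  have cm_n: "cone_mass (Suc d) d x = c * \<gamma>" unfolding cm \<gamma>_def by simp
  have \<gamma>: "0 < \<gamma>" "\<gamma> < \<infinity>" by (simp_all add: \<gamma>_def g_nrm nn_integral_leb_gauss)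
  have "\<gamma>k \<le> \<gamma>" unfolding \<gamma>k_def \<gamma>_def by (intro nn_integral_mono mult_left_mono) (auto simp: C_def cone_ind_def)
  then have \<gamma>k: "\<gamma>k < \<infinity>" using \<gamma>(2) by (rule le_less_trans)
  define a where "a = enn2real (\<gamma>k / \<gamma>)"
  have a: "ennreal a = \<gamma>k / \<gamma>" 
    unfolding a_def using \<gamma> \<gamma>k by (intro ennreal_enn2real) (auto simp: ennreal_divide_eq_top_iff less_top[symmetric])
  define V where "V r = (\<integral>\<^sup>+U. indicator {..<r} (nrm U) * C U \<partial>leb ?K)" for r :: real
  define Vn where "Vn r = (\<integral>\<^sup>+U. indicator {..<r} (nrm U) * (1::ennreal) \<partial>leb ?K)" for r :: real
  have Vn: "0 < Vn r" "Vn r < \<infinity>" if "r > 0" for r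
    using eball_measure_pos_finite[OF that, of d] by (simp_all add: Vn_def nrm_def)
  have V: "V r < \<infinity>" if "r > 0" for r
  proof -
    have "V r \<le> Vn r" unfolding V_def Vn_def by (intro nn_integral_mono mult_left_mono) (auto simp: C_def cone_ind_def)
    also have "\<dots> < \<infinity>" by (rule Vn(2)[OF that])
    finally show ?thesis .
  qed
  have nrm_scale: "nrm (vscale ?K t U) = t * nrm U" if "t > 0" for t U
    using that by (simp add: nrm_def vscale_def power_mult_distrib sum_distrib_left[symmetric] real_sqrt_mult)
  have S_scale: "S (vscale ?K t U) = vscale ?K t (S U)" for t U
    by (auto simp: S_def vscale_def fun_eq_iff sum_distrib_left mult.assoc)
  have C_scale: "C (vscale ?K t U) = C U" if "t > 0" for t U
    using that by (simp add: C_def S_scale cone_ind_vscale)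
  \<comment> \<open>Coordinate 0 exists because 1 <= k <= d; a vector of norm 0 has this coordinate
    equal to 0, which happens on a null set.\<close>
  have nrm_pos: "AE U in leb ?K. P U \<or> nrm U > 0" for P
  proof -
    have "AE U in leb ?K. U 0 \<noteq> 0" using k by (intro AE_leb_component_nonzero) auto
    then show ?thesis
    proof (rule AE_mp, intro AE_I2 impI disjI2)
      fix U :: "nat \<Rightarrow> real" assume "U 0 \<noteq> 0"
      then have "0 < (\<Sum>j<d. (U j)\<^sup>2)" using k by (intro sum_pos2[of _ 0]) auto
      then show "nrm U > 0" by (simp add: nrm_def)
    qed
  qed
  have ratio: "V r / Vn r = ennreal a" if "r > 0" for r
    unfolding a
  proof (rule ennreal_ratio_eq)
    show "V r * \<gamma> = \<gamma>k * Vn r" unfolding V_def \<gamma>_def \<gamma>k_def Vn_def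
      by (rule nn_integral_homogeneous_ratio) (use C_scale nrm_scale nrm_pos nrm_pos[of "\<lambda>_. False"] in auto)
  qed (use Vn that \<gamma> in auto)
  have lim: "((\<lambda>r. measure (Rsp d) (eball d z r \<inter> psimplex d X {..<Suc d}) / measure (Rsp d) (eball d z r)) \<longlongrightarrow> a) (at_right 0)"
    if zin: "z \<in> relint_simplex d X {..<k}" for z
  proof -
    obtain t where t: "\<And>i. i < k \<Longrightarrow> 0 < t i" "(\<Sum>i<k. t i) = 1" and z: "z = pcomb d X {..<k} t"
      using zin by (auto simp: relint_simplex_def)
    define D where "D y = vadd ?K y (vscale ?K (-1) z)" for y
    \<comment> \<open>Crude operator bound: \<open>nrm U < r\<close> moves each barycentric
      coordinate with index below d by at most r * b. The summand 1 makes \<open>b\<close>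
      positive.\<close>
    define b where "b = (\<Sum>l<d. \<Sum>j<d. \<bar>B j l\<bar>) + 1"
    have b: "b > 0" by (auto simp: b_def intro!: add_nonneg_pos sum_nonneg)
    define t0 where "t0 = Min (t ` {..<k})"
    have k0: "0 < k" using k by simp
    have "t0 \<in> t ` {..<k}" unfolding t0_def using k0 by (intro Min_in) auto
    then have t0: "t0 > 0" "\<And>i. i < k \<Longrightarrow> t0 \<le> t i" using t(1) by (auto simp: t0_def)
    \<comment> \<open>For r < t0/b the coordinates i < k cannot turn negative, so just the
      constraints i >= k remain, which are those of \<open>C\<close>. Since k <= d, the coordinates
      i < k are read off from \<open>S U\<close> itself and not from the dependent coordinate
      d.\<close>
    have *: "measure (Rsp d) (eball d z r \<inter> psimplex d X {..<Suc d}) / measure (Rsp d) (eball d z r) = a"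
      if r: "0 < r" "r < t0 / b" for r
    proof -
      have small: "0 \<le> t i + zext d (S U) i" if i: "i < k" and U: "nrm U < r" for U i
      proof -
        have Uj: "\<bar>U j\<bar> \<le> r" if "j < d" for j
          using member_le_L2_set[of "{..<d}" j "\<lambda>j. \<bar>U j\<bar>"] that U by (simp add: L2_set_def nrm_def)
        have id: "i < d" using i k by simp
        have "\<bar>zext d (S U) i\<bar> = \<bar>\<Sum>j<d. U j * B j i\<bar>" using id by (simp add: zext_def S_def)
        also have "\<dots> \<le> (\<Sum>j<d. \<bar>U j\<bar> * \<bar>B j i\<bar>)" by (rule order_trans[OF sum_abs]) (simp add: abs_mult)
        also have "\<dots> \<le> (\<Sum>j<d. r * \<bar>B j i\<bar>)" by (intro sum_mono mult_right_mono Uj) auto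
        also have "\<dots> = r * (\<Sum>j<d. \<bar>B j i\<bar>)" by (simp add: sum_distrib_left)
        also have "\<dots> \<le> r * b"
        proof (intro mult_left_mono)
          have "(\<Sum>j<d. \<bar>B j i\<bar>) \<le> (\<Sum>l<d. \<Sum>j<d. \<bar>B j l\<bar>)"
            using id by (intro member_le_sum[of i "{..<d}" "\<lambda>l. \<Sum>j<d. \<bar>B j l\<bar>"]) (auto intro!: sum_nonneg)
          then show "(\<Sum>j<d. \<bar>B j i\<bar>) \<le> b" by (simp add: b_def)
        qed (use r in auto)
        also have "\<dots> \<le> t0" using r b by (simp add: field_simps)
        finally show ?thesis using t0(2)[OF i] by linarith
      qed
      have emb: "emeasure (Rsp d) (eball d z r) = Vn r"
      proof -
        have e: "eball d z r = {y \<in> space (leb ?K). nrm (D y) < r}"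
          by (auto simp: eball_def Rsp_eq_leb edist_eq_norm nrm_def D_def)
        have [measurable]: "D \<in> leb ?K \<rightarrow>\<^sub>M leb ?K" unfolding D_def by (intro measurable_vadd measurable_ident_sets refl measurable_const_leb vscale_in_space)
        have "emeasure (Rsp d) (eball d z r) = (\<integral>\<^sup>+y. indicator {y \<in> space (leb ?K). nrm (D y) < r} y \<partial>leb ?K)"
          unfolding e Rsp_eq_leb by (rule nn_integral_indicator[symmetric]) measurable
        also have "\<dots> = (\<integral>\<^sup>+y. indicator {..<r} (nrm (D y)) * 1 \<partial>leb ?K)"
          by (intro nn_integral_cong) (auto simp: indicator_def)
        also have "\<dots> = Vn r" unfolding Vn_def D_def
          by (rule nn_integral_leb_translate[of ?K "\<lambda>U. indicator {..<r} (nrm U) * 1"]) auto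
        finally show ?thesis .
      qed
      have ems: "emeasure (Rsp d) (eball d z r \<inter> psimplex d X {..<Suc d}) = V r"
      proof -
        have mem: "y \<in> psimplex d X {..<Suc d} \<longleftrightarrow> C (D y) = 1" if y: "y \<in> space (leb ?K)" and r: "nrm (D y) < r" for y
        proof -
          have "y \<in> psimplex d X {..<Suc d} \<longleftrightarrow> (\<forall>i\<le>d. 0 \<le> (if i < k then t i else 0) + zext d (S (D y)) i)"
            unfolding D_def by (rule psimplex_iff_near_relint[OF ST[unfolded x_def] TS[unfolded x_def] le_SucI[OF k(2)] t(2) z y])
          also have "\<dots> \<longleftrightarrow> (\<forall>i\<in>{k..d}. 0 \<le> zext d (S (D y)) i)"
            using small[OF _ r] by (auto simp: not_less)
          also have "\<dots> \<longleftrightarrow> C (D y) = 1" by (simp add: C_def cone_ind_def)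
          finally show ?thesis .
        qed
        have e: "eball d z r \<inter> psimplex d X {..<Suc d} = {y \<in> space (leb ?K). nrm (D y) < r \<and> C (D y) = 1}"
          using mem by (auto simp: eball_def Rsp_eq_leb edist_eq_norm nrm_def D_def)
        have [measurable]: "D \<in> leb ?K \<rightarrow>\<^sub>M leb ?K" unfolding D_def by (intro measurable_vadd measurable_ident_sets refl measurable_const_leb vscale_in_space)
        have "emeasure (Rsp d) (eball d z r \<inter> psimplex d X {..<Suc d}) = (\<integral>\<^sup>+y. indicator {y \<in> space (leb ?K). nrm (D y) < r \<and> C (D y) = 1} y \<partial>leb ?K)"
          unfolding e Rsp_eq_leb by (rule nn_integral_indicator[symmetric]) measurable
        also have "\<dots> = (\<integral>\<^sup>+y. indicator {..<r} (nrm (D y)) * C (D y) \<partial>leb ?K)"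
          by (intro nn_integral_cong) (auto simp: indicator_def C_def cone_ind_def)
        also have "\<dots> = V r" unfolding V_def D_def
          by (rule nn_integral_leb_translate[of ?K "\<lambda>U. indicator {..<r} (nrm U) * C U"]) auto
        finally show ?thesis .
      qed
      obtain v w where v: "V r = ennreal v" "v \<ge> 0" and w: "Vn r = ennreal w" "w \<ge> 0"
        using V[OF r(1)] Vn(2)[OF r(1)] by (metis ennreal_cases infinity_ennreal_def less_irrefl)
      have "w > 0" using Vn(1)[OF r(1)] w by simp
      then have "ennreal (v / w) = ennreal a" using ratio[OF r(1)] v w by (simp add: divide_ennreal)
      then have "v / w = a" using v w by (subst (asm) ennreal_inj) (auto simp: a_def)
      then show ?thesis by (simp add: measure_def emb ems v w)
    qed
    have "\<forall>\<^sub>F r in at_right 0. measure (Rsp d) (eball d z r \<inter> psimplex d X {..<Suc d}) / measure (Rsp d) (eball d z r) = a"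
      unfolding eventually_at_right_field using * t0 b by (intro exI[of _ "t0 / b"]) auto
    then show ?thesis by (rule tendsto_eventually)
  qed
  \<comment> \<open>The barycentre of the face: with an empty relative interior every number would
    satisfy the definite description, and there would be no uniqueness.\<close>
  have ne: "pcomb d X {..<k} (\<lambda>_. 1 / k) \<in> relint_simplex d X {..<k}"
    unfolding relint_simplex_def using k by (intro CollectI exI[of _ "\<lambda>_. 1 / k"]) auto
  have "internal_angle d X {..<k} {..<Suc d} = a"
    unfolding internal_angle_def
  proof (rule the_equality)
    fix a' assume "\<forall>z\<in>relint_simplex d X {..<k}. ((\<lambda>r. measure (Rsp d) (eball d z r \<inter> psimplex d X {..<Suc d}) / measure (Rsp d) (eball d z r)) \<longlongrightarrow> a') (at_right 0)"
    from tendsto_unique[OF trivial_limit_at_right_real bspec[OF this ne] lim[OF ne]] show "a' = a" .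
  qed (use lim in blast)
  moreover have "cone_mass k d x / cone_mass (Suc d) d x = \<gamma>k / \<gamma>"
    unfolding cm_k cm_n using c by (simp add: mult.commute[of c] divide_mult_eq)
  ultimately show "0 \<le> internal_angle d X {..<k} {..<Suc d}"
    "ennreal (internal_angle d X {..<k} {..<Suc d}) = cone_mass k d x / cone_mass (Suc d) d x"
    using a by (simp_all add: a_def)
qed

section \<open>Averaging over Gaussian points with given precisions\<close>

text \<open>Twice the variance of each coordinate of the sum of the vectors
  \<open>zext d \<nu> i\<close> times X_i, when the X_i are independent with densities proportional
  to exp(- s_i |x|^2).\<close>

definition qform :: "nat \<Rightarrow> (nat \<Rightarrow> real) \<Rightarrow> (nat \<Rightarrow> real) \<Rightarrow> real" where
  "qform d s \<nu> = (\<Sum>i<Suc d. (zext d \<nu> i)\<^sup>2 / s i)"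

definition cone_gauss :: "nat \<Rightarrow> nat \<Rightarrow> (nat \<Rightarrow> real) \<Rightarrow> ennreal" where
  "cone_gauss k d s = (\<integral>\<^sup>+\<nu>. cone_ind k d \<nu> * ennreal (exp (- qform d s \<nu>)) \<partial>leb {..<d})"

definition weight :: "nat \<Rightarrow> (nat \<Rightarrow> real) \<Rightarrow> (nat \<times> nat \<Rightarrow> real) \<Rightarrow> ennreal" where
  "weight d s x = ennreal (exp (- (\<Sum>j<d. \<Sum>i<Suc d. s i * (x (i, j))\<^sup>2)))"

text \<open>For fixed non-degenerate points the quotient is a probability density in \<nu>, and this
  is its unnormalised average over Gaussian points. Dividing before averaging makes its integral
  over the cone an average of angles.\<close>

definition smoothed :: "nat \<Rightarrow> (nat \<Rightarrow> real) \<Rightarrow> (nat \<Rightarrow> real) \<Rightarrow> ennreal" where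
  "smoothed d s \<nu> = (\<integral>\<^sup>+x. weight d s x * (edge_gauss d x \<nu> / cone_mass (Suc d) d x) \<partial>leb ({..<Suc d} \<times> {..<d}))"

lemma measurable_weight [measurable]: "weight d s \<in> borel_measurable (leb ({..<Suc d} \<times> {..<d}))"
proof -
  have [measurable]: "(\<lambda>x. \<Sum>j<d. \<Sum>i<Suc d. s i * (x (i, j))\<^sup>2) \<in> borel_measurable (leb ({..<Suc d} \<times> {..<d}))"
    by (intro borel_measurable_sum borel_measurable_times borel_measurable_const borel_measurable_power
      measurable_leb_component[OF measurable_ident]) auto
  show ?thesis unfolding weight_def by measurable
qed

lemma measurable_qform [measurable]: "qform d s \<in> borel_measurable (leb {..<d})"
  unfolding qform_def by measurable

lemma qform_nonneg: "(\<And>i. i \<le> d \<Longrightarrow> s i > 0) \<Longrightarrow> 0 \<le> qform d s \<nu>"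
  unfolding qform_def by (intro sum_nonneg divide_nonneg_pos) auto

lemma qform_vscale: "qform d s (vscale {..<d} t \<nu>) = t\<^sup>2 * qform d s \<nu>"
  by (simp add: qform_def zext_vscale power_mult_distrib sum_distrib_left distrib_left)

lemma qform_eq_0:
  assumes s: "\<And>i. i \<le> d \<Longrightarrow> s i > 0" and "qform d s \<nu> = 0" "i \<le> d"
  shows "zext d \<nu> i = 0"
proof -
  have "\<forall>i\<in>{..<Suc d}. (zext d \<nu> i)\<^sup>2 / s i = 0"
    using assms unfolding qform_def by (subst (asm) sum_nonneg_eq_0_iff) (auto intro!: divide_nonneg_pos)
  then show ?thesis using s[OF assms(3)] assms(3) by fastforce
qed

text \<open>The reflection exchanging two vectors of equal length for the quadratic form \<open>qform d s\<close> and its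
  transpose acting on the points preserve all the integrals defining \<open>smoothed\<close>.\<close>

lemma smoothed_cong_qform:
  fixes s :: "nat \<Rightarrow> real"
  assumes s: "\<And>i. i \<le> d \<Longrightarrow> s i > 0"
    and \<nu>: "\<nu> \<in> space (leb {..<d})" and \<nu>': "\<nu>' \<in> space (leb {..<d})"
    and eq: "qform d s \<nu> = qform d s \<nu>'"
  shows "smoothed d s \<nu>' = smoothed d s \<nu>"
proof (cases "\<nu> = \<nu>'")
  case False
  let ?K = "{..<Suc d} \<times> {..<d}"
  \<comment> \<open>Reflection along z = \<nu> - \<nu>' for the bilinear form of
    \<open>qform\<close>: \<open>Q\<close> is the squared length of z, and
    \<open>\<beta> \<mu>\<close> the pairing of \<mu> with z.\<close>
  define z where "z i = zext d \<nu> i - zext d \<nu>' i" for i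
  define Q where "Q = (\<Sum>i<Suc d. (z i)\<^sup>2 / s i)"
  define \<beta> where "\<beta> \<mu> = (\<Sum>i<Suc d. zext d \<mu> i * z i / s i)" for \<mu>
  define \<rho> where "\<rho> \<mu> = (\<lambda>l\<in>{..<d}. \<mu> l - (2 / Q) * \<beta> \<mu> * z l)" for \<mu>
  \<comment> \<open>\<open>R\<close> is the transpose of \<rho>: combining reflected points with
    \<mu> is combining the original points with \<open>\<rho> \<mu>\<close>. It is also the
    reflection for the dual form, the sum of s_i x_i^2, and therefore leaves \<open>weight\<close>
    unchanged.\<close>
  define Z where "Z x j = (\<Sum>i<Suc d. z i * x (i, j))" for x :: "nat \<times> nat \<Rightarrow> real" and j
  define R where "R x = (\<lambda>p\<in>?K. x p - (2 / Q) * (z (fst p) / s (fst p)) * Z x (snd p))" for x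
  have zsum: "(\<Sum>i<Suc d. z i) = 0" by (simp only: z_def sum_subtractf sum_zext)
  have spos: "s i > 0" if "i \<in> {..<Suc d}" for i using s that by auto
  obtain l where l: "l < d" "\<nu> l \<noteq> \<nu>' l"
    using False \<nu> \<nu>' by (auto simp: fun_eq_iff space_leb PiE_iff extensional_def) (metis)
  have Q: "Q > 0" unfolding Q_def
    using l spos by (intro sum_pos2[of _ l]) (auto simp: z_def zext_def intro!: divide_nonneg_pos divide_pos_pos)
  have zext\<rho>: "zext d (\<rho> \<mu>) i = zext d \<mu> i - (2 / Q) * \<beta> \<mu> * z i" if "i \<le> d" for \<mu> i
  proof -
    have "zext d (\<rho> \<mu>) i = zext d (\<lambda>l. zext d \<mu> l - (2 / Q) * \<beta> \<mu> * z l) i"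
      by (rule zext_cong) (simp add: \<rho>_def zext_def)
    also have "\<dots> = zext d \<mu> i - (2 / Q) * \<beta> \<mu> * z i"
      using that by (intro zext_sum_zero) (simp_all only: sum_subtractf sum_zext sum_distrib_left[symmetric] zsum)
    finally show ?thesis .
  qed
  have \<beta>\<rho>: "\<beta> (\<rho> \<mu>) = - \<beta> \<mu>" for \<mu>
  proof -
    have "\<beta> (\<rho> \<mu>) = (\<Sum>i<Suc d. zext d \<mu> i * z i / s i - (2 / Q) * \<beta> \<mu> * ((z i)\<^sup>2 / s i))"
      unfolding \<beta>_def by (intro sum.cong refl, subst zext\<rho>) (auto simp: \<beta>_def left_diff_distrib power2_eq_square diff_divide_distrib)
    also have "\<dots> = \<beta> \<mu> - (2 / Q) * \<beta> \<mu> * Q"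
      unfolding sum_subtractf sum_distrib_left[symmetric] Q_def[symmetric] \<beta>_def[symmetric] ..
    finally show ?thesis using Q by simp
  qed
  have \<rho>\<rho>: "\<rho> (\<rho> \<mu>) = \<mu>" if "\<mu> \<in> space (leb {..<d})" for \<mu>
  proof
    fix m show "\<rho> (\<rho> \<mu>) m = \<mu> m"
    proof (cases "m < d")
      case True
      then have "\<rho> (\<rho> \<mu>) m = \<rho> \<mu> m + (2 / Q) * \<beta> \<mu> * z m" by (simp add: \<rho>_def[of "\<rho> \<mu>"] \<beta>\<rho>)
      then show ?thesis using True by (simp add: \<rho>_def[of \<mu>])
    qed (use that in \<open>auto simp: \<rho>_def space_leb PiE_iff extensional_def\<close>)
  qed
  have \<beta>_add: "\<beta> (vadd {..<d} \<mu> \<mu>') = \<beta> \<mu> + \<beta> \<mu>'" for \<mu> \<mu>'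
    by (simp only: \<beta>_def zext_vadd distrib_right add_divide_distrib sum.distrib)
  have \<rho>_add: "\<rho> (vadd {..<d} \<mu> \<mu>') = vadd {..<d} (\<rho> \<mu>) (\<rho> \<mu>')" for \<mu> \<mu>'
    by (auto simp: \<rho>_def \<beta>_add vadd_def[of _ "restrict _ _"] fun_eq_iff algebra_simps)
       (auto simp: vadd_def algebra_simps add_divide_distrib)
  have \<beta>_meas [measurable]: "\<beta> \<in> borel_measurable (leb {..<d})" unfolding \<beta>_def by measurable
  have \<rho>_meas [measurable]: "\<rho> \<in> leb {..<d} \<rightarrow>\<^sub>M leb {..<d}"
    unfolding \<rho>_def by (intro measurable_restrict) (auto intro!: borel_measurable_diff borel_measurable_times measurable_leb_component[OF measurable_ident])
  \<comment> \<open>Equal lengths give Q = 2 \<open>\<beta> \<nu>\<close>, so the reflection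
    subtracts exactly z.\<close>
  have \<rho>\<nu>: "\<rho> \<nu> = \<nu>'"
  proof -
    have "Q = qform d s \<nu> + qform d s \<nu>' - 2 * (\<Sum>i<Suc d. zext d \<nu> i * zext d \<nu>' i / s i)"
      unfolding Q_def qform_def sum_distrib_left sum.distrib[symmetric] sum_subtractf[symmetric]
      by (intro sum.cong refl) (simp add: z_def power2_eq_square algebra_simps add_divide_distrib diff_divide_distrib)
    also have "\<dots> = 2 * (qform d s \<nu> - (\<Sum>i<Suc d. zext d \<nu> i * zext d \<nu>' i / s i))" using eq by simp
    also have "qform d s \<nu> - (\<Sum>i<Suc d. zext d \<nu> i * zext d \<nu>' i / s i) = \<beta> \<nu>"
      unfolding qform_def \<beta>_def sum_subtractf[symmetric]
      by (intro sum.cong refl) (simp add: z_def power2_eq_square algebra_simps diff_divide_distrib)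
    finally have "(2 / Q) * \<beta> \<nu> = 1" using Q by (simp add: field_simps)
    then show ?thesis using \<nu>' 
      by (auto simp: \<rho>_def fun_eq_iff z_def zext_def space_leb PiE_iff extensional_def)
  qed
  have Zb: "(\<Sum>i<Suc d. z i * (c * (z i / s i) * y)) = c * Q * y" for c y :: real
    unfolding Q_def sum_distrib_left sum_distrib_right by (intro sum.cong refl) (simp add: power2_eq_square)
  have R_app: "R x (i, j) = x (i, j) - (2 / Q) * (z i / s i) * Z x j" if "i < Suc d" "j < d" for x i j
    using that by (simp add: R_def)
  have ZR: "Z (R x) j = - Z x j" if "j < d" for x j
  proof -
    have "Z (R x) j = (\<Sum>i<Suc d. z i * x (i, j) - z i * ((2 / Q) * (z i / s i) * Z x j))"
      unfolding Z_def[of "R x"] using that by (intro sum.cong refl) (simp add: R_app right_diff_distrib)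
    also have "\<dots> = Z x j - (2 / Q) * Q * Z x j" unfolding sum_subtractf Zb Z_def ..
    finally show ?thesis using Q by simp
  qed
  have RR: "R (R x) = x" if "x \<in> space (leb ?K)" for x
  proof
    fix p show "R (R x) p = x p"
    proof (cases "p \<in> ?K")
      case True
      then show ?thesis by (auto simp: R_app ZR)
    qed (use that in \<open>cases p, auto simp: R_def space_leb PiE_iff extensional_def\<close>)
  qed
  have Z_add: "Z (vadd ?K x y) j = Z x j + Z y j" if "j < d" for x y j
    unfolding Z_def sum.distrib[symmetric] using that by (intro sum.cong refl) (simp add: vadd_def algebra_simps)
  have R_add: "R (vadd ?K x y) = vadd ?K (R x) (R y)" for x y
  proof
    fix p show "R (vadd ?K x y) p = vadd ?K (R x) (R y) p"
    proof (cases "p \<in> ?K")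
      case True
      then obtain i j where p: "p = (i, j)" "i < Suc d" "j < d" by auto
      then have "R (vadd ?K x y) p = vadd ?K x y p - (2 / Q) * (z i / s i) * (Z x j + Z y j)"
        by (simp add: R_app Z_add)
      with p show ?thesis by (simp add: R_app vadd_def algebra_simps add_divide_distrib)
    qed (auto simp: R_def vadd_def)
  qed
  have R_meas [measurable]: "R \<in> leb ?K \<rightarrow>\<^sub>M leb ?K"
    unfolding R_def Z_def
    by (intro measurable_restrict) (auto intro!: borel_measurable_diff borel_measurable_times borel_measurable_sum measurable_leb_component[OF measurable_ident])
  have wR: "weight d s (R x) = weight d s x" for x
  proof -
    have "(\<Sum>i<Suc d. s i * (R x (i, j))\<^sup>2) = (\<Sum>i<Suc d. s i * (x (i, j))\<^sup>2)" if j: "j < d" for j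
    proof -
      have "(\<Sum>i<Suc d. s i * (R x (i, j))\<^sup>2) = (\<Sum>i<Suc d. s i * (x (i, j))\<^sup>2 - (4 / Q * Z x j) * (z i * x (i, j)) 
          + z i * ((4 / Q\<^sup>2) * (z i / s i) * (Z x j)\<^sup>2))"
      proof (intro sum.cong refl)
        fix i assume i: "i \<in> {..<Suc d}"
        have "s i * (a - 2 / Q * (z i / s i) * b)\<^sup>2 = s i * a\<^sup>2 - (4 / Q * b) * (z i * a) + z i * ((4 / Q\<^sup>2) * (z i / s i) * b\<^sup>2)" for a b
          using spos[OF i] Q by (simp add: power2_eq_square field_simps)
        then show "s i * (R x (i, j))\<^sup>2 = s i * (x (i, j))\<^sup>2 - (4 / Q * Z x j) * (z i * x (i, j)) + z i * ((4 / Q\<^sup>2) * (z i / s i) * (Z x j)\<^sup>2)"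
          using i j by (simp add: R_app)
      qed
      also have "\<dots> = (\<Sum>i<Suc d. s i * (x (i, j))\<^sup>2) - (4 / Q * Z x j) * Z x j + (4 / Q\<^sup>2) * Q * (Z x j)\<^sup>2"
        unfolding sum.distrib sum_subtractf Zb sum_distrib_left[symmetric] Z_def[symmetric] ..
      also have "\<dots> = (\<Sum>i<Suc d. s i * (x (i, j))\<^sup>2)" using Q by (simp add: power2_eq_square)
      finally show ?thesis .
    qed
    then show ?thesis unfolding weight_def by (simp del: sum.lessThan_Suc)
  qed
  have ecR: "edge_comb d (R x) \<mu> j = edge_comb d x (\<rho> \<mu>) j" if j: "j < d" for x \<mu> j
  proof -
    have "edge_comb d (R x) \<mu> j = (\<Sum>i<Suc d. zext d \<mu> i * x (i, j) - (2 / Q * Z x j) * (zext d \<mu> i * z i / s i))"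
      unfolding edge_comb_def using j by (intro sum.cong refl) (simp add: R_app algebra_simps)
    also have "\<dots> = (\<Sum>i<Suc d. zext d \<mu> i * x (i, j)) - (2 / Q * \<beta> \<mu>) * Z x j"
      unfolding sum_subtractf sum_distrib_left[symmetric] \<beta>_def[symmetric] by simp
    also have "\<dots> = (\<Sum>i<Suc d. zext d \<mu> i * x (i, j) - (2 / Q * \<beta> \<mu>) * (z i * x (i, j)))"
      unfolding sum_subtractf sum_distrib_left[symmetric] Z_def ..
    also have "\<dots> = edge_comb d x (\<rho> \<mu>) j"
      unfolding edge_comb_def by (intro sum.cong refl) (simp add: zext\<rho> algebra_simps)
    finally show ?thesis .
  qed
  have egR: "edge_gauss d (R x) \<mu> = edge_gauss d x (\<rho> \<mu>)" for x \<mu>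
    by (simp add: edge_gauss_def ecR)
  \<comment> \<open>The denominator integrates over all \<nu>, so the involution \<rho> is removed
    by a change of variable.\<close>
  have cmR: "cone_mass (Suc d) d (R x) = cone_mass (Suc d) d x" if x: "x \<in> space (leb ?K)" for x
    unfolding cone_mass_def egR cone_ind_Suc
    using x by (intro nn_integral_leb_additive_involution[of "{..<d}" \<rho> "\<lambda>\<nu>. 1 * edge_gauss d x \<nu>"] \<rho>\<rho> \<rho>_add) measurable
  have "smoothed d s \<nu> = (\<integral>\<^sup>+x. weight d s (R x) * (edge_gauss d (R x) \<nu> / cone_mass (Suc d) d (R x)) \<partial>leb ?K)"
    unfolding smoothed_def using \<nu>
    by (intro nn_integral_leb_additive_involution[symmetric] RR R_add) measurable
  also have "\<dots> = smoothed d s \<nu>'"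
    unfolding smoothed_def by (intro nn_integral_cong) (simp add: wR egR cmR \<rho>\<nu>)
  finally show ?thesis ..
qed simp


lemma measurable_smoothed [measurable]: "smoothed d s \<in> borel_measurable (leb {..<d})"
proof -
  interpret sigma_finite_measure "leb ({..<Suc d} \<times> {..<d})" by (rule sigma_finite_leb) simp
  show ?thesis unfolding smoothed_def by measurable
qed

text \<open>After exchanging integrals, the first factor is the integral of \<open>smoothed\<close>
  over the cone. By the reflections \<open>smoothed\<close> depends on N =
  sqrt(\<open>qform\<close>) alone, so it can be traded for the profile exp(-N^2), with the
  unconstrained case k = d + 1 as reference.\<close>

lemma nn_integral_cone_ratio_weight:
  fixes s :: "nat \<Rightarrow> real"
  assumes s: "\<And>i. i \<le> d \<Longrightarrow> s i > 0" and d: "1 \<le> d"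
  shows "(\<integral>\<^sup>+x. weight d s x * (cone_mass k d x / cone_mass (Suc d) d x) \<partial>leb ({..<Suc d} \<times> {..<d})) * cone_gauss (Suc d) d s
    = cone_gauss k d s * (\<integral>\<^sup>+x. weight d s x \<partial>leb ({..<Suc d} \<times> {..<d}))"
proof -
  let ?K = "{..<Suc d} \<times> {..<d}" and ?L = "{..<d}"
  have inner: "(\<integral>\<^sup>+x. weight d s x * (cone_mass m d x / cone_mass (Suc d) d x) \<partial>leb ?K) = (\<integral>\<^sup>+\<nu>. smoothed d s \<nu> * cone_ind m d \<nu> \<partial>leb ?L)" for m
  proof -
    have "(\<integral>\<^sup>+x. weight d s x * (cone_mass m d x / cone_mass (Suc d) d x) \<partial>leb ?K)
      = (\<integral>\<^sup>+x. \<integral>\<^sup>+\<nu>. weight d s x * (edge_gauss d x \<nu> / cone_mass (Suc d) d x) * cone_ind m d \<nu> \<partial>leb ?L \<partial>leb ?K)"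
    proof (rule nn_integral_cong)
      fix x assume x: "x \<in> space (leb ?K)"
      have "weight d s x * (cone_mass m d x / cone_mass (Suc d) d x) 
        = (\<integral>\<^sup>+\<nu>. weight d s x / cone_mass (Suc d) d x * (cone_ind m d \<nu> * edge_gauss d x \<nu>) \<partial>leb ?L)"
        unfolding cone_mass_def[of m] using x
        by (subst nn_integral_cmult) (auto simp: divide_ennreal_def mult_ac)
      also have "\<dots> = (\<integral>\<^sup>+\<nu>. weight d s x * (edge_gauss d x \<nu> / cone_mass (Suc d) d x) * cone_ind m d \<nu> \<partial>leb ?L)"
        by (intro nn_integral_cong) (simp add: divide_ennreal_def mult_ac)
      finally show "weight d s x * (cone_mass m d x / cone_mass (Suc d) d x) = \<dots>" .
    qed
    also have "\<dots> = (\<integral>\<^sup>+\<nu>. \<integral>\<^sup>+x. weight d s x * (edge_gauss d x \<nu> / cone_mass (Suc d) d x) * cone_ind m d \<nu> \<partial>leb ?K \<partial>leb ?L)"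
      by (rule nn_integral_leb_swap) (simp, simp, measurable)
    also have "\<dots> = (\<integral>\<^sup>+\<nu>. smoothed d s \<nu> * cone_ind m d \<nu> \<partial>leb ?L)"
    proof (rule nn_integral_cong)
      fix \<nu> assume \<nu>: "\<nu> \<in> space (leb ?L)"
      show "(\<integral>\<^sup>+x. weight d s x * (edge_gauss d x \<nu> / cone_mass (Suc d) d x) * cone_ind m d \<nu> \<partial>leb ?K) = smoothed d s \<nu> * cone_ind m d \<nu>"
        unfolding smoothed_def using \<nu> by (intro nn_integral_multc) measurable
    qed
    finally show ?thesis .
  qed
  \<comment> \<open>Without constraints the quotient is 1 except on the null set of degenerate
    configurations.\<close>
  have total: "(\<integral>\<^sup>+x. weight d s x * (cone_mass (Suc d) d x / cone_mass (Suc d) d x) \<partial>leb ?K) = (\<integral>\<^sup>+x. weight d s x \<partial>leb ?K)"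
  proof (rule nn_integral_cong_AE, rule AE_mp[OF AE_det_edge_mat_nonzero[OF order_refl]], intro AE_I2 impI)
    fix x assume "det (edge_mat d d x) \<noteq> 0"
    from cone_mass_pos_finite[OF this] show "weight d s x * (cone_mass (Suc d) d x / cone_mass (Suc d) d x) = weight d s x"
      by (simp add: ennreal_divide_self)
  qed
  \<comment> \<open>Any non-zero vector would do; one exists because d >= 1. For t > 0,
    \<open>\<phi> t\<close> below samples \<open>smoothed\<close> on this ray at
    \<open>qform\<close>-length t.\<close>
  define e0 :: "nat \<Rightarrow> real" where "e0 = (\<lambda>l\<in>?L. if l = 0 then 1 else 0)"
  have "qform d s e0 \<noteq> 0" using qform_eq_0[of d s e0 0] s d by (auto simp: e0_def zext_def)
  then have q0: "qform d s e0 > 0" using qform_nonneg[of d s e0] s by (simp add: less_le)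
  define N where "N \<nu> = sqrt (qform d s \<nu>)" for \<nu>
  define \<phi> where "\<phi> t = smoothed d s (vscale ?L (t / sqrt (qform d s e0)) e0)" for t
  have e0: "e0 \<in> space (leb ?L)" by (simp add: e0_def space_leb)
  have \<phi>_meas [measurable]: "\<phi> \<in> borel_measurable borel"
    unfolding \<phi>_def by (rule measurable_compose[OF measurable_vscale measurable_smoothed]) (use e0 in measurable)
  have N_meas [measurable]: "N \<in> borel_measurable (leb ?L)" unfolding N_def by measurable
  have \<phi>N: "smoothed d s \<nu> = \<phi> (N \<nu>)" if "\<nu> \<in> space (leb ?L)" for \<nu>
    unfolding \<phi>_def
  proof (rule smoothed_cong_qform[OF s])
    show "qform d s (vscale ?L (N \<nu> / sqrt (qform d s e0)) e0) = qform d s \<nu>"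
      using q0 qform_nonneg[of d s \<nu>] s by (simp add: qform_vscale N_def power_divide)
  qed (use that vscale_in_space in auto)
  have N_scale: "N (vscale ?L t \<nu>) = t * N \<nu>" if "t > 0" for t \<nu>
    using that by (simp add: N_def qform_vscale real_sqrt_mult)
  have N_pos: "AE \<nu> in leb ?L. P \<nu> \<or> N \<nu> > 0" for P
  proof -
    have "AE \<nu> in leb ?L. \<nu> 0 \<noteq> 0" using d by (intro AE_leb_component_nonzero) auto
    then show ?thesis
    proof (rule AE_mp, intro AE_I2 impI disjI2)
      fix \<nu> :: "nat \<Rightarrow> real" assume "\<nu> 0 \<noteq> 0"
      then have "qform d s \<nu> \<noteq> 0" using qform_eq_0[of d s \<nu> 0] s d by (auto simp: zext_def)
      then show "N \<nu> > 0" using qform_nonneg[of d s \<nu>] s by (simp add: N_def less_le)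
    qed
  qed
  have gauss: "ennreal (exp (- (N \<nu>)\<^sup>2)) = ennreal (exp (- qform d s \<nu>))" for \<nu>
    using qform_nonneg[of d s \<nu>] s by (simp add: N_def)
  have ratio: "(\<integral>\<^sup>+\<nu>. \<phi> (N \<nu>) * cone_ind k d \<nu> \<partial>leb ?L) * (\<integral>\<^sup>+\<nu>. ennreal (exp (- (N \<nu>)\<^sup>2)) * cone_ind (Suc d) d \<nu> \<partial>leb ?L)
    = (\<integral>\<^sup>+\<nu>. ennreal (exp (- (N \<nu>)\<^sup>2)) * cone_ind k d \<nu> \<partial>leb ?L) * (\<integral>\<^sup>+\<nu>. \<phi> (N \<nu>) * cone_ind (Suc d) d \<nu> \<partial>leb ?L)"
  proof (rule nn_integral_homogeneous_ratio[where \<xi>="\<lambda>u. ennreal (exp (- u\<^sup>2))"])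
    show "cone_ind k d \<in> borel_measurable (leb ?L)" "cone_ind (Suc d) d \<in> borel_measurable (leb ?L)"
      using measurable_cone_ind[OF measurable_ident_sets[OF refl]] by auto
  qed (use N_scale N_pos N_pos[of "\<lambda>_. False"] in \<open>auto simp: cone_ind_vscale\<close>)
  have gm: "(\<integral>\<^sup>+\<nu>. ennreal (exp (- (N \<nu>)\<^sup>2)) * cone_ind m d \<nu> \<partial>leb ?L) = cone_gauss m d s" for m
    unfolding cone_gauss_def gauss by (simp add: mult.commute)
  have \<phi>m: "(\<integral>\<^sup>+\<nu>. \<phi> (N \<nu>) * cone_ind m d \<nu> \<partial>leb ?L) = (\<integral>\<^sup>+x. weight d s x * (cone_mass m d x / cone_mass (Suc d) d x) \<partial>leb ?K)" for m
    unfolding inner by (intro nn_integral_cong) (simp add: \<phi>N)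
  show ?thesis using ratio unfolding gm \<phi>m total .
qed

section \<open>Convolutions and Laplace variables\<close>

text \<open>Exhaustion: substitute on the intervals from -n to n and let n grow. The image of g may
  be a proper subset of the line, as for s = c exp(2a) below.\<close>

lemma nn_integral_substitution_range:
  fixes f :: "real \<Rightarrow> ennreal" and g g' :: "real \<Rightarrow> real"
  assumes f [measurable]: "f \<in> borel_measurable borel"
    and g: "\<And>x. (g has_real_derivative g' x) (at x)"
    and cont: "continuous_on UNIV g'" and nonneg: "\<And>x. g' x \<ge> 0"
  shows "(\<integral>\<^sup>+x. f (g x) * ennreal (g' x) \<partial>lborel) = (\<integral>\<^sup>+y. f y * indicator (range g) y \<partial>lborel)"
proof -
  have [measurable]: "g' \<in> borel_measurable borel" using cont by (rule borel_measurable_continuous_onI)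
  have contg: "continuous_on A g" for A
    using g by (meson DERIV_isCont continuous_at_imp_continuous_on)
  have [measurable]: "g \<in> borel_measurable borel" by (rule borel_measurable_continuous_onI[OF contg])
  have mono: "g x \<le> g y" if "x \<le> y" for x y
    using that g nonneg by (intro DERIV_nonneg_imp_nondecreasing[of x y g]) blast+
  have eq: "(\<integral>\<^sup>+x. f x * indicator {g (- real n)..g n} x \<partial>lborel) = (\<integral>\<^sup>+x. f (g x) * g' x * indicator {- real n..n} x \<partial>lborel)" for n
  proof (cases n)
    case 0
    have "(\<integral>\<^sup>+x. f x * indicator {g 0} x \<partial>lborel) = 0"
      using AE_lborel_singleton[of "g 0"] by (subst nn_integral_0_iff_AE) (auto elim!: eventually_mono)
    moreover have "(\<integral>\<^sup>+x. f (g x) * g' x * indicator {0} x \<partial>lborel) = 0"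
      using AE_lborel_singleton[of "0::real"] by (subst nn_integral_0_iff_AE) (auto elim!: eventually_mono)
    ultimately show ?thesis using 0 by simp
  next
    case (Suc m)
    show ?thesis
      by (rule nn_integral_substitution_aux) (use Suc g cont nonneg in \<open>auto intro: continuous_on_subset\<close>)
  qed
  have dens: "(SUP n. \<integral>\<^sup>+x. h x * indicator (A n) x \<partial>lborel) = (\<integral>\<^sup>+x. h x * indicator (\<Union>n. A n) x \<partial>lborel)"
    if [measurable]: "h \<in> borel_measurable borel" and A: "\<And>n. A n \<in> sets borel" "incseq A" 
    for h :: "real \<Rightarrow> ennreal" and A :: "nat \<Rightarrow> real set"
  proof -
    have U: "(\<Union>n. A n) \<in> sets borel" using A(1) by auto
    have "(SUP n. emeasure (density lborel h) (A n)) = emeasure (density lborel h) (\<Union>n. A n)"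
      using A by (intro SUP_emeasure_incseq) auto
    then show ?thesis using A(1) U by (simp add: emeasure_density)
  qed
  have R: "(\<Union>n. {g (- real n)..g n}) = range g"
  proof (intro equalityI subsetI)
    fix y assume "y \<in> (\<Union>n. {g (- real n)..g n})"
    then obtain n :: nat where "g (- real n) \<le> y" "y \<le> g n" by auto
    then obtain x where "g x = y" using IVT'[of g "- real n" y "real n"] contg by auto
    then show "y \<in> range g" by auto
  next
    fix y assume "y \<in> range g"
    then obtain x where x: "y = g x" by auto
    obtain n :: nat where "\<bar>x\<bar> \<le> n" using real_arch_simple by blast
    then have "- real n \<le> x" "x \<le> n" by auto
    then have "y \<in> {g (- real n)..g n}" using x mono by auto
    then show "y \<in> (\<Union>n. {g (- real n)..g n})" by (rule UN_I[OF UNIV_I])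
  qed
  have D: "(\<Union>n::nat. {- real n..n}) = UNIV"
  proof (intro equalityI subsetI UNIV_I)
    fix x :: real 
    obtain n :: nat where "\<bar>x\<bar> \<le> n" using real_arch_simple by blast
    then have "- real n \<le> x" "x \<le> n" by auto
    then show "x \<in> (\<Union>n::nat. {- real n..n})" by auto
  qed
  have "(\<integral>\<^sup>+y. f y * indicator (range g) y \<partial>lborel) = (SUP n. \<integral>\<^sup>+x. f x * indicator {g (- real n)..g n} x \<partial>lborel)"
    unfolding R[symmetric] by (rule dens[symmetric]) (auto simp: incseq_def intro!: mono order_trans[OF mono] order_trans[OF _ mono])
  also have "\<dots> = (SUP n. \<integral>\<^sup>+x. f (g x) * g' x * indicator {- real n..n} x \<partial>lborel)" by (simp only: eq)
  also have "\<dots> = (\<integral>\<^sup>+x. f (g x) * g' x * indicator (\<Union>n::nat. {- real n..n}) x \<partial>lborel)"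
    by (rule dens) (auto simp: incseq_def)
  finally show ?thesis by (simp add: D)
qed

text \<open>With c = |y| > 0 and s = c exp(2a) the exponent becomes -2c - (2 sqrt c sinh a)^2, and
  the Jacobian leaves the factor 2 sqrt c exp a. The rest is even in a, so symmetrising turns this
  factor into 2 sqrt c cosh a, the derivative of 2 sqrt c sinh a, and a Gaussian integral remains.
  For y = 0 the integral is Gamma(1/2).\<close>

lemma nn_integral_exp_plus_inverse:
  fixes y :: real
  shows "(\<integral>\<^sup>+s. indicator {0<..} s * ennreal (exp (- s - y\<^sup>2 / s) / sqrt s) \<partial>lborel) = ennreal (sqrt pi * exp (- 2 * \<bar>y\<bar>))"
proof (cases "y = 0")
  case True
  have "(\<integral>\<^sup>+s. indicator {0<..} s * ennreal (exp (- s - y\<^sup>2 / s) / sqrt s) \<partial>lborel) 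
      = (\<integral>\<^sup>+t. ennreal (indicator {0..} t * t powr (1 / 2 - 1) / exp t) \<partial>lborel)"
    using True by (intro nn_integral_cong)
      (auto simp: indicator_def powr_minus powr_half_sqrt exp_minus field_simps)
  also have "\<dots> = ennreal (sqrt pi)"
    using Gamma_conv_nn_integral_real[of "1 / 2"] by (simp add: Gamma_one_half_real)
  finally show ?thesis using True by simp
next
  case False
  define c where "c = \<bar>y\<bar>"
  have c: "c > 0" using False by (simp add: c_def)
  define f where "f s = indicator {0<..} s * ennreal (exp (- s - c\<^sup>2 / s) / sqrt s)" for s :: real
  have f [measurable]: "f \<in> borel_measurable borel" unfolding f_def by measurable
  define h where "h a = ennreal (exp (- 2 * c) * exp (- (2 * sqrt c * sinh a)\<^sup>2))" for a :: real
  have h [measurable]: "h \<in> borel_measurable borel" unfolding h_def sinh_def by measurable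
  have rng: "range (\<lambda>a. c * exp (2 * a)) = {0<..}"
  proof (intro equalityI subsetI)
    fix s :: real assume "s \<in> {0<..}"
    then have "s = c * exp (2 * (ln (s / c) / 2))" using c by simp
    then show "s \<in> range (\<lambda>a. c * exp (2 * a))" by blast
  qed (use c in auto)
  have "(\<integral>\<^sup>+s. f s \<partial>lborel) = (\<integral>\<^sup>+s. f s * indicator (range (\<lambda>a. c * exp (2 * a))) s \<partial>lborel)"
    unfolding rng by (intro nn_integral_cong) (auto simp: f_def indicator_def)
  also have "\<dots> = (\<integral>\<^sup>+a. f (c * exp (2 * a)) * ennreal (2 * c * exp (2 * a)) \<partial>lborel)"
    using c by (intro nn_integral_substitution_range[symmetric]) (auto intro!: derivative_eq_intros continuous_intros)
  also have "\<dots> = (\<integral>\<^sup>+a. ennreal (sqrt c * exp a) * h a + ennreal (sqrt c * exp a) * h a \<partial>lborel)"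
  proof (rule nn_integral_cong)
    fix a :: real
    have ex: "exp (2 * a) = exp a * exp a" by (metis exp_add mult_2)
    have cc: "sqrt c * sqrt c = c" using c by simp
    have s1: "sqrt (c * exp (2 * a)) = sqrt c * exp a" unfolding ex real_sqrt_mult by simp
    have sh: "sinh a = (exp a - inverse (exp a)) / 2" by (simp add: sinh_def exp_minus)
    have s2: "- (c * exp (2 * a)) - c\<^sup>2 / (c * exp (2 * a)) = - 2 * c - (2 * sqrt c * sinh a)\<^sup>2"
    proof -
      have sq: "(2 * sqrt c * w)\<^sup>2 = 4 * c * w\<^sup>2" for w using c by (simp add: power_mult_distrib)
      show ?thesis unfolding sq ex sh using c by (simp add: field_simps power2_eq_square)
    qed
    have alg: "e / (k * A) * (2 * (k * k) * (A * A)) = 2 * (k * A * e)" if "k > 0" "A > 0" for e k A :: real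
      using that by (simp add: field_simps)
    have ed: "exp (- 2 * c - w) = exp (- 2 * c) * exp (- w)" for w by (metis exp_add diff_conv_add_uminus)
    have "exp (- (c * exp (2 * a)) - c\<^sup>2 / (c * exp (2 * a))) / sqrt (c * exp (2 * a)) * (2 * c * exp (2 * a))
      = 2 * ((sqrt c * exp a) * (exp (- 2 * c) * exp (- (2 * sqrt c * sinh a)\<^sup>2)))"
      unfolding s1 s2 unfolding ex ed
      by (rule alg[of "sqrt c" "exp a" "exp (- 2 * c) * exp (- (2 * sqrt c * sinh a)\<^sup>2)", unfolded cc]) (use c in auto)
    then have "f (c * exp (2 * a)) * ennreal (2 * c * exp (2 * a)) = ennreal (2 * ((sqrt c * exp a) * (exp (- 2 * c) * exp (- (2 * sqrt c * sinh a)\<^sup>2))))"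
      using c by (simp add: f_def ennreal_mult'[symmetric])
    also have "\<dots> = ennreal (sqrt c * exp a) * h a + ennreal (sqrt c * exp a) * h a"
      unfolding h_def using c by (simp add: ennreal_mult'[symmetric] ennreal_plus[symmetric] del: ennreal_plus)
    finally show "f (c * exp (2 * a)) * ennreal (2 * c * exp (2 * a)) = \<dots>" .
  qed
  also have "\<dots> = (\<integral>\<^sup>+a. ennreal (sqrt c * exp a) * h a \<partial>lborel) + (\<integral>\<^sup>+a. ennreal (sqrt c * exp a) * h a \<partial>lborel)"
    by (rule nn_integral_add) measurable
  also have "\<dots> = (\<integral>\<^sup>+a. ennreal (sqrt c * exp (- a)) * h a \<partial>lborel) + (\<integral>\<^sup>+a. ennreal (sqrt c * exp a) * h a \<partial>lborel)"
  proof -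
    have "h (- a) = h a" for a by (simp add: h_def)
    then show ?thesis
      using nn_integral_real_affine[of "\<lambda>a. ennreal (sqrt c * exp a) * h a" "-1" 0] by simp
  qed
  also have "\<dots> = (\<integral>\<^sup>+a. ennreal (sqrt c * exp (- a)) * h a + ennreal (sqrt c * exp a) * h a \<partial>lborel)"
    by (rule nn_integral_add[symmetric]) measurable
  also have "\<dots> = (\<integral>\<^sup>+a. (ennreal (exp (- 2 * c)) * ennreal (exp (- (2 * sqrt c * sinh a)\<^sup>2))) * ennreal (2 * sqrt c * cosh a) \<partial>lborel)"
    using c by (intro nn_integral_cong)
      (simp add: h_def ennreal_mult'[symmetric] ennreal_plus[symmetric] cosh_def field_simps del: ennreal_plus)
  also have "\<dots> = (\<integral>\<^sup>+u. (ennreal (exp (- 2 * c)) * ennreal (exp (- u\<^sup>2))) * indicator (range (\<lambda>a. 2 * sqrt c * sinh a)) u \<partial>lborel)"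
    using c by (intro nn_integral_substitution_range) (auto intro!: derivative_eq_intros continuous_intros)
  also have "range (\<lambda>a. 2 * sqrt c * sinh a) = UNIV"
  proof (intro equalityI subsetI UNIV_I)
    fix u :: real
    have "u = 2 * sqrt c * sinh (arsinh (u / (2 * sqrt c)))" using c by simp
    then show "u \<in> range (\<lambda>a. 2 * sqrt c * sinh a)" by blast
  qed
  also have "(\<integral>\<^sup>+u. (ennreal (exp (- 2 * c)) * ennreal (exp (- u\<^sup>2))) * indicator UNIV u \<partial>lborel) = ennreal (exp (- 2 * c)) * ennreal (sqrt pi)"
    by (simp add: nn_integral_cmult nn_integral_gauss)
  finally show ?thesis by (simp add: f_def c_def ennreal_mult'[symmetric] mult.commute)
qed

section \<open>Convolution on the line and integrals over the sum-zero hyperplane\<close>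

definition convolve :: "(real \<Rightarrow> ennreal) \<Rightarrow> (real \<Rightarrow> ennreal) \<Rightarrow> real \<Rightarrow> ennreal" where
  "convolve f g x = (\<integral>\<^sup>+y. f y * g (x - y) \<partial>lborel)"

lemma measurable_convolve [measurable]:
  assumes [measurable]: "f \<in> borel_measurable borel" "g \<in> borel_measurable borel"
  shows "convolve f g \<in> borel_measurable borel"
  unfolding convolve_def by measurable

lemma convolve_commute:
  assumes [measurable]: "f \<in> borel_measurable borel" "g \<in> borel_measurable borel"
  shows "convolve f g = convolve g f"
proof
  fix x
  show "convolve f g x = convolve g f x"
    unfolding convolve_def
    using nn_integral_real_affine[of "\<lambda>y. f y * g (x - y)" "-1" x] by (simp add: mult.commute)
qed

lemma convolve_assoc:
  assumes [measurable]: "f \<in> borel_measurable borel" "g \<in> borel_measurable borel" "h \<in> borel_measurable borel"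
  shows "convolve (convolve f g) h = convolve f (convolve g h)"
proof
  fix x
  have "convolve (convolve f g) h x = (\<integral>\<^sup>+w. \<integral>\<^sup>+y. f y * g (w - y) * h (x - w) \<partial>lborel \<partial>lborel)"
    unfolding convolve_def by (simp add: nn_integral_multc)
  also have "\<dots> = (\<integral>\<^sup>+y. \<integral>\<^sup>+w. f y * g (w - y) * h (x - w) \<partial>lborel \<partial>lborel)"
    by (rule lborel_pair.Fubini') measurable
  also have "\<dots> = (\<integral>\<^sup>+y. f y * (\<integral>\<^sup>+z. g z * h (x - y - z) \<partial>lborel) \<partial>lborel)"
  proof (rule nn_integral_cong)
    fix y
    have "(\<integral>\<^sup>+w. f y * g (w - y) * h (x - w) \<partial>lborel) = (\<integral>\<^sup>+w. f y * (g w * h (x - y - w)) \<partial>lborel)"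
      using nn_integral_real_affine[of "\<lambda>w. f y * g (w - y) * h (x - w)" 1 y] by (simp add: mult.assoc diff_diff_eq)
    then show "(\<integral>\<^sup>+w. f y * g (w - y) * h (x - w) \<partial>lborel) = f y * (\<integral>\<^sup>+z. g z * h (x - y - z) \<partial>lborel)"
      by (simp add: nn_integral_cmult)
  qed
  finally show "convolve (convolve f g) h x = convolve f (convolve g h) x" by (simp add: convolve_def)
qed

lemma convolve_reflect:
  assumes [measurable]: "f \<in> borel_measurable borel" "g \<in> borel_measurable borel"
  shows "convolve (\<lambda>y. f (- y)) (\<lambda>y. g (- y)) x = convolve f g (- x)"
  unfolding convolve_def
  using nn_integral_real_affine[of "\<lambda>y. f y * g (- x - y)" "-1" 0] by (simp add: add.commute)

lemma convolve_cmult_left: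
  assumes [measurable]: "f \<in> borel_measurable borel" "g \<in> borel_measurable borel"
  shows "convolve (\<lambda>y. c * f y) g x = c * convolve f g x"
  unfolding convolve_def by (simp add: mult.assoc nn_integral_cmult)

lemma convolve_cmult_right:
  assumes [measurable]: "f \<in> borel_measurable borel" "g \<in> borel_measurable borel"
  shows "convolve f (\<lambda>y. c * g y) x = c * convolve f g x"
  unfolding convolve_def by (simp add: mult.left_commute[of _ c] nn_integral_cmult)

primrec convolve_iter :: "(nat \<Rightarrow> real \<Rightarrow> ennreal) \<Rightarrow> (real \<Rightarrow> ennreal) \<Rightarrow> nat \<Rightarrow> real \<Rightarrow> ennreal" where
  "convolve_iter f g 0 = g"
| "convolve_iter f g (Suc m) = convolve (f m) (convolve_iter f g m)"

text \<open>Fubini splits off the last coordinate, and x absorbs it. For m = d, x = 0 and g the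
  factor of coordinate d, the argument of g is \<open>zext d \<nu> d\<close>: an integral over the
  hyperplane becomes a convolution evaluated at 0.\<close>

lemma nn_integral_convolve_iter:
  fixes f :: "nat \<Rightarrow> real \<Rightarrow> ennreal"
  assumes f [measurable]: "\<And>i. f i \<in> borel_measurable borel" and g [measurable]: "g \<in> borel_measurable borel"
  shows "(\<integral>\<^sup>+\<nu>. (\<Prod>i<m. f i (\<nu> i)) * g (x - (\<Sum>i<m. \<nu> i)) \<partial>leb {..<m}) = convolve_iter f g m x"
proof (induction m arbitrary: x)
  case 0
  show ?case by (simp add: PiM_empty nn_integral_count_space_finite)
next
  case (Suc m)
  have meas: "(\<lambda>\<nu>. (\<Prod>i<l. f i (\<nu> i)) * g (x - (\<Sum>i<l. \<nu> i))) \<in> borel_measurable (leb {..<l})" for l x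
  proof -
    have [measurable]: "(\<lambda>\<nu>. \<Prod>i<l. f i (\<nu> i)) \<in> borel_measurable (leb {..<l})"
      by (intro borel_measurable_prod_ennreal measurable_compose[OF measurable_component_singleton]) auto
    have "(\<lambda>\<nu>. x - (\<Sum>i<l. \<nu> i)) \<in> borel_measurable (leb {..<l})"
      by (intro borel_measurable_diff borel_measurable_const borel_measurable_sum measurable_leb_component[OF measurable_ident_sets[OF refl]]) auto
    then have [measurable]: "(\<lambda>\<nu>. g (x - (\<Sum>i<l. \<nu> i))) \<in> borel_measurable (leb {..<l})"
      by (rule measurable_compose) measurable
    show ?thesis by measurable
  qed
  have ins: "{..<Suc m} = insert m {..<m}" by auto
  have "(\<integral>\<^sup>+\<nu>. (\<Prod>i<Suc m. f i (\<nu> i)) * g (x - (\<Sum>i<Suc m. \<nu> i)) \<partial>leb {..<Suc m})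
    = (\<integral>\<^sup>+y. \<integral>\<^sup>+\<nu>. (\<Prod>i<Suc m. f i ((\<nu>(m := y)) i)) * g (x - (\<Sum>i<Suc m. (\<nu>(m := y)) i)) \<partial>leb {..<m} \<partial>lborel)"
    using meas[of "Suc m" x] unfolding ins
    by (subst lborel_prod.product_nn_integral_insert_rev) auto
  also have "\<dots> = (\<integral>\<^sup>+y. \<integral>\<^sup>+\<nu>. f m y * ((\<Prod>i<m. f i (\<nu> i)) * g (x - y - (\<Sum>i<m. \<nu> i))) \<partial>leb {..<m} \<partial>lborel)"
    by (intro nn_integral_cong) (simp add: mult_ac diff_diff_eq add.commute)
  also have "\<dots> = (\<integral>\<^sup>+y. f m y * convolve_iter f g m (x - y) \<partial>lborel)"
    by (intro nn_integral_cong) (simp add: nn_integral_cmult[OF meas] Suc.IH)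
  finally show ?case by (simp add: convolve_def)
qed

text \<open>Complete the square in y: the minimum is at a x/(a + b), and the quadratic coefficient
  is 1/a + 1/b = 1/r^2 with r = sqrt(a b/(a + b)). The substitution y = a x/(a + b) + r u normalises
  it.\<close>

lemma convolve_gauss:
  fixes a b :: real
  assumes a: "a > 0" and b: "b > 0"
  shows "convolve (\<lambda>y. ennreal (exp (- y\<^sup>2 / a))) (\<lambda>y. ennreal (exp (- y\<^sup>2 / b))) x
    = ennreal (sqrt pi * sqrt (a * b / (a + b)) * exp (- x\<^sup>2 / (a + b)))"
proof -
  define r where "r = sqrt (a * b / (a + b))"
  have r: "r > 0" "r\<^sup>2 = a * b / (a + b)" using a b by (simp_all add: r_def)
  have sq: "- (a * x / (a + b) + r * u)\<^sup>2 / a + - (x - (a * x / (a + b) + r * u))\<^sup>2 / b = - u\<^sup>2 - x\<^sup>2 / (a + b)" for u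
  proof -
    have "(a * x / (a + b) + r * u)\<^sup>2 / a + (x - (a * x / (a + b) + r * u))\<^sup>2 / b 
       = (a * x / (a + b))\<^sup>2 / a + (b * x / (a + b))\<^sup>2 / b + r\<^sup>2 * u\<^sup>2 * (1 / a + 1 / b) 
        + 2 * r * u * ((a * x / (a + b)) / a - (b * x / (a + b)) / b)"
    proof -
      have e: "x - (a * x / (a + b) + r * u) = b * x / (a + b) - r * u" using a b by (simp add: field_simps)
      have "(p + w)\<^sup>2 / a + (q - w)\<^sup>2 / b = p\<^sup>2 / a + q\<^sup>2 / b + w\<^sup>2 * (1 / a + 1 / b) + 2 * w * (p / a - q / b)" for p q w
        by (simp add: power2_eq_square algebra_simps add_divide_distrib diff_divide_distrib)
      from this[of "a * x / (a + b)" "r * u" "b * x / (a + b)"] show ?thesis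
        unfolding e power_mult_distrib[of r u] by (simp only: mult.assoc)
    qed
    also have "\<dots> = u\<^sup>2 + x\<^sup>2 / (a + b)"
    proof -
      have "(a * x / (a + b))\<^sup>2 / a + (b * x / (a + b))\<^sup>2 / b = (a + b) * x\<^sup>2 / (a + b)\<^sup>2"
        using a b by (simp add: power_divide power_mult_distrib power2_eq_square[of a] power2_eq_square[of b] add_divide_distrib[symmetric] distrib_right)
      also have "\<dots> = x\<^sup>2 / (a + b)" using a b by (simp add: power2_eq_square[of "a + b"])
      finally have 1: "(a * x / (a + b))\<^sup>2 / a + (b * x / (a + b))\<^sup>2 / b = x\<^sup>2 / (a + b)" .
      have 2: "r\<^sup>2 * u\<^sup>2 * (1 / a + 1 / b) = u\<^sup>2" 
      proof -
        have inv: "1 / a + 1 / b = (a + b) / (a * b)" using a b by (simp add: field_simps)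
        have "a + b \<noteq> 0" using a b by simp
        then show ?thesis unfolding r(2) inv using a b by (simp add: divide_simps)
      qed
      have 3: "(a * x / (a + b)) / a - (b * x / (a + b)) / b = 0" using a b by simp
      show ?thesis unfolding 1 2 3 by simp
    qed
    finally show ?thesis by simp
  qed
  have "convolve (\<lambda>y. ennreal (exp (- y\<^sup>2 / a))) (\<lambda>y. ennreal (exp (- y\<^sup>2 / b))) x
    = (\<integral>\<^sup>+y. ennreal (exp (- y\<^sup>2 / a + - (x - y)\<^sup>2 / b)) \<partial>lborel)"
    unfolding convolve_def exp_add by (simp add: ennreal_mult')
  also have "\<dots> = ennreal \<bar>r\<bar> * (\<integral>\<^sup>+u. ennreal (exp (- (a * x / (a + b) + r * u)\<^sup>2 / a + - (x - (a * x / (a + b) + r * u))\<^sup>2 / b)) \<partial>lborel)"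
    using r by (intro nn_integral_real_affine) auto
  also have "(\<integral>\<^sup>+u. ennreal (exp (- (a * x / (a + b) + r * u)\<^sup>2 / a + - (x - (a * x / (a + b) + r * u))\<^sup>2 / b)) \<partial>lborel)
    = (\<integral>\<^sup>+u. ennreal (exp (- x\<^sup>2 / (a + b))) * ennreal (exp (- u\<^sup>2)) \<partial>lborel)"
    unfolding sq by (intro nn_integral_cong) (simp add: ennreal_mult'[symmetric] exp_add[symmetric])
  also have "\<dots> = ennreal (exp (- x\<^sup>2 / (a + b))) * ennreal (sqrt pi)"
    by (simp add: nn_integral_cmult nn_integral_gauss)
  finally show ?thesis using r by (simp add: ennreal_mult'[symmetric] r_def mult_ac)
qed

lemma convolve_iter_gauss:
  fixes s :: "nat \<Rightarrow> real" and b :: real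
  assumes b: "b > 0" and s: "\<And>i. i < m \<Longrightarrow> s i > 0"
  shows "convolve_iter (\<lambda>i y. ennreal (exp (- y\<^sup>2 / s i))) (\<lambda>y. ennreal (exp (- y\<^sup>2 / b))) m
    = (\<lambda>x. ennreal (sqrt pi ^ m * sqrt ((\<Prod>i<m. s i) * b / ((\<Sum>i<m. s i) + b))) * ennreal (exp (- x\<^sup>2 / ((\<Sum>i<m. s i) + b))))"
  using s
proof (induction m)
  case 0
  show ?case using b by simp
next
  case (Suc m)
  define B where "B = (\<Sum>i<m. s i) + b"
  define P where "P = (\<Prod>i<m. s i)"
  have B: "B > 0" unfolding B_def using Suc.prems b by (intro add_nonneg_pos sum_nonneg) (auto simp: less_imp_le)
  have P: "P > 0" unfolding P_def using Suc.prems by (intro prod_pos) auto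
  have sm: "s m > 0" using Suc.prems by simp
  have IH: "convolve_iter (\<lambda>i y. ennreal (exp (- y\<^sup>2 / s i))) (\<lambda>y. ennreal (exp (- y\<^sup>2 / b))) m
    = (\<lambda>x. ennreal (sqrt pi ^ m * sqrt (P * b / B)) * ennreal (exp (- x\<^sup>2 / B)))"
    using Suc by (simp add: B_def P_def)
  \<comment> \<open>The previous denominator \<open>B\<close> cancels, so the prefactors
    telescope.\<close>
  have "sqrt (P * b / B) * sqrt (s m * B / (s m + B)) = sqrt (P * s m * b / (B + s m))"
    unfolding real_sqrt_mult[symmetric] using B by (simp add: field_simps)
  then have c: "sqrt pi ^ m * sqrt (P * b / B) * (sqrt pi * sqrt (s m * B / (s m + B))) = sqrt pi ^ Suc m * sqrt (P * s m * b / (B + s m))"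
    by (simp add: mult_ac)
  have BS: "(\<Sum>i<Suc m. s i) + b = B + s m" by (simp add: B_def)
  show ?case
  proof
    fix x
    have "convolve_iter (\<lambda>i y. ennreal (exp (- y\<^sup>2 / s i))) (\<lambda>y. ennreal (exp (- y\<^sup>2 / b))) (Suc m) x
      = ennreal (sqrt pi ^ m * sqrt (P * b / B)) * ennreal (sqrt pi * sqrt (s m * B / (s m + B)) * exp (- x\<^sup>2 / (s m + B)))"
      unfolding convolve_iter.simps IH convolve_gauss[OF sm B, symmetric] by (rule convolve_cmult_right) measurable
    also have "\<dots> = ennreal (sqrt pi ^ m * sqrt (P * b / B) * (sqrt pi * sqrt (s m * B / (s m + B)))) * ennreal (exp (- x\<^sup>2 / (s m + B)))"
      using b P B sm by (simp add: ennreal_mult'[symmetric] mult.assoc)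
    finally show "convolve_iter (\<lambda>i y. ennreal (exp (- y\<^sup>2 / s i))) (\<lambda>y. ennreal (exp (- y\<^sup>2 / b))) (Suc m) x
      = ennreal (sqrt pi ^ Suc m * sqrt ((\<Prod>i<Suc m. s i) * b / ((\<Sum>i<Suc m. s i) + b))) * ennreal (exp (- x\<^sup>2 / ((\<Sum>i<Suc m. s i) + b)))"
      unfolding c BS by (simp add: P_def add.commute)
  qed
qed

text \<open>Up to normalisation this is the density at 0 of a sum of independent Gaussians. The sum
  of the s_i is the one factor that does not split over coordinates; it is the origin of the weight
  1/sqrt S used later.\<close>

lemma cone_gauss_full:
  fixes s :: "nat \<Rightarrow> real"
  assumes s: "\<And>i. i \<le> d \<Longrightarrow> s i > 0"
  shows "cone_gauss (Suc d) d s = ennreal (sqrt pi ^ d * sqrt ((\<Prod>i<Suc d. s i) / (\<Sum>i<Suc d. s i)))"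
proof -
  have "cone_gauss (Suc d) d s = (\<integral>\<^sup>+\<nu>. (\<Prod>i<d. ennreal (exp (- (\<nu> i)\<^sup>2 / s i))) * ennreal (exp (- (0 - (\<Sum>i<d. \<nu> i))\<^sup>2 / s d)) \<partial>leb {..<d})"
    unfolding cone_gauss_def
  proof (rule nn_integral_cong)
    fix \<nu>
    have "- qform d s \<nu> = (\<Sum>i<d. - (\<nu> i)\<^sup>2 / s i) + - (0 - (\<Sum>i<d. \<nu> i))\<^sup>2 / s d"
      by (simp add: qform_def zext_def sum_negf)
    then show "cone_ind (Suc d) d \<nu> * ennreal (exp (- qform d s \<nu>)) = (\<Prod>i<d. ennreal (exp (- (\<nu> i)\<^sup>2 / s i))) * ennreal (exp (- (0 - (\<Sum>i<d. \<nu> i))\<^sup>2 / s d))"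
      by (simp only: exp_add exp_sum finite_lessThan prod_ennreal exp_ge_zero ennreal_mult prod_nonneg cone_ind_Suc mult_1)
  qed
  also have "\<dots> = convolve_iter (\<lambda>i y. ennreal (exp (- y\<^sup>2 / s i))) (\<lambda>y. ennreal (exp (- y\<^sup>2 / s d))) d 0"
    by (rule nn_integral_convolve_iter) measurable
  also have "\<dots> = ennreal (sqrt pi ^ d * sqrt ((\<Prod>i<Suc d. s i) / (\<Sum>i<Suc d. s i)))"
    using s by (subst convolve_iter_gauss) auto
  finally show ?thesis .
qed

section \<open>Exponential densities, their reflections and the Laplace density\<close>

definition exp_conv :: "nat \<Rightarrow> real \<Rightarrow> ennreal" where
  "exp_conv p y = (if 0 \<le> y then ennreal (y ^ p / fact p * exp (- 2 * y)) else 0)"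

lemma measurable_exp_conv [measurable]: "exp_conv p \<in> borel_measurable borel"
  unfolding exp_conv_def by measurable

lemma convolve_exp_conv: "convolve (exp_conv 0) (exp_conv p) = exp_conv (Suc p)"
proof
  fix x :: real
  show "convolve (exp_conv 0) (exp_conv p) x = exp_conv (Suc p) x"
  proof (cases "0 \<le> x")
    case True
    have "convolve (exp_conv 0) (exp_conv p) x = (\<integral>\<^sup>+y. ennreal ((x - y) ^ p / fact p * exp (- 2 * x)) * indicator {0..x} y \<partial>lborel)"
      unfolding convolve_def
    proof (rule nn_integral_cong)
      fix y :: real
      have "exp (- 2 * y) * exp (- 2 * (x - y)) = exp (- 2 * x)" by (simp add: exp_add[symmetric])
      then have "exp (- 2 * y) * ((x - y) ^ p / fact p * exp (- 2 * (x - y))) = (x - y) ^ p / fact p * exp (- 2 * x)"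
        by (metis mult.left_commute)
      then show "exp_conv 0 y * exp_conv p (x - y) = ennreal ((x - y) ^ p / fact p * exp (- 2 * x)) * indicator {0..x} y"
        by (auto simp: exp_conv_def indicator_def ennreal_mult'[symmetric])
    qed
    also have "\<dots> = ennreal ((- ((x - x) ^ Suc p) / fact (Suc p) * exp (- 2 * x)) - (- ((x - 0) ^ Suc p) / fact (Suc p) * exp (- 2 * x)))"
    proof (rule nn_integral_FTC_Icc)
      fix y :: real
      have "((\<lambda>y. - ((x - y) ^ Suc p) / fact (Suc p) * exp (- 2 * x)) has_real_derivative 
          (real (Suc p) * (x - y) ^ p) / fact (Suc p) * exp (- 2 * x)) (at y)"
        by (rule derivative_eq_intros refl | simp)+
      moreover have "(real (Suc p) * (x - y) ^ p) / fact (Suc p) = (x - y) ^ p / fact p" 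
        unfolding fact_Suc by (rule mult_divide_mult_cancel_left) simp
      ultimately show "((\<lambda>y. - ((x - y) ^ Suc p) / fact (Suc p) * exp (- 2 * x)) has_real_derivative (x - y) ^ p / fact p * exp (- 2 * x)) (at y)"
        by simp
    qed (use True in auto)
    finally show ?thesis using True by (simp add: exp_conv_def)
  next
    case False
    then have z: "exp_conv 0 y * exp_conv p (x - y) = 0" for y by (auto simp: exp_conv_def)
    show ?thesis unfolding convolve_def z using False by (simp add: exp_conv_def)
  qed
qed

text \<open>\<open>exp_conv p\<close> is the (p + 1)-fold convolution power of exp(-2y) on the
  half-line. So p + 1 exponentials are convolved here with q + 1 reflected ones, which gives, up to
  normalisation, the density of a difference of two Gamma variables.\<close>

definition two_sided :: "nat \<Rightarrow> nat \<Rightarrow> real \<Rightarrow> ennreal" where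
  "two_sided p q = convolve (\<lambda>y. exp_conv q (- y)) (exp_conv p)"

lemma measurable_two_sided [measurable]: "two_sided p q \<in> borel_measurable borel"
  unfolding two_sided_def by measurable

lemma nn_integral_exp4_Ici: "(\<integral>\<^sup>+y. ennreal (y ^ r * exp (- 4 * y)) * indicator {0..} y \<partial>lborel) = ennreal (fact r / 4 ^ Suc r)"
proof -
  have "ennreal (fact r) = (\<integral>\<^sup>+x. ennreal (x ^ r * exp (- x)) * indicator {0..} x \<partial>lborel)"
    by (simp add: nn_intergal_power_times_exp_Ici)
  also have "\<dots> = ennreal \<bar>4\<bar> * (\<integral>\<^sup>+x. ennreal ((0 + 4 * x) ^ r * exp (- (0 + 4 * x))) * indicator {0..} (0 + 4 * x) \<partial>lborel)"
    by (rule nn_integral_real_affine) auto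
  also have "(\<integral>\<^sup>+x. ennreal ((0 + 4 * x) ^ r * exp (- (0 + 4 * x))) * indicator {0..} (0 + 4 * x) \<partial>lborel)
     = (\<integral>\<^sup>+x. ennreal (4 ^ r) * (ennreal (x ^ r * exp (- 4 * x)) * indicator {0..} x) \<partial>lborel)"
    by (intro nn_integral_cong) (auto simp: indicator_def ennreal_mult'[symmetric] power_mult_distrib mult.assoc)
  also have "\<dots> = ennreal (4 ^ r) * (\<integral>\<^sup>+x. ennreal (x ^ r * exp (- 4 * x)) * indicator {0..} x \<partial>lborel)"
    by (rule nn_integral_cmult) measurable
  also have "ennreal \<bar>4\<bar> * (ennreal (4 ^ r) * J) = ennreal (4 ^ Suc r) * J" for J
    unfolding mult.assoc[symmetric] by (subst ennreal_mult'[symmetric]) auto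
  finally have e: "ennreal (fact r) = ennreal (4 ^ Suc r) * (\<integral>\<^sup>+x. ennreal (x ^ r * exp (- 4 * x)) * indicator {0..} x \<partial>lborel)" .
  have "ennreal (fact r / 4 ^ Suc r) = ennreal (inverse (4 ^ Suc r)) * ennreal (fact r)"
    by (simp add: ennreal_mult'[symmetric] field_simps)
  also have "\<dots> = (ennreal (inverse (4 ^ Suc r)) * ennreal (4 ^ Suc r)) * (\<integral>\<^sup>+x. ennreal (x ^ r * exp (- 4 * x)) * indicator {0..} x \<partial>lborel)"
    unfolding e by (simp only: mult.assoc)
  also have "ennreal (inverse (4 ^ Suc r)) * ennreal (4 ^ Suc r) = 1"
    by (subst ennreal_mult'[symmetric]) auto
  finally show ?thesis by simp
qed

text \<open>At 0 both factors are taken at the same point, so the integrand is y^(p + q)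
  exp(-4y)/(p! q!) on the half-line. The binomial coefficient is (p + q)!/(p! q!).\<close>

lemma two_sided_zero: "two_sided p q 0 = ennreal (real ((p + q) choose q) / 4 ^ Suc (p + q))"
proof -
  have "two_sided p q 0 = (\<integral>\<^sup>+y. exp_conv q (- y) * exp_conv p (- y) \<partial>lborel)"
    by (simp add: two_sided_def convolve_def)
  also have "\<dots> = (\<integral>\<^sup>+y. exp_conv q y * exp_conv p y \<partial>lborel)"
    using nn_integral_real_affine[of "\<lambda>y. exp_conv q y * exp_conv p y" "-1" 0] by simp
  also have "\<dots> = (\<integral>\<^sup>+y. ennreal (1 / (fact p * fact q)) * (ennreal (y ^ (p + q) * exp (- 4 * y)) * indicator {0..} y) \<partial>lborel)"
  proof (rule nn_integral_cong)
    fix y :: real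
    have "exp (- 2 * y) * exp (- 2 * y) = exp (- 4 * y)" by (simp add: exp_add[symmetric])
    then have "(y ^ q / fact q * exp (- 2 * y)) * (y ^ p / fact p * exp (- 2 * y)) = 1 / (fact p * fact q) * (y ^ (p + q) * exp (- 4 * y))"
      by (simp add: power_add field_simps)
    then show "exp_conv q y * exp_conv p y = ennreal (1 / (fact p * fact q)) * (ennreal (y ^ (p + q) * exp (- 4 * y)) * indicator {0..} y)"
      by (auto simp: exp_conv_def indicator_def ennreal_mult'[symmetric])
  qed
  also have "\<dots> = ennreal (1 / (fact p * fact q)) * ennreal (fact (p + q) / 4 ^ Suc (p + q))"
    unfolding nn_integral_exp4_Ici[symmetric] by (rule nn_integral_cmult) measurable
  also have "\<dots> = ennreal (real ((p + q) choose q) / 4 ^ Suc (p + q))"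
    by (simp add: ennreal_mult'[symmetric] binomial_fact field_simps)
  finally show ?thesis .
qed

lemma laplace_eq_two_sided: "ennreal (exp (- 2 * \<bar>x\<bar>)) = 4 * two_sided 0 0 x"
proof -
  \<comment> \<open>The smallest y with y >= 0 and x + y >= 0. Since 2m + x = |x|, the shift by
    \<open>m\<close> brings the exponent to -2|x| - 4u.\<close>
  define m where "m = max 0 (- x)"
  have "two_sided 0 0 x = (\<integral>\<^sup>+y. exp_conv 0 (- y) * exp_conv 0 (x - y) \<partial>lborel)"
    by (simp add: two_sided_def convolve_def)
  also have "\<dots> = (\<integral>\<^sup>+y. exp_conv 0 y * exp_conv 0 (x + y) \<partial>lborel)"
    using nn_integral_real_affine[of "\<lambda>y. exp_conv 0 y * exp_conv 0 (x + y)" "-1" 0] by simp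
  also have "\<dots> = (\<integral>\<^sup>+u. exp_conv 0 (m + u) * exp_conv 0 (x + (m + u)) \<partial>lborel)"
    using nn_integral_real_affine[of "\<lambda>y. exp_conv 0 y * exp_conv 0 (x + y)" "1" m] by simp
  also have "\<dots> = (\<integral>\<^sup>+u. ennreal (exp (- 2 * \<bar>x\<bar>)) * (ennreal (u ^ 0 * exp (- 4 * u)) * indicator {0..} u) \<partial>lborel)"
  proof (rule nn_integral_cong)
    fix u :: real
    have "exp (- 2 * (m + u)) * exp (- 2 * (x + (m + u))) = exp (- 2 * \<bar>x\<bar>) * exp (- 4 * u)"
      unfolding exp_add[symmetric] by (intro arg_cong[where f=exp]) (auto simp: m_def max_def)
    then show "exp_conv 0 (m + u) * exp_conv 0 (x + (m + u)) = ennreal (exp (- 2 * \<bar>x\<bar>)) * (ennreal (u ^ 0 * exp (- 4 * u)) * indicator {0..} u)"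
      by (auto simp: exp_conv_def indicator_def ennreal_mult'[symmetric]) (auto simp: m_def max_def split: if_splits)
  qed
  also have "\<dots> = ennreal (exp (- 2 * \<bar>x\<bar>)) * ennreal (fact 0 / 4 ^ Suc 0)"
    unfolding nn_integral_exp4_Ici[symmetric] by (rule nn_integral_cmult) measurable
  finally have t: "two_sided 0 0 x = ennreal (exp (- 2 * \<bar>x\<bar>)) * ennreal (fact 0 / 4 ^ Suc 0)" .
  have "ennreal (exp (- 2 * \<bar>x\<bar>)) = ennreal (4 * (exp (- 2 * \<bar>x\<bar>) * (fact 0 / 4 ^ Suc 0)))" by simp
  also have "\<dots> = ennreal 4 * (ennreal (exp (- 2 * \<bar>x\<bar>)) * ennreal (fact 0 / 4 ^ Suc 0))"
    by (simp only: ennreal_mult' zero_le_numeral exp_ge_zero)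
  finally show ?thesis unfolding t by simp
qed

lemma convolve_exp_two_sided: "convolve (exp_conv 0) (two_sided p q) = two_sided (Suc p) q"
proof -
  have "convolve (exp_conv 0) (two_sided p q) = convolve (convolve (exp_conv 0) (\<lambda>y. exp_conv q (- y))) (exp_conv p)"
    unfolding two_sided_def by (rule convolve_assoc[symmetric]) measurable
  also have "convolve (exp_conv 0) (\<lambda>y. exp_conv q (- y)) = convolve (\<lambda>y. exp_conv q (- y)) (exp_conv 0)"
    by (rule convolve_commute) measurable
  also have "convolve (convolve (\<lambda>y. exp_conv q (- y)) (exp_conv 0)) (exp_conv p) = two_sided (Suc p) q"
    unfolding two_sided_def convolve_exp_conv[symmetric] by (rule convolve_assoc) measurable
  finally show ?thesis .
qed

lemma convolve_exp_reflected_two_sided: "convolve (\<lambda>y. exp_conv 0 (- y)) (two_sided p q) = two_sided p (Suc q)"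
proof -
  have "convolve (\<lambda>y. exp_conv 0 (- y)) (\<lambda>y. exp_conv q (- y)) = (\<lambda>y. exp_conv (Suc q) (- y))"
    by (rule ext) (simp add: convolve_reflect convolve_exp_conv)
  moreover have "convolve (\<lambda>y. exp_conv 0 (- y)) (two_sided p q) = convolve (convolve (\<lambda>y. exp_conv 0 (- y)) (\<lambda>y. exp_conv q (- y))) (exp_conv p)"
    unfolding two_sided_def by (rule convolve_assoc[symmetric]) measurable
  ultimately show ?thesis by (simp add: two_sided_def)
qed

text \<open>Each Laplace factor adds one exponential and one reflected exponential, at the price of
  a factor 4.\<close>

lemma convolve_laplace:
  assumes [measurable]: "f \<in> borel_measurable borel"
  shows "convolve (\<lambda>y. ennreal (exp (- 2 * \<bar>y\<bar>))) f = (\<lambda>x. 4 * convolve (\<lambda>y. exp_conv 0 (- y)) (convolve (exp_conv 0) f) x)"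
proof
  fix x
  have "convolve (\<lambda>y. ennreal (exp (- 2 * \<bar>y\<bar>))) f x = 4 * convolve (two_sided 0 0) f x"
    unfolding laplace_eq_two_sided by (rule convolve_cmult_left) measurable
  also have "convolve (two_sided 0 0) f = convolve (\<lambda>y. exp_conv 0 (- y)) (convolve (exp_conv 0) f)"
    unfolding two_sided_def by (rule convolve_assoc) measurable
  finally show "convolve (\<lambda>y. ennreal (exp (- 2 * \<bar>y\<bar>))) f x = 4 * convolve (\<lambda>y. exp_conv 0 (- y)) (convolve (exp_conv 0) f) x" .
qed

lemma convolve_laplace_two_sided:
  "convolve (\<lambda>y. ennreal (exp (- 2 * \<bar>y\<bar>))) (two_sided p q) = (\<lambda>x. 4 * two_sided (Suc p) (Suc q) x)"
  unfolding convolve_laplace[OF measurable_two_sided] convolve_exp_two_sided convolve_exp_reflected_two_sided ..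

lemma convolve_laplace_exp:
  "convolve (\<lambda>y. ennreal (exp (- 2 * \<bar>y\<bar>))) (exp_conv 0) = (\<lambda>x. 4 * two_sided 1 0 x)"
  unfolding convolve_laplace[OF measurable_exp_conv] convolve_exp_conv two_sided_def by simp

definition cone_laplace :: "nat \<Rightarrow> nat \<Rightarrow> ennreal" where
  "cone_laplace k d = (\<integral>\<^sup>+\<nu>. cone_ind k d \<nu> * (\<Prod>i<Suc d. ennreal (exp (- 2 * \<bar>zext d \<nu> i\<bar>))) \<partial>leb {..<d})"

text \<open>A coordinate i < k contributes a Laplace factor, one with i >= k only its positive half,
  an exponential. In total there are d + 1 exponentials and k reflected ones, hence 4^k times
  \<open>two_sided d (k - 1)\<close>, evaluated at 0.\<close>

lemma cone_laplace_eq: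
  assumes k: "1 \<le> k" "k \<le> Suc d"
  shows "cone_laplace k d = ennreal (real ((d + k - 1) choose (k - 1)) / 4 ^ d)"
proof -
  define L where "L = (\<lambda>y. ennreal (exp (- 2 * \<bar>y\<bar>)))"
  have L [measurable]: "L \<in> borel_measurable borel" unfolding L_def by measurable
  have stepL: "convolve L (\<lambda>x. c * two_sided p q x) = (\<lambda>x. 4 * c * two_sided (Suc p) (Suc q) x)" for c p q
  proof
    fix x
    have "convolve L (\<lambda>x. c * two_sided p q x) x = c * convolve L (two_sided p q) x"
      by (rule convolve_cmult_right) measurable
    also have "\<dots> = 4 * c * two_sided (Suc p) (Suc q) x"
      unfolding L_def convolve_laplace_two_sided by (simp only: mult_ac)
    finally show "convolve L (\<lambda>x. c * two_sided p q x) x = 4 * c * two_sided (Suc p) (Suc q) x" .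
  qed
  have stepE: "convolve (exp_conv 0) (\<lambda>x. c * two_sided p q x) = (\<lambda>x. c * two_sided (Suc p) q x)" for c p q
    unfolding convolve_exp_two_sided[symmetric] by (intro ext convolve_cmult_right) measurable
  define f where "f i = (if i < k then L else exp_conv 0)" for i
  have f [measurable]: "f i \<in> borel_measurable borel" for i unfolding f_def by simp
  have f_eq: "f i y = (if k \<le> i \<longrightarrow> 0 \<le> y then L y else 0)" for i y
    by (auto simp: f_def L_def exp_conv_def)
  have "cone_laplace k d = (\<integral>\<^sup>+\<nu>. (\<Prod>i<d. f i (\<nu> i)) * f d (0 - (\<Sum>i<d. \<nu> i)) \<partial>leb {..<d})"
    unfolding cone_laplace_def
  proof (rule nn_integral_cong)
    fix \<nu> :: "nat \<Rightarrow> real"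
    have "(\<Prod>i<Suc d. f i (zext d \<nu> i)) = cone_ind k d \<nu> * (\<Prod>i<Suc d. L (zext d \<nu> i))"
    proof (cases "\<forall>i\<in>{k..d}. 0 \<le> zext d \<nu> i")
      case True
      then have "(\<Prod>i<Suc d. f i (zext d \<nu> i)) = (\<Prod>i<Suc d. L (zext d \<nu> i))"
        by (intro prod.cong refl) (auto simp: f_eq)
      then show ?thesis using True by (simp add: cone_ind_def)
    next
      case False
      then obtain i where i: "k \<le> i" "i \<le> d" "\<not> 0 \<le> zext d \<nu> i" by auto
      then have "(\<Prod>i<Suc d. f i (zext d \<nu> i)) = 0"
        by (intro prod_zero bexI[of _ i]) (auto simp: f_eq)
      then show ?thesis by (simp only: cone_ind_def False if_False mult_zero_left)
    qed
    then show "cone_ind k d \<nu> * (\<Prod>i<Suc d. ennreal (exp (- 2 * \<bar>zext d \<nu> i\<bar>))) = (\<Prod>i<d. f i (\<nu> i)) * f d (0 - (\<Sum>i<d. \<nu> i))"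
      by (simp add: L_def zext_def)
  qed
  also have "\<dots> = convolve_iter f (f d) d 0"
    by (rule nn_integral_convolve_iter) measurable
  also have "convolve_iter f (f d) d = (\<lambda>x. 4 ^ k * two_sided d (k - 1) x)"
  \<comment> \<open>The dependent coordinate d starts the iteration. Unconstrained, it is already 4
    times \<open>two_sided 0 0\<close>; constrained, it is a bare exponential, which becomes
    two-sided with the first Laplace factor, present because k >= 1.\<close>
  proof (cases "k = Suc d")
    case True
    have "convolve_iter f L m = (\<lambda>x. 4 ^ Suc m * two_sided m m x)" if "m \<le> d" for m
      using that
    proof (induction m)
      case 0
      show ?case unfolding L_def laplace_eq_two_sided by simp
    next
      case (Suc m)
      have "f m = L" using Suc.prems True by (simp add: f_def)
      moreover have "convolve_iter f L m = (\<lambda>x. 4 ^ Suc m * two_sided m m x)" using Suc by simp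
      ultimately show ?case by (simp only: convolve_iter.simps stepL power_Suc)
    qed
    moreover have "f d = L" using True by (simp add: f_def)
    ultimately show ?thesis using True by simp
  next
    case False
    have fd: "f d = exp_conv 0" using False k by (simp add: f_def)
    have "convolve_iter f (exp_conv 0) (Suc m) = (\<lambda>x. 4 ^ Suc m * two_sided (Suc m) m x)" if "Suc m \<le> k" for m
      using that
    proof (induction m)
      case 0
      then have "f 0 = L" by (simp add: f_def)
      then show ?case using convolve_laplace_exp by (simp add: L_def)
    next
      case (Suc m)
      have "f (Suc m) = L" using Suc.prems by (simp add: f_def)
      moreover have "convolve_iter f (exp_conv 0) (Suc m) = (\<lambda>x. 4 ^ Suc m * two_sided (Suc m) m x)" using Suc by simp
      ultimately show ?case by (simp only: convolve_iter.simps(2)[of _ _ "Suc m"] stepL power_Suc)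
    qed
    from this[of "k - 1"] have base: "convolve_iter f (exp_conv 0) k = (\<lambda>x. 4 ^ k * two_sided k (k - 1) x)" using k by simp
    have "convolve_iter f (exp_conv 0) (k + j) = (\<lambda>x. 4 ^ k * two_sided (k + j) (k - 1) x)" for j
    proof (induction j)
      case 0
      show ?case using base by simp
    next
      case (Suc j)
      have "f (k + j) = exp_conv 0" by (simp add: f_def)
      then show ?case by (simp only: add_Suc_right convolve_iter.simps Suc.IH stepE)
    qed
    from this[of "d - k"] show ?thesis using fd False k by simp
  qed
  also have "4 ^ k * two_sided d (k - 1) 0 = ennreal (real ((d + k - 1) choose (k - 1)) / 4 ^ d)"
  proof -
    have "ennreal (real ((d + k - 1) choose (k - 1)) / 4 ^ d) = ennreal (4 ^ k * (real ((d + (k - 1)) choose (k - 1)) / 4 ^ Suc (d + (k - 1))))"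
      using k by (simp add: power_add[symmetric] field_simps)
    also have "\<dots> = 4 ^ k * two_sided d (k - 1) 0"
    proof -
      have p4: "(4::ennreal) ^ k = ennreal (4 ^ k)" by (simp flip: ennreal_power)
      show ?thesis unfolding two_sided_zero p4 by (rule ennreal_mult') simp
    qed
    finally show ?thesis ..
  qed
  finally show ?thesis .
qed

section \<open>The expected angle\<close>

lemma measurable_qform_pair [measurable (raw)]:
  assumes f: "f \<in> M \<rightarrow>\<^sub>M leb {..<Suc d}" and g [measurable]: "g \<in> M \<rightarrow>\<^sub>M leb {..<d}"
  shows "(\<lambda>w. qform d (f w) (g w)) \<in> borel_measurable M"
  unfolding qform_def
  by (intro borel_measurable_sum borel_measurable_divide borel_measurable_power measurable_zext[OF g]
      measurable_leb_component[OF f]) auto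

lemma measurable_weight_pair [measurable (raw)]:
  assumes f: "f \<in> M \<rightarrow>\<^sub>M leb {..<Suc d}" and g: "g \<in> M \<rightarrow>\<^sub>M leb ({..<Suc d} \<times> {..<d})"
  shows "(\<lambda>w. weight d (f w) (g w)) \<in> borel_measurable M"
proof -
  have [measurable]: "(\<lambda>w. \<Sum>j<d. \<Sum>i<Suc d. f w i * (g w (i, j))\<^sup>2) \<in> borel_measurable M"
    by (intro borel_measurable_sum borel_measurable_times borel_measurable_power
      measurable_leb_component[OF f] measurable_leb_component[OF g]) auto
  show ?thesis unfolding weight_def by measurable
qed

lemma measurable_cone_gauss [measurable]: "cone_gauss k d \<in> borel_measurable (leb {..<Suc d})"
proof -
  interpret sigma_finite_measure "leb {..<d}" by (rule sigma_finite_leb) simp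
  show ?thesis unfolding cone_gauss_def by measurable
qed

lemma nn_integral_gauss_scaled:
  fixes s :: real
  assumes "s > 0"
  shows "(\<integral>\<^sup>+x. ennreal (exp (- (s * x\<^sup>2))) \<partial>lborel) = ennreal (sqrt (pi / s))"
proof -
  have "(\<integral>\<^sup>+x. ennreal (exp (- (s * x\<^sup>2))) \<partial>lborel) = ennreal \<bar>1 / sqrt s\<bar> * (\<integral>\<^sup>+x. ennreal (exp (- (s * (0 + 1 / sqrt s * x)\<^sup>2))) \<partial>lborel)"
    using assms by (intro nn_integral_real_affine) auto
  also have "\<dots> = ennreal (1 / sqrt s) * (\<integral>\<^sup>+x. ennreal (exp (- x\<^sup>2)) \<partial>lborel)"
    using assms by (simp add: power_mult_distrib power_divide)
  finally show ?thesis using assms by (simp add: nn_integral_gauss ennreal_mult'[symmetric] real_sqrt_divide)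
qed

lemma weight_eq_prod: "weight d s x = (\<Prod>i<Suc d. ennreal (exp (- (s i * (\<Sum>j<d. (x (i, j))\<^sup>2)))))"
proof -
  have "- (\<Sum>j<d. \<Sum>i<Suc d. s i * (x (i, j))\<^sup>2) = (\<Sum>i<Suc d. - (s i * (\<Sum>j<d. (x (i, j))\<^sup>2)))"
    by (subst sum.swap) (simp only: sum_negf sum_distrib_left)
  then show ?thesis
    unfolding weight_def by (simp only: exp_sum finite_lessThan prod_ennreal exp_ge_zero)
qed

lemma nn_integral_weight:
  assumes s: "\<And>i. i \<le> d \<Longrightarrow> s i > 0"
  shows "(\<integral>\<^sup>+x. weight d s x \<partial>leb ({..<Suc d} \<times> {..<d})) = (\<Prod>i<Suc d. ennreal (sqrt (pi / s i) ^ d))"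
proof -
  let ?K = "{..<Suc d} \<times> {..<d}"
  have "(\<integral>\<^sup>+x. weight d s x \<partial>leb ?K) = (\<integral>\<^sup>+x. (\<Prod>p\<in>?K. ennreal (exp (- (s (fst p) * (x p)\<^sup>2)))) \<partial>leb ?K)"
  proof (rule nn_integral_cong)
    fix x
    have "weight d s x = (\<Prod>i<Suc d. \<Prod>j<d. ennreal (exp (- (s i * (x (i, j))\<^sup>2))))"
      unfolding weight_eq_prod
      by (intro prod.cong refl) (simp add: prod_ennreal exp_sum[symmetric] sum_negf sum_distrib_left)
    then show "weight d s x = (\<Prod>p\<in>?K. ennreal (exp (- (s (fst p) * (x p)\<^sup>2))))"
      by (simp only: prod.cartesian_product) (auto intro!: prod.cong)
  qed
  also have "\<dots> = (\<Prod>p\<in>?K. \<integral>\<^sup>+u. ennreal (exp (- (s (fst p) * u\<^sup>2))) \<partial>lborel)"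
    by (rule lborel_prod.product_nn_integral_prod) auto
  also have "\<dots> = (\<Prod>p\<in>?K. ennreal (sqrt (pi / s (fst p))))"
    using s by (intro prod.cong refl nn_integral_gauss_scaled) auto
  also have "\<dots> = (\<Prod>i<Suc d. \<Prod>j<d. ennreal (sqrt (pi / s i)))"
    by (simp only: prod.cartesian_product) (auto intro!: prod.cong)
  also have "\<dots> = (\<Prod>i<Suc d. ennreal (sqrt (pi / s i) ^ d))"
    using s by (intro prod.cong refl) (auto simp: ennreal_power less_imp_le)
  finally show ?thesis .
qed

text \<open>With \<open>\<beta> = d/2 + 1\<close> the beta' distribution is a Gaussian mixture over an exponentially distributed precision.\<close>

lemma beta'_density_mixture:
  "ennreal (beta'_density d (real d / 2 + 1) y) = 
    (\<integral>\<^sup>+s. indicator {0<..} s * ennreal (sqrt (s / pi) ^ d * exp (- s)) * ennreal (exp (- (s * (\<Sum>j<d. (y j)\<^sup>2)))) \<partial>lborel)"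
proof -
  define Y where "Y = 1 + (\<Sum>j<d. (y j)\<^sup>2)"
  have Y: "Y > 0" unfolding Y_def by (intro add_pos_nonneg sum_nonneg) auto
  define b where "b = real d / 2"
  have b: "b \<ge> 0" by (simp add: b_def)
  define I where "I = (\<integral>\<^sup>+s. indicator {0<..} s * ennreal (s powr b * exp (- (Y * s))) \<partial>lborel)"
  have "ennreal (Gamma (b + 1)) = (\<integral>\<^sup>+t. ennreal (indicator {0..} t * t powr (b + 1 - 1) / exp t) \<partial>lborel)"
    by (rule Gamma_conv_nn_integral_real) (use b in simp)
  also have "\<dots> = ennreal \<bar>Y\<bar> * (\<integral>\<^sup>+s. ennreal (indicator {0..} (0 + Y * s) * (0 + Y * s) powr (b + 1 - 1) / exp (0 + Y * s)) \<partial>lborel)"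
    using Y by (intro nn_integral_real_affine) auto
  also have "(\<integral>\<^sup>+s. ennreal (indicator {0..} (0 + Y * s) * (0 + Y * s) powr (b + 1 - 1) / exp (0 + Y * s)) \<partial>lborel)
      = (\<integral>\<^sup>+s. ennreal (Y powr b) * (indicator {0<..} s * ennreal (s powr b * exp (- (Y * s)))) \<partial>lborel)"
  proof (rule nn_integral_cong)
    fix s :: real
    show "ennreal (indicator {0..} (0 + Y * s) * (0 + Y * s) powr (b + 1 - 1) / exp (0 + Y * s))
        = ennreal (Y powr b) * (indicator {0<..} s * ennreal (s powr b * exp (- (Y * s))))"
    proof (cases "s > 0")
      case True
      have "indicator {0..} (0 + Y * s) * (0 + Y * s) powr (b + 1 - 1) / exp (0 + Y * s) = Y powr b * (s powr b * exp (- (Y * s)))"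
        using True Y by (simp add: powr_mult exp_minus divide_inverse mult.assoc)
      then show ?thesis using True by (simp only: ennreal_mult' powr_ge_zero) simp
    next
      case False
      then have "s = 0 \<or> Y * s < 0" using Y by (cases "s = 0") (auto simp: mult_less_0_iff)
      then show ?thesis using False by auto
    qed
  qed
  also have "\<dots> = ennreal (Y powr b) * I" unfolding I_def by (rule nn_integral_cmult) measurable
  also have "ennreal \<bar>Y\<bar> * (ennreal (Y powr b) * I) = ennreal (Y powr (b + 1)) * I"
  proof -
    have "Y powr (b + 1) = \<bar>Y\<bar> * Y powr b" using Y by (simp add: powr_add)
    then show ?thesis by (simp only: ennreal_mult' abs_ge_zero mult.assoc)
  qed
  finally have G: "ennreal (Gamma (b + 1)) = ennreal (Y powr (b + 1)) * I" .
  \<comment> \<open>The substitution t = Y s produced Y^(b + 1), which cancels the power in the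
    density because its exponent is -(b + 1). The second Gamma value in the constant is Gamma 1 =
    1.\<close>
  have dens: "beta'_density d (real d / 2 + 1) y = Y powr (- (b + 1)) * (pi powr (- b)) * Gamma (b + 1)"
    by (simp add: beta'_density_def beta'_const_def Y_def b_def powr_minus field_simps)
  have "ennreal (beta'_density d (real d / 2 + 1) y) = ennreal (Y powr (- (b + 1))) * ennreal (pi powr (- b)) * (ennreal (Y powr (b + 1)) * I)"
    unfolding dens G[symmetric] by (simp add: ennreal_mult')
  also have "\<dots> = (ennreal (Y powr (- (b + 1))) * ennreal (Y powr (b + 1))) * (ennreal (pi powr (- b)) * I)"
    by (simp only: mult_ac)
  also have "ennreal (Y powr (- (b + 1))) * ennreal (Y powr (b + 1)) = 1"
    using Y by (subst ennreal_mult'[symmetric]) (auto simp: powr_add[symmetric])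
  also have "ennreal (pi powr (- b)) * I = (\<integral>\<^sup>+s. ennreal (pi powr (- b)) * (indicator {0<..} s * ennreal (s powr b * exp (- (Y * s)))) \<partial>lborel)"
    unfolding I_def by (rule nn_integral_cmult[symmetric]) measurable
  also have "\<dots> = (\<integral>\<^sup>+s. indicator {0<..} s * ennreal (sqrt (s / pi) ^ d * exp (- s)) * ennreal (exp (- (s * (\<Sum>j<d. (y j)\<^sup>2)))) \<partial>lborel)"
  proof (rule nn_integral_cong)
    fix s :: real
    show "ennreal (pi powr (- b)) * (indicator {0<..} s * ennreal (s powr b * exp (- (Y * s)))) 
      = indicator {0<..} s * ennreal (sqrt (s / pi) ^ d * exp (- s)) * ennreal (exp (- (s * (\<Sum>j<d. (y j)\<^sup>2))))"
    proof (cases "s > 0")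
      case True
      have "sqrt (s / pi) ^ d = (s / pi) powr b"
        using True by (simp add: powr_half_sqrt[symmetric] powr_realpow[symmetric] powr_powr b_def)
      also have "\<dots> = pi powr (- b) * s powr b" using True by (simp add: powr_divide powr_minus field_simps)
      finally have 1: "sqrt (s / pi) ^ d = pi powr (- b) * s powr b" .
      have 2: "exp (- (Y * s)) = exp (- s) * exp (- (s * (\<Sum>j<d. (y j)\<^sup>2)))"
        unfolding exp_add[symmetric] Y_def by (simp add: algebra_simps)
      show ?thesis unfolding 1 2 using True by (simp add: ennreal_mult'[symmetric] mult_ac)
    qed simp
  qed
  finally show ?thesis by simp
qed

section \<open>The mean angle conditional on the precisions\<close>

definition pos_ind :: "nat \<Rightarrow> (nat \<Rightarrow> real) \<Rightarrow> ennreal" where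
  "pos_ind d s = (\<Prod>i<Suc d. indicator {0<..} (s i))"

lemma measurable_pos_ind [measurable]: "pos_ind d \<in> borel_measurable (leb {..<Suc d})"
  unfolding pos_ind_def
  by (intro borel_measurable_prod_ennreal measurable_compose[OF measurable_component_singleton]) auto

lemma pos_ind_cases:
  assumes "(\<And>i. i \<le> d \<Longrightarrow> s i > 0) \<Longrightarrow> pos_ind d s = 1 \<Longrightarrow> P" "\<And>i. i \<le> d \<Longrightarrow> \<not> s i > 0 \<Longrightarrow> pos_ind d s = 0 \<Longrightarrow> P"
  shows P
proof (cases "\<forall>i\<le>d. s i > 0")
  case True
  then have "pos_ind d s = 1" unfolding pos_ind_def by (intro prod.neutral) auto
  then show ?thesis using True assms by blast
next
  case False
  then obtain i where i: "i \<le> d" "\<not> s i > 0" by auto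
  then have "pos_ind d s = 0" unfolding pos_ind_def by (intro prod_zero bexI[of _ i]) auto
  then show ?thesis by (rule assms(2)[OF i])
qed

text \<open>Dilating \<nu> by sqrt t preserves the cone and compensates the scaling of s in
  \<open>qform\<close>. The resulting factor is the same for all k, so it cancels in
  \<open>angle_ratio\<close>.\<close>

lemma cone_gauss_scale:
  assumes t: "t > 0"
  shows "cone_gauss k d (vscale {..<Suc d} t s) = ennreal (sqrt t ^ d) * cone_gauss k d s"
proof -
  have q: "qform d (vscale {..<Suc d} t s) (vscale {..<d} (sqrt t) \<nu>) = qform d s \<nu>" for \<nu>
    unfolding qform_vscale using t by (simp add: qform_def vscale_def sum_distrib_left distrib_left)
  have "cone_gauss k d (vscale {..<Suc d} t s) = ennreal (sqrt t ^ card {..<d}) * 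
      (\<integral>\<^sup>+\<nu>. cone_ind k d (vscale {..<d} (sqrt t) \<nu>) * ennreal (exp (- qform d (vscale {..<Suc d} t s) (vscale {..<d} (sqrt t) \<nu>))) \<partial>leb {..<d})"
    unfolding cone_gauss_def using t by (intro nn_integral_leb_scale) auto
  then show ?thesis unfolding q using t by (simp add: cone_gauss_def cone_ind_vscale)
qed

lemma cone_gauss_full_pos_finite:
  assumes s: "\<And>i. i \<le> d \<Longrightarrow> s i > 0"
  shows "0 < cone_gauss (Suc d) d s" "cone_gauss (Suc d) d s < \<infinity>"
proof -
  have "(\<Sum>i<Suc d. s i) > 0" using s by (intro sum_pos) auto
  moreover have "(\<Prod>i<Suc d. s i) > 0" using s by (intro prod_pos) auto
  ultimately have "0 < sqrt pi ^ d * sqrt ((\<Prod>i<Suc d. s i) / (\<Sum>i<Suc d. s i))"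
    by (simp del: sum.lessThan_Suc prod.lessThan_Suc)
  then show "0 < cone_gauss (Suc d) d s" "cone_gauss (Suc d) d s < \<infinity>"
    by (simp_all add: cone_gauss_full[OF s] del: sum.lessThan_Suc prod.lessThan_Suc)
qed

text \<open>Conditional mean angle given the precisions. The indicator extends it by 0 beyond the
  positive orthant, so that it can be integrated over all of \<open>leb\<close>.\<close>

definition angle_ratio :: "nat \<Rightarrow> nat \<Rightarrow> (nat \<Rightarrow> real) \<Rightarrow> ennreal" where
  "angle_ratio k d s = pos_ind d s * (cone_gauss k d s / cone_gauss (Suc d) d s)"

lemma measurable_angle_ratio [measurable]: "angle_ratio k d \<in> borel_measurable (leb {..<Suc d})"
  unfolding angle_ratio_def by measurable

lemma angle_ratio_full: "angle_ratio (Suc d) d s = pos_ind d s"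
proof (rule pos_ind_cases[of d s])
  assume s: "\<And>i. i \<le> d \<Longrightarrow> s i > 0"
  from cone_gauss_full_pos_finite[of d s, OF s] show ?thesis
    by (simp add: angle_ratio_def ennreal_divide_self)
qed (simp add: angle_ratio_def)

lemma angle_ratio_scale:
  assumes t: "t > 0"
  shows "angle_ratio k d (vscale {..<Suc d} t s) = angle_ratio k d s"
proof -
  have "pos_ind d (vscale {..<Suc d} t s) = pos_ind d s"
    unfolding pos_ind_def using t by (intro prod.cong refl) (auto simp: vscale_def indicator_def zero_less_mult_iff)
  moreover have "ennreal (sqrt t ^ d) * a / (ennreal (sqrt t ^ d) * b) = a / b" for a b
    unfolding mult.commute[of "ennreal (sqrt t ^ d)"] using t by (intro divide_mult_eq) auto
  ultimately show ?thesis
    unfolding angle_ratio_def by (simp only: cone_gauss_scale[OF t])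
qed

text \<open>Insert the Gaussian mixture and exchange integrals. For fixed s the total mass of
  \<open>weight\<close> cancels the normalisers sqrt(s_i/pi)^d, and independent exponential
  precisions remain.\<close>

lemma nn_integral_angle_eq:
  assumes d: "1 \<le> d"
  shows "(\<integral>\<^sup>+x. (cone_mass k d x / cone_mass (Suc d) d x) * (\<Prod>i<Suc d. ennreal (beta'_density d (real d / 2 + 1) (\<lambda>j. x (i, j)))) \<partial>leb ({..<Suc d} \<times> {..<d}))
    = (\<integral>\<^sup>+s. ennreal (exp (- (\<Sum>i<Suc d. s i))) * angle_ratio k d s \<partial>leb {..<Suc d})"
proof -
  let ?K = "{..<Suc d} \<times> {..<d}" and ?N = "{..<Suc d}"
  define a where "a u = indicator {0<..} u * ennreal (sqrt (u / pi) ^ d * exp (- u))" for u :: real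
  have a [measurable]: "a \<in> borel_measurable borel" unfolding a_def by measurable
  have A [measurable]: "(\<lambda>s. \<Prod>i<Suc d. a (s i)) \<in> borel_measurable (leb ?N)"
    by (intro borel_measurable_prod_ennreal measurable_compose[OF measurable_component_singleton]) auto
  define r where "r x = cone_mass k d x / cone_mass (Suc d) d x" for x
  have r [measurable]: "r \<in> borel_measurable (leb ?K)" unfolding r_def by measurable
  have "(\<integral>\<^sup>+x. r x * (\<Prod>i<Suc d. ennreal (beta'_density d (real d / 2 + 1) (\<lambda>j. x (i, j)))) \<partial>leb ?K)
    = (\<integral>\<^sup>+x. \<integral>\<^sup>+s. r x * ((\<Prod>i<Suc d. a (s i)) * weight d s x) \<partial>leb ?N \<partial>leb ?K)"
  proof (rule nn_integral_cong)
    fix x assume x: "x \<in> space (leb ?K)"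
    have "(\<Prod>i<Suc d. ennreal (beta'_density d (real d / 2 + 1) (\<lambda>j. x (i, j))))
      = (\<Prod>i\<in>?N. \<integral>\<^sup>+u. a u * ennreal (exp (- (u * (\<Sum>j<d. (x (i, j))\<^sup>2)))) \<partial>lborel)"
      unfolding beta'_density_mixture a_def ..
    also have "\<dots> = (\<integral>\<^sup>+s. (\<Prod>i\<in>?N. a (s i) * ennreal (exp (- (s i * (\<Sum>j<d. (x (i, j))\<^sup>2))))) \<partial>leb ?N)"
      by (rule lborel_prod.product_nn_integral_prod[symmetric]) auto
    also have "\<dots> = (\<integral>\<^sup>+s. (\<Prod>i<Suc d. a (s i)) * weight d s x \<partial>leb ?N)"
      unfolding weight_eq_prod prod.distrib ..
    finally have e: "(\<Prod>i<Suc d. ennreal (beta'_density d (real d / 2 + 1) (\<lambda>j. x (i, j)))) = \<dots>" .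
    show "r x * (\<Prod>i<Suc d. ennreal (beta'_density d (real d / 2 + 1) (\<lambda>j. x (i, j)))) = (\<integral>\<^sup>+s. r x * ((\<Prod>i<Suc d. a (s i)) * weight d s x) \<partial>leb ?N)"
      unfolding e using x by (intro nn_integral_cmult[symmetric]) measurable
  qed
  also have "\<dots> = (\<integral>\<^sup>+s. \<integral>\<^sup>+x. r x * ((\<Prod>i<Suc d. a (s i)) * weight d s x) \<partial>leb ?K \<partial>leb ?N)"
    by (rule nn_integral_leb_swap) (simp, simp, measurable)
  also have "\<dots> = (\<integral>\<^sup>+s. ennreal (exp (- (\<Sum>i<Suc d. s i))) * angle_ratio k d s \<partial>leb ?N)"
  proof (rule nn_integral_cong)
    fix s assume ss: "s \<in> space (leb ?N)"
    have "(\<integral>\<^sup>+x. r x * ((\<Prod>i<Suc d. a (s i)) * weight d s x) \<partial>leb ?K) = (\<integral>\<^sup>+x. (\<Prod>i<Suc d. a (s i)) * (weight d s x * r x) \<partial>leb ?K)"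
      by (simp only: mult_ac)
    also have "\<dots> = (\<Prod>i<Suc d. a (s i)) * (\<integral>\<^sup>+x. weight d s x * r x \<partial>leb ?K)"
      by (rule nn_integral_cmult) measurable
    also have "\<dots> = ennreal (exp (- (\<Sum>i<Suc d. s i))) * angle_ratio k d s"
    proof (rule pos_ind_cases[of d s])
      assume s: "\<And>i. i \<le> d \<Longrightarrow> s i > 0" and p: "pos_ind d s = 1"
      note cg = cone_gauss_full_pos_finite[of d s, OF s]
      have "(\<integral>\<^sup>+x. weight d s x * r x \<partial>leb ?K) = ((\<integral>\<^sup>+x. weight d s x * r x \<partial>leb ?K) * cone_gauss (Suc d) d s) / cone_gauss (Suc d) d s"
        using cg by (intro mult_divide_eq_ennreal[symmetric]) auto
      also have "\<dots> = (cone_gauss k d s * (\<integral>\<^sup>+x. weight d s x \<partial>leb ?K)) / cone_gauss (Suc d) d s"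
        unfolding r_def using nn_integral_cone_ratio_weight[of d s k] s d by simp
      also have "\<dots> = (cone_gauss k d s / cone_gauss (Suc d) d s) * (\<Prod>i<Suc d. ennreal (sqrt (pi / s i) ^ d))"
      proof -
        have "a * w / b = a / b * w" for a w b :: ennreal by (simp add: divide_ennreal_def mult_ac)
        then show ?thesis using nn_integral_weight[of d s, OF s] by (simp only:)
      qed
      finally have 1: "(\<integral>\<^sup>+x. weight d s x * r x \<partial>leb ?K) = (cone_gauss k d s / cone_gauss (Suc d) d s) * (\<Prod>i<Suc d. ennreal (sqrt (pi / s i) ^ d))" .
      have "(\<Prod>i<Suc d. a (s i)) * (\<Prod>i<Suc d. ennreal (sqrt (pi / s i) ^ d)) = (\<Prod>i<Suc d. ennreal (exp (- s i)))"
        unfolding prod.distrib[symmetric]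
      proof (rule prod.cong[OF refl])
        fix i assume "i \<in> {..<Suc d}"
        then have si: "s i > 0" using s by auto
        have "sqrt (s i / pi) * sqrt (pi / s i) = 1" using si by (simp add: real_sqrt_mult[symmetric])
        then have "sqrt (s i / pi) ^ d * sqrt (pi / s i) ^ d = 1" by (metis power_mult_distrib power_one)
        then have "sqrt (s i / pi) ^ d * exp (- s i) * sqrt (pi / s i) ^ d = exp (- s i)"
          by (metis mult.commute mult.left_commute mult.right_neutral)
        then show "a (s i) * ennreal (sqrt (pi / s i) ^ d) = ennreal (exp (- s i))"
          using si by (simp add: a_def ennreal_mult'[symmetric])
      qed
      also have "\<dots> = ennreal (exp (- (\<Sum>i<Suc d. s i)))"
        by (simp only: prod_ennreal exp_ge_zero exp_sum[symmetric] finite_lessThan sum_negf)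
      finally have 2: "(\<Prod>i<Suc d. a (s i)) * (\<Prod>i<Suc d. ennreal (sqrt (pi / s i) ^ d)) = ennreal (exp (- (\<Sum>i<Suc d. s i)))" .
      show ?thesis unfolding 1 angle_ratio_def p 2[symmetric] by (simp only: mult_ac mult_1)
    next
      fix i assume i: "i \<le> d" "\<not> s i > 0" and p: "pos_ind d s = 0"
      then have "(\<Prod>i<Suc d. a (s i)) = 0"
        by (intro prod_zero bexI[of _ i]) (auto simp: a_def)
      then show ?thesis using p by (simp only: angle_ratio_def mult_zero_left mult_zero_right)
    qed
    finally show "(\<integral>\<^sup>+x. r x * ((\<Prod>i<Suc d. a (s i)) * weight d s x) \<partial>leb ?K) = ennreal (exp (- (\<Sum>i<Suc d. s i))) * angle_ratio k d s" .
  qed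
  finally show ?thesis unfolding r_def .
qed

lemma real_sqrt_prod: "sqrt (\<Prod>i\<in>A. f i) = (\<Prod>i\<in>A. sqrt (f i))"
  by (induction A rule: infinite_finite_induct) (auto simp: real_sqrt_mult)

text \<open>The weight 1/sqrt S cancels the sqrt S that comes from the denominator
  \<open>cone_gauss (Suc d) d s\<close>. Up to pi^(d/2), exp(-S)/sqrt P times the exponential of
  minus \<open>qform\<close> is left. This is a product over coordinates, so after a swap each s_i
  is integrated by \<open>nn_integral_exp_plus_inverse\<close>.\<close>

lemma nn_integral_angle_ratio_weighted:
  "(\<integral>\<^sup>+s. ennreal (exp (- (\<Sum>i<Suc d. s i)) / sqrt (\<Sum>i<Suc d. s i)) * angle_ratio k d s \<partial>leb {..<Suc d})
    = ennreal (sqrt pi) * cone_laplace k d"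
proof -
  let ?N = "{..<Suc d}" and ?L = "{..<d}"
  define h where "h u z = indicator {0<..} u * ennreal (exp (- u - z\<^sup>2 / u) / sqrt u)" for u z :: real
  have h [measurable]: "case_prod h \<in> borel_measurable (borel \<Otimes>\<^sub>M borel)" unfolding h_def by measurable
  have h_prod [measurable]: "(\<lambda>w. \<Prod>i<Suc d. h (fst w i) (zext d (snd w) i)) \<in> borel_measurable (leb ?N \<Otimes>\<^sub>M leb ?L)"
  proof (rule borel_measurable_prod_ennreal)
    fix i assume i: "i \<in> {..<Suc d}"
    have [measurable]: "(\<lambda>w. fst w i) \<in> borel_measurable (leb ?N \<Otimes>\<^sub>M leb ?L)"
      using i by (rule measurable_leb_component[OF measurable_fst])
    show "(\<lambda>w. h (fst w i) (zext d (snd w) i)) \<in> borel_measurable (leb ?N \<Otimes>\<^sub>M leb ?L)" by measurable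
  qed
  \<comment> \<open>Reciprocal of the factor pi^(d/2) in \<open>cone_gauss_full\<close>. The d + 1
    integrations over the s_i return sqrt pi each, so one sqrt pi survives.\<close>
  define c where "c = ennreal (1 / sqrt pi ^ d)"
  have "(\<integral>\<^sup>+s. ennreal (exp (- (\<Sum>i<Suc d. s i)) / sqrt (\<Sum>i<Suc d. s i)) * angle_ratio k d s \<partial>leb ?N)
    = (\<integral>\<^sup>+s. \<integral>\<^sup>+\<nu>. c * (cone_ind k d \<nu> * (\<Prod>i<Suc d. h (s i) (zext d \<nu> i))) \<partial>leb ?L \<partial>leb ?N)"
  proof (rule nn_integral_cong)
    fix s :: "nat \<Rightarrow> real" assume ss: "s \<in> space (leb ?N)"
    show "ennreal (exp (- (\<Sum>i<Suc d. s i)) / sqrt (\<Sum>i<Suc d. s i)) * angle_ratio k d s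
      = (\<integral>\<^sup>+\<nu>. c * (cone_ind k d \<nu> * (\<Prod>i<Suc d. h (s i) (zext d \<nu> i))) \<partial>leb ?L)"
    proof (rule pos_ind_cases[of d s])
      assume s: "\<And>i. i \<le> d \<Longrightarrow> s i > 0" and p: "pos_ind d s = 1"
      define S where "S = (\<Sum>i<Suc d. s i)"
      define P where "P = (\<Prod>i<Suc d. s i)"
      have S: "S > 0" unfolding S_def using s by (intro sum_pos) auto
      have P: "P > 0" unfolding P_def using s by (intro prod_pos) auto
      have prod_h: "(\<Prod>i<Suc d. h (s i) (zext d \<nu> i)) = ennreal (exp (- S) / sqrt P) * ennreal (exp (- qform d s \<nu>))" for \<nu>
      proof -
        have "(\<Prod>i<Suc d. h (s i) (zext d \<nu> i)) = (\<Prod>i<Suc d. ennreal (exp (- s i - (zext d \<nu> i)\<^sup>2 / s i) / sqrt (s i)))"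
          using s by (intro prod.cong refl) (auto simp: h_def)
        also have "\<dots> = ennreal (\<Prod>i<Suc d. exp (- s i - (zext d \<nu> i)\<^sup>2 / s i) / sqrt (s i))"
          using s by (intro prod_ennreal) (auto simp: less_imp_le)
        also have "(\<Prod>i<Suc d. exp (- s i - (zext d \<nu> i)\<^sup>2 / s i) / sqrt (s i)) = exp (- S - qform d s \<nu>) / sqrt P"
          unfolding prod_dividef S_def P_def qform_def
          by (simp only: exp_sum[symmetric] finite_lessThan sum_subtractf sum_negf real_sqrt_prod)
        also have "exp (- S - qform d s \<nu>) / sqrt P = exp (- S) / sqrt P * exp (- qform d s \<nu>)"
          by (simp add: exp_diff exp_minus divide_inverse)
        finally show ?thesis using P by (subst ennreal_mult'[symmetric]) auto
      qed
      have "(\<integral>\<^sup>+\<nu>. c * (cone_ind k d \<nu> * (\<Prod>i<Suc d. h (s i) (zext d \<nu> i))) \<partial>leb ?L)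
        = (\<integral>\<^sup>+\<nu>. c * ennreal (exp (- S) / sqrt P) * (cone_ind k d \<nu> * ennreal (exp (- qform d s \<nu>))) \<partial>leb ?L)"
        unfolding prod_h by (simp only: mult_ac)
      also have "\<dots> = c * ennreal (exp (- S) / sqrt P) * cone_gauss k d s"
        unfolding cone_gauss_def by (rule nn_integral_cmult) measurable
      finally have r: "(\<integral>\<^sup>+\<nu>. c * (cone_ind k d \<nu> * (\<Prod>i<Suc d. h (s i) (zext d \<nu> i))) \<partial>leb ?L) = c * ennreal (exp (- S) / sqrt P) * cone_gauss k d s" .
      define D where "D = sqrt pi ^ d * sqrt (P / S)"
      have D: "D > 0" using P S by (simp add: D_def)
      have cg: "cone_gauss (Suc d) d s = ennreal D" unfolding D_def P_def S_def by (rule cone_gauss_full[OF s])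
      have "exp (- S) / sqrt S * inverse D = 1 / sqrt pi ^ d * (exp (- S) / sqrt P)"
        using P S by (simp add: D_def real_sqrt_divide field_simps)
      then have "ennreal (exp (- S) / sqrt S) * ennreal (inverse D) = c * ennreal (exp (- S) / sqrt P)"
        unfolding c_def using S D by (simp only: ennreal_mult'[symmetric] divide_nonneg_pos exp_ge_zero real_sqrt_gt_zero zero_le_divide_1_iff zero_le_power real_sqrt_ge_zero pi_ge_zero)
      then show ?thesis
        unfolding r angle_ratio_def p cg divide_ennreal_def inverse_ennreal[OF D] S_def[symmetric] mult_1
        by (simp only: mult_ac) (metis mult.assoc mult.commute)
    next
      fix i assume i: "i \<le> d" "\<not> s i > 0" and p: "pos_ind d s = 0"
      then have z: "(\<Prod>i<Suc d. h (s i) (zext d \<nu> i)) = 0" for \<nu>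
        by (intro prod_zero bexI[of _ i]) (auto simp: h_def)
      show ?thesis unfolding z angle_ratio_def p by simp
    qed
  qed
  also have "\<dots> = (\<integral>\<^sup>+\<nu>. \<integral>\<^sup>+s. c * (cone_ind k d \<nu> * (\<Prod>i<Suc d. h (s i) (zext d \<nu> i))) \<partial>leb ?N \<partial>leb ?L)"
  proof (rule nn_integral_leb_swap)
    show "(\<lambda>(s, \<nu>). c * (cone_ind k d \<nu> * (\<Prod>i<Suc d. h (s i) (zext d \<nu> i)))) \<in> borel_measurable (leb ?N \<Otimes>\<^sub>M leb ?L)"
      unfolding case_prod_beta by measurable
  qed auto
  also have "\<dots> = (\<integral>\<^sup>+\<nu>. ennreal (sqrt pi) * (cone_ind k d \<nu> * (\<Prod>i<Suc d. ennreal (exp (- 2 * \<bar>zext d \<nu> i\<bar>)))) \<partial>leb ?L)"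
  proof (rule nn_integral_cong)
    fix \<nu> assume \<nu>: "\<nu> \<in> space (leb ?L)"
    have hm [measurable]: "(\<lambda>u. h u z) \<in> borel_measurable borel" for z unfolding h_def by measurable
    have "(\<integral>\<^sup>+s. c * (cone_ind k d \<nu> * (\<Prod>i<Suc d. h (s i) (zext d \<nu> i))) \<partial>leb ?N) = (c * cone_ind k d \<nu>) * (\<integral>\<^sup>+s. (\<Prod>i<Suc d. h (s i) (zext d \<nu> i)) \<partial>leb ?N)"
      unfolding mult.assoc[symmetric]
      by (intro nn_integral_cmult borel_measurable_prod_ennreal measurable_compose[OF measurable_component_singleton]) auto
    also have "(\<integral>\<^sup>+s. (\<Prod>i<Suc d. h (s i) (zext d \<nu> i)) \<partial>leb ?N) = (\<Prod>i<Suc d. \<integral>\<^sup>+u. h u (zext d \<nu> i) \<partial>lborel)"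
      by (rule lborel_prod.product_nn_integral_prod) auto
    also have "\<dots> = (\<Prod>i<Suc d. ennreal (sqrt pi) * ennreal (exp (- 2 * \<bar>zext d \<nu> i\<bar>)))"
      unfolding h_def nn_integral_exp_plus_inverse by (simp only: ennreal_mult' real_sqrt_ge_zero pi_ge_zero)
    also have "\<dots> = ennreal (sqrt pi ^ Suc d) * (\<Prod>i<Suc d. ennreal (exp (- 2 * \<bar>zext d \<nu> i\<bar>)))"
      by (simp only: prod.distrib prod_constant card_lessThan ennreal_power real_sqrt_ge_zero pi_ge_zero)
    also have "(c * cone_ind k d \<nu>) * \<dots> = (c * ennreal (sqrt pi ^ Suc d)) * (cone_ind k d \<nu> * (\<Prod>i<Suc d. ennreal (exp (- 2 * \<bar>zext d \<nu> i\<bar>))))"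
      by (simp only: mult_ac)
    also have "c * ennreal (sqrt pi ^ Suc d) = ennreal (sqrt pi)"
      unfolding c_def by (subst ennreal_mult'[symmetric]) auto
    finally show "(\<integral>\<^sup>+s. c * (cone_ind k d \<nu> * (\<Prod>i<Suc d. h (s i) (zext d \<nu> i))) \<partial>leb ?N) = ennreal (sqrt pi) * (cone_ind k d \<nu> * (\<Prod>i<Suc d. ennreal (exp (- 2 * \<bar>zext d \<nu> i\<bar>))))" .
  qed
  also have "\<dots> = ennreal (sqrt pi) * cone_laplace k d"
  proof -
    have [measurable]: "(\<lambda>\<nu>. \<Prod>i<Suc d. ennreal (exp (- 2 * \<bar>zext d \<nu> i\<bar>))) \<in> borel_measurable (leb ?L)"
      by (rule borel_measurable_prod_ennreal) measurable
    show ?thesis unfolding cone_laplace_def by (rule nn_integral_cmult) measurable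
  qed
  finally show ?thesis .
qed

lemma nn_integral_exp_pos_ind:
  "(\<integral>\<^sup>+s. ennreal (exp (- (\<Sum>i<Suc d. s i))) * pos_ind d s \<partial>leb {..<Suc d}) = 1"
proof -
  have one: "(\<integral>\<^sup>+u. ennreal (exp (- u)) * indicator {0<..} u \<partial>lborel) = 1"
  proof -
    have "(\<integral>\<^sup>+u. ennreal (exp (- u)) * indicator {0<..} u \<partial>lborel) = (\<integral>\<^sup>+u. ennreal (u ^ 0 * exp (- u)) * indicator {0..} u \<partial>lborel)"
      by (rule nn_integral_cong_AE, rule AE_mp[OF AE_lborel_singleton[of 0]]) (auto simp: indicator_def intro!: AE_I2)
    also have "\<dots> = 1" unfolding nn_intergal_power_times_exp_Ici by simp
    finally show ?thesis .
  qed
  have "(\<integral>\<^sup>+s. ennreal (exp (- (\<Sum>i<Suc d. s i))) * pos_ind d s \<partial>leb {..<Suc d})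
    = (\<integral>\<^sup>+s. (\<Prod>i<Suc d. ennreal (exp (- s i)) * indicator {0<..} (s i)) \<partial>leb {..<Suc d})"
    unfolding pos_ind_def prod.distrib
    by (simp only: prod_ennreal exp_ge_zero exp_sum[symmetric] finite_lessThan sum_negf)
  also have "\<dots> = (\<Prod>i<Suc d. \<integral>\<^sup>+u. ennreal (exp (- u)) * indicator {0<..} u \<partial>lborel)"
    by (rule lborel_prod.product_nn_integral_prod) auto
  finally show ?thesis unfolding one by simp
qed

text \<open>\<open>angle_ratio\<close> has degree 0 and S degree 1 in s, so exp(-S) can be traded
  for exp(-S)/sqrt S. The case k = d + 1, where \<open>angle_ratio\<close> is \<open>pos_ind\<close>
  and its exponential integral is 1, fixes the constant; the result is
  \<open>cone_laplace k d\<close> divided by \<open>cone_laplace (Suc d) d\<close>.\<close>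

lemma nn_integral_angle_ratio:
  assumes k: "1 \<le> k" "k \<le> Suc d"
  shows "(\<integral>\<^sup>+s. ennreal (exp (- (\<Sum>i<Suc d. s i))) * angle_ratio k d s \<partial>leb {..<Suc d})
    = ennreal (real ((d + k - 1) choose (k - 1)) / real ((2 * d) choose d))"
proof -
  let ?N = "{..<Suc d}"
  define S :: "(nat \<Rightarrow> real) \<Rightarrow> real" where "S s = (\<Sum>i<Suc d. s i)" for s
  have S [measurable]: "S \<in> borel_measurable (leb ?N)" 
    unfolding S_def by (intro borel_measurable_sum measurable_leb_component[OF measurable_ident_sets[OF refl]]) auto
  have S_scale: "S (vscale ?N t s) = t * S s" for t s
    unfolding S_def sum_distrib_left by (intro sum.cong refl) (simp add: vscale_def)
  have pos: "angle_ratio m d s = 0 \<or> S s > 0" for m s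
  proof (rule pos_ind_cases[of d s])
    assume s: "\<And>i. i \<le> d \<Longrightarrow> s i > 0"
    have "S s > 0" unfolding S_def using s by (intro sum_pos) auto
    then show ?thesis ..
  qed (simp add: angle_ratio_def)
  have ratio: "(\<integral>\<^sup>+s. ennreal (exp (- S s)) * angle_ratio k d s \<partial>leb ?N) * (\<integral>\<^sup>+s. ennreal (exp (- S s) / sqrt (S s)) * angle_ratio (Suc d) d s \<partial>leb ?N)
    = (\<integral>\<^sup>+s. ennreal (exp (- S s) / sqrt (S s)) * angle_ratio k d s \<partial>leb ?N) * (\<integral>\<^sup>+s. ennreal (exp (- S s)) * angle_ratio (Suc d) d s \<partial>leb ?N)"
    by (rule nn_integral_homogeneous_ratio[where N=S and \<phi>="\<lambda>u. ennreal (exp (- u))" and \<xi>="\<lambda>u. ennreal (exp (- u) / sqrt u)"])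
       (use S_scale angle_ratio_scale pos in auto)
  have eq: "(\<integral>\<^sup>+s. ennreal (exp (- S s)) * angle_ratio k d s \<partial>leb ?N) * (ennreal (sqrt pi) * cone_laplace (Suc d) d)
    = ennreal (sqrt pi) * cone_laplace k d * 1"
    using ratio[unfolded S_def, unfolded nn_integral_angle_ratio_weighted, unfolded angle_ratio_full nn_integral_exp_pos_ind]
    unfolding S_def .
  define C where "C = real ((2 * d) choose d)"
  define c where "c = real ((d + k - 1) choose (k - 1))"
  have C: "C > 0" by (simp add: C_def)
  have Cn: "cone_laplace (Suc d) d = ennreal (C / 4 ^ d)" using cone_laplace_eq[of "Suc d" d] by (simp add: C_def mult_2)
  have Ck: "cone_laplace k d = ennreal (c / 4 ^ d)" using cone_laplace_eq[OF k] by (simp add: c_def)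
  define b where "b = ennreal (sqrt pi * (C / 4 ^ d))"
  have b: "b \<noteq> 0" "b \<noteq> \<top>" using C by (auto simp: b_def)
  define R where "R = (\<integral>\<^sup>+s. ennreal (exp (- S s)) * angle_ratio k d s \<partial>leb ?N)"
  have "R * b = ennreal (sqrt pi * (c / 4 ^ d))"
    using eq unfolding Cn Ck R_def[symmetric] b_def
    by (simp only: ennreal_mult' real_sqrt_ge_zero pi_ge_zero mult_1_right)
  then have "R = ennreal (sqrt pi * (c / 4 ^ d)) / b" using mult_divide_eq_ennreal[OF b, of R] by simp
  also have "\<dots> = ennreal (c / C)" unfolding b_def using C by (subst divide_ennreal) (auto simp: c_def)
  finally show ?thesis by (simp only: R_def S_def c_def C_def)
qed

lemma expected_angle_eq:
  assumes k: "1 \<le> k" "k \<le> d"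
  shows "expected_angle (Suc d) k ((real (Suc d) + 1) / 2) = real ((d + k - 1) choose (k - 1)) / real ((2 * d) choose d)"
proof -
  let ?I = "{..<Suc d}" and ?J = "{..<d}"
  have \<beta>: "(real (Suc d) + 1) / 2 = real d / 2 + 1" by (simp add: field_simps)
  define F where "F x = (cone_mass k d x / cone_mass (Suc d) d x) * (\<Prod>i<Suc d. ennreal (beta'_density d (real d / 2 + 1) (\<lambda>j. x (i, j))))" for x
  have dens_meas: "(\<lambda>x. beta'_density d b (\<lambda>j. x (i, j))) \<in> borel_measurable (leb (?I \<times> ?J))" if "i \<in> ?I" for i b
  proof -
    have [measurable]: "(\<lambda>x. \<Sum>j<d. (x (i, j))\<^sup>2) \<in> borel_measurable (leb (?I \<times> ?J))"
      using that by (intro borel_measurable_sum borel_measurable_power measurable_leb_component[OF measurable_ident_sets[OF refl]]) auto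
    show ?thesis unfolding beta'_density_def by measurable
  qed
  have [measurable]: "(\<lambda>x. \<Prod>i<Suc d. ennreal (beta'_density d (real d / 2 + 1) (\<lambda>j. x (i, j)))) \<in> borel_measurable (leb (?I \<times> ?J))"
    by (intro borel_measurable_prod_ennreal measurable_compose[OF dens_meas]) auto
  have F [measurable]: "F \<in> borel_measurable (leb (?I \<times> ?J))" unfolding F_def by measurable
  have dens_nonneg: "0 \<le> beta'_density d (real d / 2 + 1) y" for y
    unfolding beta'_density_def beta'_const_def by (intro mult_nonneg_nonneg divide_nonneg_nonneg) (auto simp: Gamma_real_pos less_imp_le)
  have "(\<integral>\<^sup>+X. ennreal (internal_angle d X {..<k} ?I * (\<Prod>i<Suc d. beta'_density d (real d / 2 + 1) (X i))) \<partial>PiM ?I (\<lambda>_. leb ?J))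
    = (\<integral>\<^sup>+X. F (flatten ?I ?J X) \<partial>PiM ?I (\<lambda>_. leb ?J))"
  \<comment> \<open>Degenerate configurations are discarded here, as \<open>internal_angle\<close>
    is controlled only for affinely independent points. \<open>F\<close> is a measurable integrand
    that agrees with the given one almost everywhere.\<close>
  proof (rule nn_integral_cong_AE, rule AE_mp[OF AE_flatten[OF _ _ AE_det_edge_mat_nonzero[OF order_refl]]])
    show "AE X in PiM ?I (\<lambda>_. leb ?J). det (edge_mat d d (flatten ?I ?J X)) \<noteq> 0 \<longrightarrow>
      ennreal (internal_angle d X {..<k} ?I * (\<Prod>i<Suc d. beta'_density d (real d / 2 + 1) (X i))) = F (flatten ?I ?J X)"
    proof (intro AE_I2 impI)
      fix X assume det: "det (edge_mat d d (flatten ?I ?J X)) \<noteq> 0"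
      note ang = internal_angle_eq_cone_mass[OF det k]
      have d: "beta'_density d (real d / 2 + 1) (X i) = beta'_density d (real d / 2 + 1) (\<lambda>j. flatten ?I ?J X (i, j))" if "i < Suc d" for i
        using that by (simp add: beta'_density_def flatten_def)
      have "ennreal (internal_angle d X {..<k} ?I * (\<Prod>i<Suc d. beta'_density d (real d / 2 + 1) (X i)))
        = ennreal (internal_angle d X {..<k} ?I) * (\<Prod>i<Suc d. ennreal (beta'_density d (real d / 2 + 1) (X i)))"
        using ang(1) by (simp only: ennreal_mult' prod_ennreal dens_nonneg)
      also have "\<dots> = F (flatten ?I ?J X)"
        unfolding F_def ang(2) by (intro arg_cong2[where f="(*)"] refl prod.cong) (simp add: d)
      finally show "ennreal (internal_angle d X {..<k} ?I * (\<Prod>i<Suc d. beta'_density d (real d / 2 + 1) (X i))) = F (flatten ?I ?J X)" .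
    qed
  qed auto
  also have "\<dots> = (\<integral>\<^sup>+x. F x \<partial>leb (?I \<times> ?J))" by (rule nn_integral_flatten) auto
  also have "\<dots> = ennreal (real ((d + k - 1) choose (k - 1)) / real ((2 * d) choose d))"
  proof -
    have d: "1 \<le> d" using k by simp
    show ?thesis unfolding F_def nn_integral_angle_eq[OF d] by (rule nn_integral_angle_ratio) (use k in auto)
  qed
  finally show ?thesis
    unfolding expected_angle_def \<beta> by (simp add: Rsp_eq_leb)
qed

section \<open>Binomial arithmetic and the final formula\<close>

lemma binomial_angle_identity:
  assumes k: "1 \<le> k" "k \<le> d"
  shows "real ((2 * Suc d) choose Suc d) * (real (Suc d choose k) * (real ((d + k - 1) choose (k - 1)) / real ((2 * d) choose d)))
    = real (Suc d choose k) * real ((Suc d + k) choose k) - real ((d - 1) choose k) * real ((d - 1 + k) choose k)"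
proof -
  obtain m where m: "d + k = Suc m" using k by (cases "d + k") auto
  obtain j where j: "k = Suc j" using k by (cases k) auto
  obtain e where e: "d = k + e" using k le_Suc_ex by blast
  \<comment> \<open>With e = d - k, all products of binomials are multiples of T = (d + k -
    1)!/(k!^2 (d - k + 1)!). The claim then reduces to (d + k + 1)(d + k) - (e + 1) e = 2 (2d + 1)
    k.\<close>
  define T :: real where "T = fact m / (fact k * fact k * fact (Suc e))"
  have A: "real (Suc d choose k) * real ((Suc d + k) choose k) = T * (real (d + k) + 1) * real (d + k)"
  proof -
    have 1: "real (Suc d choose k) = fact (Suc d) / (fact k * fact (Suc e))" using e by (simp add: binomial_fact)
    have "Suc (Suc m) - k = Suc d" using m by simp
    then have 2: "real ((Suc d + k) choose k) = fact (Suc (Suc m)) / (fact k * fact (Suc d))" 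
      using m by (subst binomial_fact) (auto simp del: fact_Suc)
    show ?thesis unfolding 1 2 T_def m by (simp add: field_simps del: fact_Suc) (simp add: field_simps)
  qed
  have B: "real ((d - 1) choose k) * real ((d - 1 + k) choose k) = T * (real e + 1) * real e"
  \<comment> \<open>For e = 0, that is k = d, the first binomial is 0 and is not a quotient of
    factorials.\<close>
  proof (cases e)
    case 0
    then show ?thesis using e k by simp
  next
    case (Suc e')
    have 1: "real ((d - 1) choose k) = fact (d - 1) / (fact k * fact e')" using e Suc by (simp add: binomial_fact)
    have "d - 1 + k = m" using m k by simp
    then have 2: "real ((d - 1 + k) choose k) = fact m / (fact k * fact (d - 1))" 
      by (subst binomial_fact) (auto simp del: fact_Suc)
    have 3: "fact (Suc e) = (real e + 1) * real e * fact e'" using Suc by simp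
    have alg: "x / (y * z) * (u / (y * x)) = u / (y * y * (p * q * z)) * p * q" 
      if "x \<noteq> 0" "y \<noteq> 0" "z \<noteq> 0" "p \<noteq> 0" "q \<noteq> 0" for x y z u p q :: real
      using that by (simp add: field_simps)
    have "real e \<noteq> 0" "real e + 1 \<noteq> 0" using Suc by simp_all
    then show ?thesis unfolding 1 2 T_def 3 by (intro alg) simp_all
  qed
  have C: "real (Suc d choose k) * real ((d + k - 1) choose (k - 1)) = T * (real d + 1) * real k"
  proof -
    have 1: "real (Suc d choose k) = fact (Suc d) / (fact k * fact (Suc e))" using e by (simp add: binomial_fact)
    have 2: "real ((d + k - 1) choose (k - 1)) = fact m / (fact (k - 1) * fact d)"
      using m j by (subst binomial_fact) (auto simp del: fact_Suc)
    have 3: "fact k = real k * fact (k - 1)" using j by simp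
    have 4: "fact (Suc d) = (real d + 1) * fact d" by simp
    have alg: "D * x / (q * y * z) * (u / (y * x)) = u / (q * y * (q * y) * z) * D * q" 
      if "x \<noteq> 0" "y \<noteq> 0" "z \<noteq> 0" "q \<noteq> 0" for x y z u q D :: real
      using that by (simp add: field_simps)
    have "real k \<noteq> 0" using k by simp
    then show ?thesis unfolding 1 2 T_def 3 4 by (intro alg) simp_all
  qed
  have D: "real ((2 * Suc d) choose Suc d) / real ((2 * d) choose d) = 2 * (2 * real d + 1) / (real d + 1)"
  proof -
    have 1: "real ((2 * Suc d) choose Suc d) = fact (Suc (Suc (2 * d))) / (fact (Suc d) * fact (Suc d))"
      by (subst binomial_fact) (auto simp del: fact_Suc simp: mult_2)
    have 2: "real ((2 * d) choose d) = fact (2 * d) / (fact d * fact d)"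
      by (subst binomial_fact) (auto simp: mult_2)
    have 3: "fact (Suc d) = (real d + 1) * fact d" by simp
    have 4: "fact (Suc (Suc (2 * d))) = 2 * (real d + 1) * (2 * real d + 1) * fact (2 * d)"
      by (simp add: algebra_simps)
    have alg: "2 * D * w * f / (D * x * (D * x)) / (f / (x * x)) = 2 * w / D"
      if "x \<noteq> 0" "f \<noteq> 0" "D \<noteq> 0" for x f D w :: real
      using that by (simp add: field_simps)
    show ?thesis unfolding 1 2 3 4 by (intro alg) (simp_all add: add_nonneg_eq_0_iff)
  qed
  have "real ((2 * Suc d) choose Suc d) * (real (Suc d choose k) * (real ((d + k - 1) choose (k - 1)) / real ((2 * d) choose d)))
    = real ((2 * Suc d) choose Suc d) / real ((2 * d) choose d) * (real (Suc d choose k) * real ((d + k - 1) choose (k - 1)))"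
    by simp
  also have "\<dots> = T * (2 * (2 * real d + 1) * real k)" unfolding C D by simp
  also have "\<dots> = T * (real (d + k) + 1) * real (d + k) - T * (real e + 1) * real e"
    by (simp add: e algebra_simps)
  finally show ?thesis unfolding A B .
qed

theorem theorem2p4:
  fixes n k :: nat
  assumes "1 \<le> k" and "k \<le> n"
  shows "real ((2 * n) choose n) * J_tilde n k ((real n + 1) / 2)
         = real (n choose k) * real ((n + k) choose k)
           - ((real n - 2) gchoose k) * ((real n - 2 + real k) gchoose k)"
proof (cases "k = n")
  case True
  have "((real n - 2) gchoose n) * ((real n - 2 + real n) gchoose n) = 0"
  \<comment> \<open>For n = 1 the first factor is -1 and the second, 0 over 1, vanishes. For n >= 2
    the first factor vanishes because n - 2 < n.\<close>
  proof (cases "n = 1")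
    case False
    then have "2 \<le> n" using assms by linarith
    then have "real n - 2 = real (n - 2)" by (simp add: of_nat_diff)
    then have "(real n - 2) gchoose n = real ((n - 2) choose n)" by (simp only: binomial_gbinomial)
    also have "\<dots> = 0" using False assms by simp
    finally have "(real n - 2) gchoose n = 0" .
    then show ?thesis by simp
  qed simp
  then show ?thesis unfolding True J_tilde_def mult_2 by simp
next
  case False
  then obtain d where n: "n = Suc d" and k: "1 \<le> k" "k \<le> d" using assms by (cases n) auto
  \<comment> \<open>Now n = d + 1 >= 2, so n - 2 = d - 1 is a natural number and the generalised
    binomials are ordinary ones.\<close>
  have g1: "(real n - 2) gchoose k = real ((d - 1) choose k)"
    using k n by (simp add: binomial_gbinomial of_nat_diff)
  have "real n - 2 + real k = real (d - 1 + k)" using k n by (simp add: of_nat_diff)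
  then have g2: "(real n - 2 + real k) gchoose k = real ((d - 1 + k) choose k)"
    by (simp only: binomial_gbinomial)
  show ?thesis
    unfolding g1 g2 using False binomial_angle_identity[OF k]
    by (simp only: n J_tilde_def if_False expected_angle_eq[OF k])
qed

end
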